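(* Let $\lambda_1,\lambda_2,\omega,Z$ be real numbers with $\lambda_1>0$, $\omega<0$ and either (i) $\lambda_2>0$ and $\frac{Z^2}{4}<-\omega$, or (ii) $\lambda_2<0$ and $\frac{Z^2}{4}<-\omega<-\frac{3\lambda_1^2}{16\lambda_2}$. Let $\mathcal{L}_{1,Z}$ be the self-adjoint operator defined in the context and let $n(\mathcal{L}_{1,Z})$ denote its number of negative eigenvalues. Then: 1. If $Z<0$, then $n(\mathcal{L}_{1,Z})=2$. 2. If $Z>0$, then $n(\mathcal{L}_{1,Z})=1$.
   Context: Put $\alpha=\lambda_1/4$, $\beta=\lambda_2/3$ and $$\phi_{\omega,Z}(x)=\left[-\frac{\alpha}{\omega}+\frac{\sqrt{\alpha^2-\beta\omega}}{-\omega}\cosh\left(2\sqrt{-\omega}\left(|x|+R^{-1}\left(\frac{Z}{2\sqrt{-\omega}}\right)\right)\right)\right]^{-1/2},$$ where $R:(-\infty,\infty)\to(-1,1)$ is the diffeomorphism $$R(s)=\frac{\sqrt{\alpha^2-\beta\omega}\,\sinh(2\sqrt{-\omega}s)}{\alpha+\sqrt{\alpha^2-\beta\omega}\,\cosh(2\sqrt{-\omega}s)}.$$ The operator $\mathcal{L}_{1,Z}$ on $L^2(\mathbb{R})$ acts, for $x\neq0$, by $$\mathcal{L}_{1,Z}=-\frac{d^2}{dx^2}-\omega-3\lambda_1\phi_{\omega,Z}^2-5\lambda_2\phi_{\omega,Z}^4$$ on the domain $D_Z=\{g\in H^1(\mathbb{R})\cap H^2(\mathbb{R}\setminus\{0\}):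 g'(0+)-g'(0-)=-Zg(0)\}$. Negative eigenvalues are counted with multiplicity. *)

theory Defs
  imports "HOL-Analysis.Analysis"
begin

section \<open>Square-integrable functions and Sobolev spaces on open subsets of the line\<close>

text \<open>
  Elements of \<open>L\<^sup>2(\<Omega>)\<close> are represented by complex-valued functions, which are only meaningful
  up to equality almost everywhere on \<open>\<Omega>\<close>; values outside \<open>\<Omega>\<close> are irrelevant.
\<close>

definition L2_on :: "real set \<Rightarrow> (real \<Rightarrow> complex) set" where
  "L2_on \<Omega> = {g. set_borel_measurable lborel \<Omega> g \<and> set_integrable lborel \<Omega> (\<lambda>x. (cmod (g x))\<^sup>2)}"

definition test_functions :: "real set \<Rightarrow> (real \<Rightarrow> real) set" where
  "test_functions \<Omega> = {\<theta>. \<theta> C1_differentiable_on UNIV \<and>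
     compact (closure {x. \<theta> x \<noteq> 0}) \<and> closure {x. \<theta> x \<noteq> 0} \<subseteq> \<Omega>}"

text \<open>
  \<open>C\<^sup>1\<close> test functions of compact support define the same weak derivatives as
  \<open>C\<^sup>\<infinity>\<close> ones; this is the usual convention for Sobolev spaces in dimension one.
\<close>

definition has_weak_deriv :: "real set \<Rightarrow> (real \<Rightarrow> complex) \<Rightarrow> (real \<Rightarrow> complex) \<Rightarrow> bool" where
  "has_weak_deriv \<Omega> g h \<longleftrightarrow> g \<in> L2_on \<Omega> \<and> h \<in> L2_on \<Omega> \<and>
     (\<forall>\<theta>\<in>test_functions \<Omega>.
        (LINT x:\<Omega>|lborel. deriv \<theta> x *\<^sub>R g x) = - (LINT x:\<Omega>|lborel. \<theta> x *\<^sub>R h x))"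

text \<open>The weak derivative is unique only almost everywhere, so a representative is chosen.\<close>

definition weak_deriv :: "real set \<Rightarrow> (real \<Rightarrow> complex) \<Rightarrow> (real \<Rightarrow> complex)" where
  "weak_deriv \<Omega> g = (SOME h. has_weak_deriv \<Omega> g h)"

definition H1_on :: "real set \<Rightarrow> (real \<Rightarrow> complex) set" where
  "H1_on \<Omega> = {g \<in> L2_on \<Omega>. \<exists>h. has_weak_deriv \<Omega> g h}"

definition H2_on :: "real set \<Rightarrow> (real \<Rightarrow> complex) set" where
  "H2_on \<Omega> = {g \<in> H1_on \<Omega>. weak_deriv \<Omega> g \<in> H1_on \<Omega>}"

text \<open>
  The continuous representative on an open set is unique there; it exists for \<open>H\<^sup>1\<close> functions.
  Pointwise values and one-sided limits always refer to it.
\<close>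

definition cont_rep :: "real set \<Rightarrow> (real \<Rightarrow> complex) \<Rightarrow> (real \<Rightarrow> complex)" where
  "cont_rep \<Omega> g = (SOME c. continuous_on \<Omega> c \<and> (AE x\<in>\<Omega> in lborel. c x = g x))"

definition trace_right :: "(real \<Rightarrow> complex) \<Rightarrow> complex" where
  "trace_right g = Lim (at_right 0) (cont_rep {0<..} g)"

definition trace_left :: "(real \<Rightarrow> complex) \<Rightarrow> complex" where
  "trace_left g = Lim (at_left 0) (cont_rep {..<0} g)"


section \<open>Eigenvalues of operators in the complex Hilbert space of square-integrable functions\<close>

text \<open>
  An operator is given by its domain \<open>D\<close> and its action \<open>A\<close>; all notions respect
  equality almost everywhere. Only real eigenvalues are considered, which are all the
  eigenvalues when the operator is self-adjoint.
\<close>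

definition eigenspace ::
  "(real \<Rightarrow> complex) set \<Rightarrow> ((real \<Rightarrow> complex) \<Rightarrow> (real \<Rightarrow> complex)) \<Rightarrow> real \<Rightarrow> (real \<Rightarrow> complex) set" where
  "eigenspace D A \<mu> = {g \<in> D. AE x in lborel. A g x = of_real \<mu> * g x}"

definition is_eigenvalue ::
  "(real \<Rightarrow> complex) set \<Rightarrow> ((real \<Rightarrow> complex) \<Rightarrow> (real \<Rightarrow> complex)) \<Rightarrow> real \<Rightarrow> bool" where
  "is_eigenvalue D A \<mu> \<longleftrightarrow> (\<exists>g\<in>eigenspace D A \<mu>. \<not> (AE x in lborel. g x = 0))"

definition ae_independent :: "(real \<Rightarrow> complex) set \<Rightarrow> bool" where
  "ae_independent B \<longleftrightarrow>
     (\<forall>c :: (real \<Rightarrow> complex) \<Rightarrow> complex.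
        (AE x in lborel. (\<Sum>b\<in>B. c b * b x) = 0) \<longrightarrow> (\<forall>b\<in>B. c b = 0))"

text \<open>The complex dimension, possibly infinite, of a space of functions modulo null functions.\<close>

definition ae_dim :: "(real \<Rightarrow> complex) set \<Rightarrow> enat" where
  "ae_dim V = (SUP B\<in>{B. finite B \<and> B \<subseteq> V \<and> ae_independent B}. enat (card B))"

definition num_neg_eigenvalues ::
  "(real \<Rightarrow> complex) set \<Rightarrow> ((real \<Rightarrow> complex) \<Rightarrow> (real \<Rightarrow> complex)) \<Rightarrow> enat" where
  "num_neg_eigenvalues D A =
     (\<Sum>\<^sub>\<infinity>\<mu>\<in>{\<mu>. \<mu> < 0 \<and> is_eigenvalue D A \<mu>}. ae_dim (eigenspace D A \<mu>))"


section \<open>The standing wave profile and the linearised operator\<close>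

definition Rfun :: "real \<Rightarrow> real \<Rightarrow> real \<Rightarrow> real \<Rightarrow> real" where
  "Rfun l1 l2 \<omega> s =
     (let \<alpha> = l1 / 4; \<beta> = l2 / 3 in
       sqrt (\<alpha>\<^sup>2 - \<beta> * \<omega>) * sinh (2 * sqrt (- \<omega>) * s) /
       (\<alpha> + sqrt (\<alpha>\<^sup>2 - \<beta> * \<omega>) * cosh (2 * sqrt (- \<omega>) * s)))"

text \<open>
  \<open>Rfun l1 l2 \<omega>\<close> is injective with range \<open>{-1<..<1}\<close> for the admissible parameters, so \<open>inv\<close>
  below is the genuine inverse at its argument, which lies in \<open>{-1<..<1}\<close>.
\<close>

definition profile :: "real \<Rightarrow> real \<Rightarrow> real \<Rightarrow> real \<Rightarrow> real \<Rightarrow> real" where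
  "profile l1 l2 \<omega> Z x =
     (let \<alpha> = l1 / 4; \<beta> = l2 / 3 in
       (- \<alpha> / \<omega> + sqrt (\<alpha>\<^sup>2 - \<beta> * \<omega>) / (- \<omega>) *
          cosh (2 * sqrt (- \<omega>) * (\<bar>x\<bar> + inv (Rfun l1 l2 \<omega>) (Z / (2 * sqrt (- \<omega>))))))
       powr (- 1 / 2))"

definition delta_domain :: "real \<Rightarrow> (real \<Rightarrow> complex) set" where
  "delta_domain Z = {g \<in> H1_on UNIV \<inter> H2_on (- {0}).
     trace_right (weak_deriv (- {0}) g) - trace_left (weak_deriv (- {0}) g)
       = - of_real Z * cont_rep UNIV g 0}"

definition L1_op ::
  "real \<Rightarrow> real \<Rightarrow> real \<Rightarrow> real \<Rightarrow> (real \<Rightarrow> complex) \<Rightarrow> (real \<Rightarrow> complex)" where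
  "L1_op l1 l2 \<omega> Z g = (\<lambda>x.
     - weak_deriv (- {0}) (weak_deriv (- {0}) g) x
     - of_real (\<omega> + 3 * l1 * (profile l1 l2 \<omega> Z x)\<^sup>2 + 5 * l2 * (profile l1 l2 \<omega> Z x) ^ 4) * g x)"

end

theory Submission
  imports Defs
begin

text \<open>
  Put \<open>s = sqrt (- \<omega>)\<close>. The profile satisfies \<open>\<phi> x = \<Phi> (\<bar>x\<bar> + a)\<close>, where \<open>\<Phi>\<close> is the even soliton on the
  whole line and \<open>a\<close> has the sign of \<open>Z\<close>, and \<open>Z / 2 = - \<Phi>' a / \<Phi> a\<close>. On each side of the origin the
  operator is thus \<open>- d\<^sup>2/dx\<^sup>2 + s\<^sup>2 - W\<close> with the well \<open>W\<close> of the soliton, seen from the point \<open>a\<close>.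

  At the energy \<open>s\<^sup>2 - \<kappa>\<^sup>2\<close> with \<open>\<kappa> > s\<close>, the square-integrable solutions on the half line are the multiples
  of the Jost function \<open>f\<^sub>\<kappa>\<close>, the solution behaving like \<open>exp (- \<kappa> * y)\<close> (\<open>half_line_solution\<close>). An
  eigenfunction consists of a multiple of \<open>f\<^sub>\<kappa> (a + x)\<close> on the right and one of \<open>f\<^sub>\<kappa> (a - x)\<close> on the
  left, and the conditions at the origin leave two cases: it is odd and \<open>f\<^sub>\<kappa> a = 0\<close>, or it is even and
  \<open>f\<^sub>\<kappa>' a + Z / 2 * f\<^sub>\<kappa> a = 0\<close> (\<open>eigenfunction_structure\<close>). Every such \<open>\<kappa>\<close> gives a simple eigenvalue
  (\<open>eigenspace_line\<close>), so the theorem becomes a count of these Dirichlet and Robin rates. There is always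
  exactly one Robin rate (\<open>Robin_unique\<close>). There is exactly one Dirichlet rate if \<open>a < 0\<close>, and none if
  \<open>a > 0\<close> (\<open>Dirichlet_unique\<close>, \<open>Dirichlet_none\<close>).

  Everything rests on the zero mode \<open>\<Phi>'\<close>, which solves the equation at energy zero and vanishes exactly at
  the crest \<open>y = 0\<close>; the crest belongs to the half line \<open>y > a\<close> precisely when \<open>a < 0\<close>.

  Existence of the rates is the intermediate value theorem in \<open>\<kappa>\<close>. For large \<open>\<kappa>\<close> the well is negligible,
  and at \<open>\<kappa> = s\<close> the Jost function is a multiple of \<open>\<Phi>'\<close> (\<open>jost_zero_energy\<close>), so the signs there are
  explicit; for the Robin condition the sign comes from \<open>(\<Phi>' / \<Phi>)' < 0\<close> (\<open>Robin_positive\<close>).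

  Uniqueness is a comparison with the zero mode (\<open>Sturm_Picone\<close>). Two Dirichlet rates, or two Robin rates,
  would admit a nontrivial combination \<open>g\<close> of their Jost functions that vanishes at the crest, or at \<open>a\<close> if
  \<open>a > 0\<close>. With the Riccati function \<open>r = \<Phi>'' / \<Phi>'\<close>, the quadratic form of the operator at \<open>g\<close> is the
  integral of \<open>(g' - r * g)\<^sup>2\<close> plus a nonnegative boundary term, whereas on a combination of orthogonal
  eigenfunctions with negative eigenvalues it is negative.
\<close>

section \<open>Recognising functions by their integrals\<close>

lemma le_one_plus_square: "t \<le> 1 + t\<^sup>2" for t :: real
  using sum_squares_ge_zero[of "t - 1/2" 0] by (simp add: power2_eq_square algebra_simps)

lemma L2_on_imp_set_integrable:
  assumes "h \<in> L2_on \<Omega>" "{a..b::real} \<subseteq> \<Omega>"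
  shows "set_integrable lborel {a..b} h"
proof -
  let ?k = "\<lambda>x. indicator {a..b} x *\<^sub>R (1::real) + indicator {a..b} x *\<^sub>R (cmod (h x))\<^sup>2"
  have m: "set_borel_measurable lborel {a..b} h"
    by (rule set_borel_measurable_subset[OF _ _ assms(2)]) (use assms in \<open>auto simp: L2_on_def\<close>)
  have "set_integrable lborel {a..b} (\<lambda>x. (cmod (h x))\<^sup>2)"
    by (rule set_integrable_subset[OF _ _ assms(2)]) (use assms in \<open>auto simp: L2_on_def\<close>)
  moreover have "set_integrable lborel {a..b} (\<lambda>x. 1::real)"
    by (rule borel_integrable_atLeastAtMost') auto
  ultimately have i: "integrable lborel ?k"
    unfolding set_integrable_def by (rule Bochner_Integration.integrable_add[rotated])
  show ?thesis unfolding set_integrable_def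
  proof (rule Bochner_Integration.integrable_bound[OF i])
    show "(\<lambda>x. indicator {a..b} x *\<^sub>R h x) \<in> borel_measurable lborel"
      using m by (simp add: set_borel_measurable_def)
    show "AE x in lborel. norm (indicat_real {a..b} x *\<^sub>R h x) \<le> norm (?k x)"
      by (auto simp: indicator_def le_one_plus_square intro!: AE_I2)
  qed
qed

lemma set_integrable_continuous_scaleR:
  fixes h :: "real \<Rightarrow> 'a::{banach, second_countable_topology}"
  assumes h: "set_integrable lborel {a..b} h" and c: "continuous_on {a..b} \<psi>"
  shows "set_integrable lborel {a..b} (\<lambda>x. (\<psi> x :: real) *\<^sub>R h x)"
proof -
  obtain M where M: "\<And>x. x \<in> {a..b} \<Longrightarrow> norm (\<psi> x) \<le> M"
    using compact_imp_bounded[OF compact_continuous_image[OF c compact_Icc]]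
    unfolding bounded_iff by blast
  have e: "(\<lambda>x. indicator {a..b} x *\<^sub>R (\<psi> x *\<^sub>R h x)) = (\<lambda>x. (indicator {a..b} x *\<^sub>R \<psi> x) *\<^sub>R (indicator {a..b} x *\<^sub>R h x))"
    by (auto simp: indicator_def)
  have m: "(\<lambda>x. indicator {a..b} x *\<^sub>R \<psi> x) \<in> borel_measurable lborel"
    using borel_integrable_atLeastAtMost'[OF c] by (auto simp: set_integrable_def)
  have mh: "(\<lambda>x. indicator {a..b} x *\<^sub>R h x) \<in> borel_measurable lborel"
    using h by (auto simp: set_integrable_def)
  show ?thesis unfolding set_integrable_def
  proof (rule Bochner_Integration.integrable_bound)
    show "integrable lborel (\<lambda>x. M *\<^sub>R (indicator {a..b} x *\<^sub>R h x))"
      using h unfolding set_integrable_def by (rule integrable_scaleR_right)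
    show "(\<lambda>x. indicat_real {a..b} x *\<^sub>R \<psi> x *\<^sub>R h x) \<in> borel_measurable lborel"
      unfolding e by (intro borel_measurable_scaleR m mh)
    show "AE x in lborel. norm (indicat_real {a..b} x *\<^sub>R \<psi> x *\<^sub>R h x) \<le> norm (M *\<^sub>R indicat_real {a..b} x *\<^sub>R h x)"
    proof (rule AE_I2)
      fix x show "norm (indicat_real {a..b} x *\<^sub>R \<psi> x *\<^sub>R h x) \<le> norm (M *\<^sub>R indicat_real {a..b} x *\<^sub>R h x)"
        using M[of x] by (auto simp: indicator_def intro!: mult_right_mono)
    qed
  qed
qed

text \<open>
  The sets over which the extended function integrates to zero form a Dynkin system; it contains the open
  intervals, hence all Borel sets, and a function with vanishing integrals over all sets is null.
\<close>
lemma zero_interval_integrals_AE: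
  fixes j :: "real \<Rightarrow> 'a::{banach, second_countable_topology}"
  assumes i: "set_integrable lborel {a..b} j"
    and z: "\<And>c d. a \<le> c \<Longrightarrow> c \<le> d \<Longrightarrow> d \<le> b \<Longrightarrow> (LINT x:{c..d}|lborel. j x) = 0"
  shows "AE x\<in>{a..b} in lborel. j x = 0"
proof -
  define f where "f = (\<lambda>x. indicator {a..b} x *\<^sub>R j x)"
  have f: "integrable lborel f" using i by (simp add: set_integrable_def f_def)
  have f': "set_integrable lborel A f" if "A \<in> sets borel" for A
    using f that integrable_mult_indicator[of A lborel f] by (simp add: set_integrable_def)
  have tot: "integral\<^sup>L lborel f = 0"
  proof (cases "a \<le> b")
    case True
    then show ?thesis using z[of a b] by (simp add: f_def set_lebesgue_integral_def)
  next
    case False then show ?thesis by (simp add: f_def)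
  qed
  have "set_lebesgue_integral lborel A f = 0" if A: "A \<in> sets lborel" for A
  proof -
    have int: "Int_stable (range (\<lambda>(c, d). box c d :: real set))"
      by (auto simp: Int_stable_def box_Int_box)
    have sp: "range (\<lambda>(c, d). box c d :: real set) \<subseteq> Pow UNIV" by auto
    have "A \<in> sigma_sets UNIV (range (\<lambda>(c, d). box c d))"
       using A sets_measure_of[OF sp] by (simp only: sets_lborel borel_eq_box)
    from int sp this show ?thesis
    proof (induction rule: sigma_sets_induct_disjoint)
      case (basic A)
      then obtain c d where A: "A = {c<..<d}" by auto
      have "set_lebesgue_integral lborel A f = (LINT x:{max a c..min b d}|lborel. j x)"
        unfolding set_lebesgue_integral_def
      proof (rule Bochner_Integration.integral_cong_AE)
        show "(\<lambda>x. indicat_real A x *\<^sub>R f x) \<in> borel_measurable lborel"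
          using f'[of A] A by (auto simp: set_integrable_def)
        have "set_integrable lborel {max a c..min b d} j"
          by (rule set_integrable_subset[OF i]) auto
        then show "(\<lambda>x. indicat_real {max a c..min b d} x *\<^sub>R j x) \<in> borel_measurable lborel"
          by (auto simp: set_integrable_def)
        have "AE x in lborel. x \<noteq> c \<and> x \<noteq> d" using AE_lborel_singleton[of c] AE_lborel_singleton[of d] by auto
        then show "AE x in lborel. indicat_real A x *\<^sub>R f x = indicat_real {max a c..min b d} x *\<^sub>R j x"
          by eventually_elim (auto simp: f_def A indicator_def)
      qed
      also have "\<dots> = 0"
        by (cases "max a c \<le> min b d") (use z[of "max a c" "min b d"] in \<open>auto simp: set_lebesgue_integral_def\<close>)
      finally show ?case .
    next
      case empty then show ?case by (simp add: set_lebesgue_integral_def)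
    next
      case (compl A)
      then have Ab: "A \<in> sets borel" using sets_measure_of[OF sp] by (simp only: borel_eq_box)
      have "set_lebesgue_integral lborel (A \<union> (UNIV - A)) f = set_lebesgue_integral lborel A f + set_lebesgue_integral lborel (UNIV - A) f"
        by (rule set_integral_Un) (use Ab f' in auto)
      moreover have "A \<union> (UNIV - A) = UNIV" by auto
      ultimately show ?case using tot compl by (simp add: set_lebesgue_integral_def)
    next
      case (union A)
      then have Ab: "A i \<in> sets borel" for i using sets_measure_of[OF sp] by (simp only: borel_eq_box) blast
      have "set_lebesgue_integral lborel (\<Union>i. A i) f = (\<Sum>i. set_lebesgue_integral lborel (A i) f)"
        by (rule lebesgue_integral_countable_add) (use Ab f' union(1) in \<open>auto simp: disjoint_family_on_def\<close>)
      then show ?case using union by simp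
    qed
  qed
  then have "AE x in lborel. f x = 0"
    by (rule sigma_finite_measure.density_zero[OF lborel.sigma_finite_measure_axioms f])
  then show ?thesis
    by eventually_elim (auto simp: f_def indicator_def)
qed

lemma AE_on_open_if_AE_on_Icc:
  assumes "open \<Omega>" and "\<And>a b. {a..b::real} \<subseteq> \<Omega> \<Longrightarrow> AE x\<in>{a..b} in lborel. P x"
  shows "AE x\<in>\<Omega> in lborel. P x"
proof -
  let ?S = "{(p,q). p \<in> \<rat> \<and> q \<in> \<rat> \<and> {p..q::real} \<subseteq> \<Omega>}"
  have "countable ?S" by (rule countable_subset[of _ "\<rat> \<times> \<rat>"]) (auto intro: countable_rat)
  then have "AE x in lborel. \<forall>pq\<in>?S. x \<in> {fst pq..snd pq} \<longrightarrow> P x"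
    by (subst AE_ball_countable) (use assms(2) in auto)
  then show ?thesis
  proof eventually_elim
    case (elim x)
    show ?case
    proof
      assume "x \<in> \<Omega>"
      then obtain e where e: "e > 0" "\<And>y. \<bar>y - x\<bar> < e \<Longrightarrow> y \<in> \<Omega>"
        using assms(1) unfolding open_real by auto
      obtain p where p: "p \<in> \<rat>" "x - e < p" "p < x" using Rats_dense_in_real[of "x-e" x] e by auto
      obtain q where q: "q \<in> \<rat>" "x < q" "q < x + e" using Rats_dense_in_real[of x "x+e"] e by auto
      have "(p,q) \<in> ?S" using p q by (auto intro!: e(2))
      then show "P x" using elim p q by force
    qed
  qed
qed

lemma real_antiderivative:
  fixes f :: "real \<Rightarrow> real"
  assumes "continuous_on UNIV f"
  obtains F where "\<And>x. (F has_real_derivative f x) (at x)"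
proof -
  have "\<exists>F. \<forall>x. (-\<infinity>::ereal) < ereal x \<longrightarrow> ereal x < \<infinity> \<longrightarrow> (F has_vector_derivative f x) (at x)"
    by (rule einterval_antiderivative) (use assms in \<open>auto simp: continuous_on_eq_continuous_at\<close>)
  then show ?thesis using that by (auto simp: has_real_derivative_iff_has_vector_derivative)
qed

text \<open>
  The mean-zero condition is what lets the antiderivative that starts at zero on the left of the support
  return to zero on the right of it, and so be a test function.
\<close>
lemma test_function_of_zero_mean:
  fixes \<psi> :: "real \<Rightarrow> real"
  assumes c: "continuous_on UNIV \<psi>" and ab: "a \<le> b" "{a..b} \<subseteq> \<Omega>"
    and z: "\<And>x. x \<notin> {a..b} \<Longrightarrow> \<psi> x = 0" and m: "integral {a..b} \<psi> = 0"
  obtains \<theta> where "\<theta> \<in> test_functions \<Omega>" "\<And>x. deriv \<theta> x = \<psi> x"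
    "\<And>x. x \<notin> {a..b} \<Longrightarrow> \<theta> x = 0" "\<And>x. (\<theta> has_real_derivative \<psi> x) (at x)" "continuous_on UNIV \<theta>"
proof -
  obtain F where F: "\<And>x. (F has_real_derivative \<psi> x) (at x)" using real_antiderivative[OF c] by blast
  define \<theta> where "\<theta> x = F x - F a" for x
  have d: "(\<theta> has_real_derivative \<psi> x) (at x)" for x
    unfolding \<theta>_def by (auto intro!: derivative_eq_intros F)
  have ftc: "integral {x..y} \<psi> = \<theta> y - \<theta> x" if "x \<le> y" for x y
    by (rule integral_unique, rule fundamental_theorem_of_calculus[OF that])
      (use d in \<open>auto simp: has_real_derivative_iff_has_vector_derivative has_vector_derivative_at_within\<close>)
  have out: "\<theta> x = 0" if "x \<notin> {a..b}" for x
  proof (cases "x < a")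
    case True
    have "integral {x..a} \<psi> = 0"
    proof -
      have "integral {x..a} \<psi> = integral {x..a} (\<lambda>_. 0)"
        by (rule integral_spike[of "{a}"]) (use z in auto)
      then show ?thesis by simp
    qed
    with ftc[of x a] True show ?thesis by (simp add: \<theta>_def)
  next
    case False
    with that have x: "x > b" by auto
    have "integral {b..x} \<psi> = integral {b..x} (\<lambda>_. 0)"
      by (rule integral_spike[of "{b}"]) (use z in auto)
    with ftc[of b x] x have "\<theta> x = \<theta> b" by simp
    also have "\<dots> = 0" using ftc[OF ab(1)] m by (simp add: \<theta>_def)
    finally show ?thesis .
  qed
  have cl: "closure {x. \<theta> x \<noteq> 0} \<subseteq> {a..b}"
    by (rule closure_minimal) (use out in blast, simp)
  have "\<theta> C1_differentiable_on UNIV"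
    unfolding C1_differentiable_on_def
    by (rule exI[of _ \<psi>]) (use d c in \<open>auto simp: has_real_derivative_iff_has_vector_derivative\<close>)
  moreover have "compact (closure {x. \<theta> x \<noteq> 0})"
    using bounded_subset[OF compact_imp_bounded[OF compact_Icc] cl] by (simp add: compact_eq_bounded_closed)
  ultimately have "\<theta> \<in> test_functions \<Omega>"
    using cl ab by (auto simp: test_functions_def)
  moreover have "deriv \<theta> x = \<psi> x" for x using d by (rule DERIV_imp_deriv)
  moreover have "continuous_on UNIV \<theta>" using d by (meson DERIV_isCont continuous_at_imp_continuous_on)
  ultimately show ?thesis using that out d by blast
qed


lemma set_integral_scaleR_vector:
  fixes k :: "'a::{banach, second_countable_topology}"
  assumes "set_integrable M S f"
  shows "(LINT x:S|M. f x *\<^sub>R k) = (LINT x:S|M. f x) *\<^sub>R k"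
proof -
  have "(LINT x|M. (indicat_real S x *\<^sub>R f x) *\<^sub>R k) = (LINT x|M. indicat_real S x *\<^sub>R f x) *\<^sub>R k"
    by (rule integral_scaleR_left) (use assms in \<open>simp add: set_integrable_def\<close>)
  then show ?thesis by (simp add: set_lebesgue_integral_def)
qed

lemma LINT_Icc_extend:
  assumes "{a..b::real} \<subseteq> {A..B}" "\<And>x. x \<notin> {a..b} \<Longrightarrow> f x = 0"
  shows "(LINT x:{A..B}|lborel. f x) = (LINT x:{a..b}|lborel. f x)"
  unfolding set_lebesgue_integral_def
  by (rule Bochner_Integration.integral_cong) (use assms in \<open>auto simp: indicator_def\<close>)

text \<open>
  Trapezoids of slope \<open>n\<close> converge to the indicator of a compact interval, so by dominated convergence
  the integrals over intervals vanish.
\<close>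
lemma fundamental_lemma_calculus_of_variations:
  fixes j :: "real \<Rightarrow> 'a::{banach, second_countable_topology}"
  assumes op: "open \<Omega>" and i: "\<And>a b. {a..b} \<subseteq> \<Omega> \<Longrightarrow> set_integrable lborel {a..b} j"
    and z: "\<And>\<psi> a b. continuous_on UNIV \<psi> \<Longrightarrow> a \<le> b \<Longrightarrow> {a..b} \<subseteq> \<Omega> \<Longrightarrow> (\<And>x. x \<notin> {a..b} \<Longrightarrow> \<psi> x = 0)
       \<Longrightarrow> (LINT x:{a..b}|lborel. (\<psi> x :: real) *\<^sub>R j x) = 0"
  shows "AE x\<in>\<Omega> in lborel. j x = 0"
proof (rule AE_on_open_if_AE_on_Icc[OF op])
  fix a b :: real assume ab: "{a..b} \<subseteq> \<Omega>"
  show "AE x\<in>{a..b} in lborel. j x = 0"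
  proof (rule zero_interval_integrals_AE[OF i[OF ab]])
    fix p q :: real assume pq: "a \<le> p" "p \<le> q" "q \<le> b"
    then have pqO: "{p..q} \<subseteq> \<Omega>" using ab by auto
    obtain d where d: "d > 0" "{p-d..q+d} \<subseteq> \<Omega>"
    proof -
      have "p \<in> \<Omega>" "q \<in> \<Omega>" using pqO pq by auto
      then obtain e1 e2 where e: "e1 > 0" "\<And>y. \<bar>y - p\<bar> < e1 \<Longrightarrow> y \<in> \<Omega>" "e2 > 0" "\<And>y. \<bar>y - q\<bar> < e2 \<Longrightarrow> y \<in> \<Omega>"
        using op unfolding open_real by meson
      show ?thesis
      proof (rule that[of "min e1 e2 / 2"])
        show "{p - min e1 e2 / 2..q + min e1 e2 / 2} \<subseteq> \<Omega>"
        proof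
          fix x assume x: "x \<in> {p - min e1 e2 / 2..q + min e1 e2 / 2}"
          show "x \<in> \<Omega>"
            by (cases "x < p"; cases "x > q") (use x e pqO in auto)
        qed
      qed (use e in auto)
    qed
    \<comment> \<open>Only the trapezoids with \<open>n \<ge> N\<close> are supported within distance \<open>d\<close> of the interval.\<close>
    define \<psi> where "\<psi> n x = max 0 (min 1 (min (1 + real n * (x - p)) (1 + real n * (q - x))))" for n x
    obtain N where N: "real N * d \<ge> 1" "N > 0"
    proof -
      obtain N where "1 / d < real N" using reals_Archimedean2 by blast
      then show ?thesis using d that[of N] by (cases N) (auto simp: field_simps)
    qed
    have out: "\<psi> n x = 0" if "n \<ge> N" "x \<notin> {p-d..q+d}" for n x
    proof -
      have n: "real n * d \<ge> 1" using N that d by (meson mult_right_mono of_nat_mono order_trans less_imp_le)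
      have "x < p - d \<or> q + d < x" using that by auto
      then consider "x - p \<le> - d" | "q - x \<le> - d" by linarith
      then show ?thesis
      proof cases
        case 1
        then have "real n * (x - p) \<le> real n * (- d)" by (intro mult_left_mono) auto
        with n show ?thesis by (auto simp: \<psi>_def)
      next
        case 2
        then have "real n * (q - x) \<le> real n * (- d)" by (intro mult_left_mono) auto
        with n show ?thesis by (auto simp: \<psi>_def)
      qed
    qed
    have cont: "continuous_on UNIV (\<psi> n)" for n
      unfolding \<psi>_def by (intro continuous_intros)
    have lim: "(\<lambda>n. \<psi> n x) \<longlonglongrightarrow> indicator {p..q} x" for x
    proof (cases "x \<in> {p..q}")
      case True then show ?thesis by (auto simp: \<psi>_def)
    next
      case False
      have "\<forall>\<^sub>F n in sequentially. \<psi> n x = 0"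
      proof -
        define e where "e = max (p - x) (x - q)"
        have e: "e > 0" using False by (auto simp: e_def)
        obtain M where M: "1 / e < real M" using reals_Archimedean2 by blast
        have "\<psi> n x = 0" if "n \<ge> M" for n
        proof -
          have n: "real n * e \<ge> 1" using M that e by (meson divide_less_eq less_le_trans less_imp_le mult_right_mono of_nat_mono)
          consider "x - p = - e" | "q - x = - e" unfolding e_def by linarith
          then show ?thesis using n by cases (auto simp: \<psi>_def)
        qed
        then show ?thesis unfolding eventually_sequentially by blast
      qed
      then show ?thesis using False by (simp add: tendsto_eventually)
    qed
    let ?J = "{p-d..q+d}"
    have iJ: "set_integrable lborel ?J j" using i d by blast
    have "(\<lambda>n. LINT x:?J|lborel. \<psi> (n+N) x *\<^sub>R j x) \<longlonglongrightarrow> (LINT x:?J|lborel. indicat_real {p..q} x *\<^sub>R j x)"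
      unfolding set_lebesgue_integral_def
    proof (rule integral_dominated_convergence)
      show "integrable lborel (\<lambda>x. norm (indicat_real ?J x *\<^sub>R j x))"
        using integrable_norm[OF iJ[unfolded set_integrable_def]] .
      show "(\<lambda>x. indicat_real ?J x *\<^sub>R (\<psi> (i+N) x *\<^sub>R j x)) \<in> borel_measurable lborel" for i
        using set_integrable_continuous_scaleR[OF iJ continuous_on_subset[OF cont]]
        by (simp add: set_integrable_def)
      have "set_integrable lborel {p..q} j" using i pqO by blast
      then have "(\<lambda>x. indicat_real {p..q} x *\<^sub>R j x) \<in> borel_measurable lborel" by (simp add: set_integrable_def)
      moreover have "(\<lambda>x. indicat_real {p..q} x *\<^sub>R j x) = (\<lambda>x. indicat_real ?J x *\<^sub>R (indicat_real {p..q} x *\<^sub>R j x))"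
        using d by (auto simp: indicator_def)
      ultimately show "(\<lambda>x. indicat_real ?J x *\<^sub>R (indicat_real {p..q} x *\<^sub>R j x)) \<in> borel_measurable lborel" by simp
      show "AE x in lborel. (\<lambda>i. indicat_real ?J x *\<^sub>R \<psi> (i + N) x *\<^sub>R j x) \<longlonglongrightarrow> indicat_real ?J x *\<^sub>R indicat_real {p..q} x *\<^sub>R j x"
        using LIMSEQ_ignore_initial_segment[OF lim, of N] by (auto intro!: AE_I2 tendsto_intros)
      show "AE x in lborel. norm (indicat_real ?J x *\<^sub>R \<psi> (i + N) x *\<^sub>R j x) \<le> norm (indicat_real ?J x *\<^sub>R j x)" for i
      proof (rule AE_I2)
        fix x
        have "\<bar>\<psi> (i+N) x\<bar> \<le> 1" by (auto simp: \<psi>_def)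
        then show "norm (indicat_real ?J x *\<^sub>R \<psi> (i + N) x *\<^sub>R j x) \<le> norm (indicat_real ?J x *\<^sub>R j x)"
          by (auto simp: indicator_def intro: mult_left_le_one_le)
      qed
    qed
    moreover have "(LINT x:?J|lborel. \<psi> (n+N) x *\<^sub>R j x) = 0" for n
      by (rule z) (use cont d pq out in auto)
    ultimately have "0 = (LINT x:?J|lborel. indicat_real {p..q} x *\<^sub>R j x)"
      by (simp add: LIMSEQ_const_iff)
    also have "(LINT x:?J|lborel. indicat_real {p..q} x *\<^sub>R j x) = (LINT x:{p..q}|lborel. j x)"
      unfolding set_lebesgue_integral_def
      by (rule Bochner_Integration.integral_cong) (use d in \<open>auto simp: indicator_def\<close>)
    finally show "(LINT x:{p..q}|lborel. j x) = 0" by simp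
  qed
qed

text \<open>
  Subtracting from \<open>\<psi>\<close> the multiple of a fixed bump \<open>\<psi>0\<close> with the same mean gives an admissible
  function. Hence \<open>j\<close> integrates against \<open>\<psi>\<close> like the constant \<open>k\<close>, its integral against the bump.
\<close>
lemma du_Bois_Reymond:
  fixes j :: "real \<Rightarrow> 'a::{banach, second_countable_topology}"
  assumes op: "open I" and iv: "is_interval I" and i: "\<And>a b. {a..b} \<subseteq> I \<Longrightarrow> set_integrable lborel {a..b} j"
    and z: "\<And>\<psi> a b. continuous_on UNIV \<psi> \<Longrightarrow> a \<le> b \<Longrightarrow> {a..b} \<subseteq> I \<Longrightarrow> (\<And>x. x \<notin> {a..b} \<Longrightarrow> \<psi> x = 0)
       \<Longrightarrow> integral {a..b} \<psi> = 0 \<Longrightarrow> (LINT x:{a..b}|lborel. (\<psi> x :: real) *\<^sub>R j x) = 0"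
  shows "\<exists>k. AE x\<in>I in lborel. j x = k"
proof (cases "I = {}")
  case True then show ?thesis by simp
next
  case False
  then obtain y where "y \<in> I" by auto
  then obtain e where e: "e > 0" "\<And>x. \<bar>x - y\<bar> < e \<Longrightarrow> x \<in> I" using op unfolding open_real by auto
  define a0 b0 where "a0 = y" and "b0 = y + e/2"
  have ab0: "a0 < b0" "{a0..b0} \<subseteq> I" using e by (auto simp: a0_def b0_def)
  define \<tau> where "\<tau> x = max 0 ((x - a0) * (b0 - x))" for x
  have \<tau>c: "continuous_on S \<tau>" for S unfolding \<tau>_def by (intro continuous_intros)
  have \<tau>0: "\<tau> x = 0" if "x \<notin> {a0..b0}" for x
    using that ab0 mult_nonneg_nonpos2[of "b0 - x" "x - a0"] mult_nonneg_nonpos[of "x - a0" "b0 - x"]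
    by (auto simp: \<tau>_def max_def mult.commute)
  define m where "m = integral {a0..b0} \<tau>"
  have m: "m > 0"
  proof -
    have "m \<ge> 0" unfolding m_def by (rule integral_nonneg) (auto intro!: integrable_continuous_real \<tau>c simp: \<tau>_def)
    moreover have "m \<noteq> 0"
    proof
      assume "m = 0"
      then have "\<forall>x\<in>{a0..b0}. \<tau> x = 0"
        unfolding m_def using integral_eq_0_iff[OF \<tau>c ab0(1)] by (auto simp: \<tau>_def)
      then have "\<tau> ((a0+b0)/2) = 0" using ab0 by auto
      moreover have "\<tau> ((a0+b0)/2) = ((b0-a0)/2)^2"
      proof -
        have "((a0+b0)/2 - a0) * (b0 - (a0+b0)/2) = ((b0-a0)/2)^2"
          by (simp add: power2_eq_square field_simps)
        then show ?thesis by (simp add: \<tau>_def)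
      qed
      ultimately show False using ab0 by auto
    qed
    ultimately show ?thesis by auto
  qed
  define \<psi>0 where "\<psi>0 x = \<tau> x / m" for x
  have c0: "continuous_on S \<psi>0" for S unfolding \<psi>0_def using m by (intro continuous_intros \<tau>c) auto
  have m0: "integral {a0..b0} \<psi>0 = 1" using m by (simp add: \<psi>0_def[abs_def] m_def)
  have z0: "\<psi>0 x = 0" if "x \<notin> {a0..b0}" for x using \<tau>0[OF that] by (simp add: \<psi>0_def)
  define k where "k = (LINT x:{a0..b0}|lborel. \<psi>0 x *\<^sub>R j x)"
  have "AE x\<in>I in lborel. j x - k = 0"
  proof (rule fundamental_lemma_calculus_of_variations[OF op])
    have ck: "set_integrable lborel {a..b} (\<lambda>x. k)" for a b :: real
      by (rule borel_integrable_atLeastAtMost') auto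
    show "set_integrable lborel {a..b} (\<lambda>x. j x - k)" if "{a..b} \<subseteq> I" for a b
      by (rule set_integral_diff(1)[OF i[OF that] ck])
    fix \<psi> :: "real \<Rightarrow> real" and a b
    assume c: "continuous_on UNIV \<psi>" and ab: "a \<le> b" "{a..b} \<subseteq> I" and out: "\<And>x. x \<notin> {a..b} \<Longrightarrow> \<psi> x = 0"
    define A B where "A = min a a0" and "B = max b b0"
    have sub: "{a..b} \<subseteq> {A..B}" "{a0..b0} \<subseteq> {A..B}" by (auto simp: A_def B_def)
    have AI: "A \<in> I" "B \<in> I" using ab ab0 by (auto simp: A_def B_def min_def max_def)
    have AB: "{A..B} \<subseteq> I" using mem_is_interval_1_I[OF iv AI] by auto
    have AB': "A \<le> B" using ab by (auto simp: A_def B_def)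
    define M where "M = integral {a..b} \<psi>"
    have ext: "integral {A..B} f = integral {p..q} f" if "{p..q} \<subseteq> {A..B}" "\<And>x. x \<notin> {p..q} \<Longrightarrow> f x = 0" for f :: "real \<Rightarrow> real" and p q
      by (rule integral_spike_set) (rule negligible_subset[of "{}"]; use that in auto)+
    have cS: "continuous_on S \<psi>" for S using c continuous_on_subset by blast
    have cd: "continuous_on S (\<lambda>x. \<psi> x - M * \<psi>0 x)" for S by (intro continuous_intros cS c0)
    have "integral {A..B} (\<lambda>x. \<psi> x - M * \<psi>0 x) = integral {A..B} \<psi> - integral {A..B} (\<lambda>x. M * \<psi>0 x)"
      by (rule integral_diff) (intro integrable_continuous_real continuous_intros c0 cS)+
    also have "\<dots> = 0" using ext[OF sub(1) out] ext[OF sub(2) z0] m0 by (simp add: M_def)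
    finally have "(LINT x:{A..B}|lborel. (\<psi> x - M * \<psi>0 x) *\<^sub>R j x) = 0"
      by (intro z AB AB' cd) (use sub out z0 in auto)
    moreover have "(LINT x:{A..B}|lborel. (\<psi> x - M * \<psi>0 x) *\<^sub>R j x) =
       (LINT x:{A..B}|lborel. \<psi> x *\<^sub>R j x - M *\<^sub>R (\<psi>0 x *\<^sub>R j x))"
      by (simp add: scaleR_left_diff_distrib)
    moreover have "\<dots> = (LINT x:{A..B}|lborel. \<psi> x *\<^sub>R j x) - (LINT x:{A..B}|lborel. M *\<^sub>R (\<psi>0 x *\<^sub>R j x))"
      by (rule set_integral_diff(2)) (intro set_integrable_continuous_scaleR continuous_on_const i AB cS c0)+
    moreover have "(LINT x:{A..B}|lborel. \<psi> x *\<^sub>R j x) = (LINT x:{a..b}|lborel. \<psi> x *\<^sub>R j x)"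
      by (rule LINT_Icc_extend[OF sub(1)]) (use out in auto)
    moreover have "(LINT x:{A..B}|lborel. M *\<^sub>R (\<psi>0 x *\<^sub>R j x)) = M *\<^sub>R (LINT x:{A..B}|lborel. \<psi>0 x *\<^sub>R j x)"
      by (rule set_integral_scaleR_right)
    moreover have "(LINT x:{A..B}|lborel. \<psi>0 x *\<^sub>R j x) = k"
      unfolding k_def by (rule LINT_Icc_extend[OF sub(2)]) (use z0 in auto)
    ultimately have 1: "(LINT x:{a..b}|lborel. \<psi> x *\<^sub>R j x) = M *\<^sub>R k" by simp
    have "set_integrable lborel {a..b} \<psi>" by (rule borel_integrable_atLeastAtMost'[OF cS])
    then have "(LINT x:{a..b}|lborel. \<psi> x *\<^sub>R k) = M *\<^sub>R k"
      using set_borel_integral_eq_integral(2)[of "{a..b}" \<psi>] set_integral_scaleR_vector[of lborel "{a..b}" \<psi> k] by (simp add: M_def)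
    moreover have "(LINT x:{a..b}|lborel. \<psi> x *\<^sub>R (j x - k)) = (LINT x:{a..b}|lborel. \<psi> x *\<^sub>R j x) - (LINT x:{a..b}|lborel. \<psi> x *\<^sub>R k)"
      unfolding scaleR_right_diff_distrib
      by (rule set_integral_diff(2)) (auto intro!: set_integrable_continuous_scaleR i ab cS ck)
    ultimately show "(LINT x:{a..b}|lborel. \<psi> x *\<^sub>R (j x - k)) = 0" using 1 by simp
  qed
  then show ?thesis by (intro exI[of _ k]) (auto elim: eventually_mono)
qed

text \<open>
  Integration by parts for an absolutely continuous factor: both sides are the integral of
  \<open>\<psi> x *\<^sub>R h t\<close> over the triangle \<open>a \<le> t \<le> x \<le> b\<close>.
\<close>
lemma Fubini_primitive:
  fixes h :: "real \<Rightarrow> 'a::{banach, second_countable_topology}"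
  assumes h: "set_integrable lborel {a..b} h" and d: "\<And>x. (\<theta> has_real_derivative \<psi> x) (at x)"
    and c: "continuous_on UNIV \<psi>" and ab: "a \<le> b"
  shows "(LINT x:{a..b}|lborel. \<psi> x *\<^sub>R (LINT t:{a..x}|lborel. h t)) = (LINT t:{a..b}|lborel. (\<theta> b - \<theta> t) *\<^sub>R h t)"
proof -
  define k where "k t = indicator {a..b} t *\<^sub>R h t" for t
  define p where "p x = indicator {a..b} x * \<psi> x" for x
  define f where "f x t = indicator {z. snd z \<le> fst z} (x, t) *\<^sub>R (p x *\<^sub>R k t)" for x t
  have k: "integrable lborel k" using h by (simp add: set_integrable_def k_def[abs_def])
  have p: "integrable lborel p" using borel_integrable_atLeastAtMost'[OF continuous_on_subset[OF c], of a b]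
    by (simp add: set_integrable_def p_def[abs_def])
  have [measurable]: "k \<in> borel_measurable borel" "p \<in> borel_measurable borel" using k p by auto
  have S: "{z. snd z \<le> fst z} \<in> sets (borel :: (real \<times> real) measure)"
    by (intro borel_closed closed_Collect_le continuous_intros)
  have ip: "integrable (lborel \<Otimes>\<^sub>M lborel) (\<lambda>(x,t). p x *\<^sub>R k t)"
  proof (rule lborel_pair.Fubini_integrable)
    show "(\<lambda>(x, t). p x *\<^sub>R k t) \<in> borel_measurable (lborel \<Otimes>\<^sub>M lborel)" by measurable
    show "integrable lborel (\<lambda>x. \<integral>y. norm (case (x, y) of (x, t) \<Rightarrow> p x *\<^sub>R k t) \<partial>lborel)"
      using p k by simp
    show "AE x in lborel. integrable lborel (\<lambda>y. case (x, y) of (x, t) \<Rightarrow> p x *\<^sub>R k t)"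
      using k by simp
  qed
  have "integrable (lborel \<Otimes>\<^sub>M lborel) (\<lambda>z. indicator {z. snd z \<le> fst z} z *\<^sub>R (case z of (x,t) \<Rightarrow> p x *\<^sub>R k t))"
    by (rule integrable_mult_indicator[OF _ ip]) (use S in \<open>simp add: borel_prod[symmetric]\<close>)
  moreover have "(\<lambda>z. indicator {z. snd z \<le> fst z} z *\<^sub>R (case z of (x,t) \<Rightarrow> p x *\<^sub>R k t)) = case_prod f"
    by (auto simp: f_def fun_eq_iff)
  ultimately have "integrable (lborel \<Otimes>\<^sub>M lborel) (case_prod f)" by simp
  from lborel_pair.Fubini_integral[OF this]
  have F: "(LINT t|lborel. LINT x|lborel. f x t) = (LINT x|lborel. LINT t|lborel. f x t)" .
  have 1: "(LINT t|lborel. f x t) = indicator {a..b} x *\<^sub>R (\<psi> x *\<^sub>R (LINT t:{a..x}|lborel. h t))" for x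
  proof -
    have "(LINT t|lborel. f x t) = (LINT t|lborel. p x *\<^sub>R (indicator {a..x} t *\<^sub>R h t))"
      by (rule Bochner_Integration.integral_cong) (auto simp: f_def p_def k_def indicator_def)
    also have "\<dots> = p x *\<^sub>R (LINT t:{a..x}|lborel. h t)"
      unfolding set_lebesgue_integral_def by (rule integral_scaleR_right)
    finally show ?thesis by (simp add: p_def)
  qed
  have 2: "(LINT x|lborel. f x t) = indicator {a..b} t *\<^sub>R ((\<theta> b - \<theta> t) *\<^sub>R h t)" for t
  proof (cases "t \<in> {a..b}")
    case True
    have cc: "continuous_on {t..b} \<psi>" using c continuous_on_subset by blast
    have "(LINT x|lborel. f x t) = (LINT x|lborel. (indicator {t..b} x *\<^sub>R \<psi> x) *\<^sub>R h t)"
      by (rule Bochner_Integration.integral_cong) (use True in \<open>auto simp: f_def p_def k_def indicator_def\<close>)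
    also have "\<dots> = (LINT x:{t..b}|lborel. \<psi> x) *\<^sub>R h t"
      unfolding set_lebesgue_integral_def
      by (rule integral_scaleR_left) (use borel_integrable_atLeastAtMost'[OF cc] in \<open>simp add: set_integrable_def\<close>)
    also have "(LINT x:{t..b}|lborel. \<psi> x) = integral {t..b} \<psi>"
      by (rule set_borel_integral_eq_integral(2)[OF borel_integrable_atLeastAtMost'[OF cc]])
    also have "\<dots> = \<theta> b - \<theta> t"
      by (rule integral_unique, rule fundamental_theorem_of_calculus)
        (use d True in \<open>auto simp: has_real_derivative_iff_has_vector_derivative has_vector_derivative_at_within\<close>)
    finally show ?thesis using True by simp
  next
    case False
    then show ?thesis by (simp add: f_def k_def)
  qed
  show ?thesis using F unfolding 1 2 set_lebesgue_integral_def by simp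
qed

section \<open>Weak derivatives on the line\<close>

lemma set_integrable_primitive_continuous:
  fixes h :: "real \<Rightarrow> 'a::euclidean_space"
  assumes "set_integrable lborel {a..b} h"
  shows "continuous_on {a..b} (\<lambda>x. LINT t:{a..x}|lborel. h t)"
proof -
  have "continuous_on {a..b} (\<lambda>x. integral {a..x} h)"
    by (rule indefinite_integral_continuous_1, rule set_borel_integral_eq_integral(1)[OF assms])
  moreover have "(LINT t:{a..x}|lborel. h t) = integral {a..x} h" if "x \<in> {a..b}" for x
    by (rule set_borel_integral_eq_integral(2), rule set_integrable_subset[OF assms]) (use that in auto)
  ultimately show ?thesis by (metis (lifting) continuous_on_eq)
qed

lemma set_integral_Icc_combine:
  fixes h :: "real \<Rightarrow> 'a::euclidean_space"
  assumes "set_integrable lborel {a..c} h" "a \<le> b" "b \<le> c"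
  shows "(LINT t:{a..c}|lborel. h t) = (LINT t:{a..b}|lborel. h t) + (LINT t:{b..c}|lborel. h t)"
proof -
  have "set_integrable lborel {a..b} h" "set_integrable lborel {b..c} h"
    by (rule set_integrable_subset[OF assms(1)]; use assms in auto)+
  then show ?thesis
    using Henstock_Kurzweil_Integration.integral_combine[OF assms(2,3) set_borel_integral_eq_integral(1)[OF assms(1)]] assms(1)
    by (simp add: set_borel_integral_eq_integral(2))
qed

text \<open>
  The weak derivative is tested against the antiderivative of a mean-free continuous function; after
  integrating by parts, the function minus a primitive of its weak derivative is orthogonal to all
  such functions.
\<close>
lemma weak_deriv_imp_primitive:
  assumes op: "open I" and iv: "is_interval I" and w: "has_weak_deriv I g h"
  obtains C where "AE x\<in>I in lborel. g x = C x" "continuous_on I C"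
    "\<And>x y. x \<in> I \<Longrightarrow> y \<in> I \<Longrightarrow> x \<le> y \<Longrightarrow> C y - C x = (LINT t:{x..y}|lborel. h t)"
proof (cases "I = {}")
  case True then show ?thesis using that[of "\<lambda>_. 0"] by auto
next
  case False
  then obtain c where c: "c \<in> I" by auto
  have ih: "set_integrable lborel {a..b} h" if "{a..b} \<subseteq> I" for a b
    using L2_on_imp_set_integrable[OF _ that] w by (auto simp: has_weak_deriv_def)
  have ig: "set_integrable lborel {a..b} g" if "{a..b} \<subseteq> I" for a b
    using L2_on_imp_set_integrable[OF _ that] w by (auto simp: has_weak_deriv_def)
  have sub: "{x..y} \<subseteq> I" if "x \<in> I" "y \<in> I" for x y
    using mem_is_interval_1_I[OF iv that] by auto
  \<comment> \<open>A signed primitive: on each side of \<open>c\<close> one of the two intervals is empty.\<close>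
  define H where "H x = (LINT t:{c..x}|lborel. h t) - (LINT t:{x..c}|lborel. h t)" for x
  have null: "(LINT t:{a..b}|lborel. h t) = 0" if "b \<le> a" for a b
  proof (cases "a = b")
    case True
    have "AE x in lborel. indicator {b..b} x *\<^sub>R h x = 0"
      using AE_lborel_singleton[of b] by eventually_elim (auto simp: indicator_def)
    then show ?thesis unfolding True set_lebesgue_integral_def by (rule integral_eq_zero_AE)
  next
    case False with that show ?thesis by (simp add: set_lebesgue_integral_def)
  qed
  have Hd: "H y - H x = (LINT t:{x..y}|lborel. h t)" if xy: "x \<in> I" "y \<in> I" "x \<le> y" for x y
  proof -
    consider "c \<le> x" | "x \<le> c" "c \<le> y" | "y \<le> c" by linarith
    then show ?thesis
    proof cases
      case 1
      have n: "(LINT t:{x..c}|lborel. h t) = 0" "(LINT t:{y..c}|lborel. h t) = 0" by (rule null, use 1 xy in linarith)+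
      show ?thesis using set_integral_Icc_combine[OF ih[OF sub[OF c xy(2)]] 1 xy(3)] n by (simp add: H_def)
    next
      case 2
      have n: "(LINT t:{y..c}|lborel. h t) = 0" "(LINT t:{c..x}|lborel. h t) = 0" by (rule null, use 2 xy in linarith)+
      show ?thesis using set_integral_Icc_combine[OF ih[OF sub[OF xy(1,2)]] 2] n by (simp add: H_def)
    next
      case 3
      have n: "(LINT t:{c..x}|lborel. h t) = 0" "(LINT t:{c..y}|lborel. h t) = 0" by (rule null, use 3 xy in linarith)+
      show ?thesis using set_integral_Icc_combine[OF ih[OF sub[OF xy(1) c]] xy(3) 3] n by (simp add: H_def)
    qed
  qed
  have Hc: "continuous_on {a..b} H" if "{a..b} \<subseteq> I" "a \<le> b" for a b
  proof -
    have "continuous_on {a..b} (\<lambda>x. H a + (LINT t:{a..x}|lborel. h t))"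
      by (intro continuous_intros set_integrable_primitive_continuous ih that)
    moreover have "H x = H a + (LINT t:{a..x}|lborel. h t)" if "x \<in> {a..b}" for x
      using Hd[of a x] that \<open>{a..b} \<subseteq> I\<close> \<open>a \<le> b\<close> by (auto simp: subset_eq algebra_simps)
    ultimately show ?thesis by (metis (lifting) continuous_on_eq)
  qed
  have iH: "set_integrable lborel {a..b} H" if "{a..b} \<subseteq> I" for a b
  proof (cases "a \<le> b")
    case True then show ?thesis by (intro borel_integrable_atLeastAtMost' Hc that)
  next
    case False then show ?thesis by (simp add: set_integrable_def)
  qed
  have "\<exists>k. AE x\<in>I in lborel. g x - H x = k"
  proof (rule du_Bois_Reymond[OF op iv])
    show "set_integrable lborel {a..b} (\<lambda>x. g x - H x)" if "{a..b} \<subseteq> I" for a b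
      by (rule set_integral_diff(1)[OF ig[OF that] iH[OF that]])
    fix \<psi> :: "real \<Rightarrow> real" and a b
    assume c: "continuous_on UNIV \<psi>" and ab: "a \<le> b" "{a..b} \<subseteq> I" and out: "\<And>x. x \<notin> {a..b} \<Longrightarrow> \<psi> x = 0"
      and m: "integral {a..b} \<psi> = 0"
    have cS: "continuous_on S \<psi>" for S using c continuous_on_subset by blast
    obtain \<theta> where \<theta>: "\<theta> \<in> test_functions I" "\<And>x. deriv \<theta> x = \<psi> x" "\<And>x. x \<notin> {a..b} \<Longrightarrow> \<theta> x = 0"
      "\<And>x. (\<theta> has_real_derivative \<psi> x) (at x)" "continuous_on UNIV \<theta>"
      using test_function_of_zero_mean[OF c ab out m] by blast
    have res: "(LINT x:I|lborel. f x) = (LINT x:{a..b}|lborel. f x)" if "\<And>x. x \<notin> {a..b} \<Longrightarrow> f x = 0" for f :: "real \<Rightarrow> complex"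
      unfolding set_lebesgue_integral_def
      by (rule Bochner_Integration.integral_cong) (use that ab in \<open>auto simp: indicator_def\<close>)
    have 1: "(LINT x:{a..b}|lborel. \<psi> x *\<^sub>R g x) = - (LINT x:{a..b}|lborel. \<theta> x *\<^sub>R h x)"
    proof -
      have "(LINT x:I|lborel. deriv \<theta> x *\<^sub>R g x) = - (LINT x:I|lborel. \<theta> x *\<^sub>R h x)"
        using w \<theta>(1) by (auto simp: has_weak_deriv_def)
      then show ?thesis
        using res[of "\<lambda>x. \<psi> x *\<^sub>R g x"] res[of "\<lambda>x. \<theta> x *\<^sub>R h x"] by (simp add: \<theta>(2,3) out)
    qed
    have \<theta>b: "\<theta> b = 0"
    proof -
      have "(\<theta> \<longlongrightarrow> \<theta> b) (at_right b)"
        using DERIV_isCont[OF \<theta>(4), of b] by (simp add: isCont_def filterlim_at_split)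
      moreover have "(\<theta> \<longlongrightarrow> 0) (at_right b)"
        by (rule tendsto_eventually) (use \<theta>(3) in \<open>auto simp: eventually_at_filter\<close>)
      ultimately show ?thesis using tendsto_unique[of "at_right b"] by simp
    qed
    have "(LINT x:{a..b}|lborel. \<psi> x *\<^sub>R H x) = (LINT x:{a..b}|lborel. \<psi> x *\<^sub>R H a + \<psi> x *\<^sub>R (LINT t:{a..x}|lborel. h t))"
    proof (rule set_lebesgue_integral_cong)
      show "\<forall>x. x \<in> {a..b} \<longrightarrow> \<psi> x *\<^sub>R H x = \<psi> x *\<^sub>R H a + \<psi> x *\<^sub>R (LINT t:{a..x}|lborel. h t)"
      proof (intro allI impI)
        fix x assume x: "x \<in> {a..b}"
        then have "H x = H a + (LINT t:{a..x}|lborel. h t)" using Hd[of a x] ab by (auto simp: subset_eq algebra_simps)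
        then show "\<psi> x *\<^sub>R H x = \<psi> x *\<^sub>R H a + \<psi> x *\<^sub>R (LINT t:{a..x}|lborel. h t)" by (simp add: scaleR_right_distrib)
      qed
    qed simp
    also have "\<dots> = (LINT x:{a..b}|lborel. \<psi> x *\<^sub>R H a) + (LINT x:{a..b}|lborel. \<psi> x *\<^sub>R (LINT t:{a..x}|lborel. h t))"
      by (intro set_integral_add(2) borel_integrable_atLeastAtMost' continuous_intros cS set_integrable_primitive_continuous ih ab)
    also have "(LINT x:{a..b}|lborel. \<psi> x *\<^sub>R H a) = 0"
      using set_borel_integral_eq_integral(2)[of "{a..b}" \<psi>] set_integral_scaleR_vector[of lborel "{a..b}" \<psi> "H a"]
        borel_integrable_atLeastAtMost'[OF cS] m by simp
    also have "(LINT x:{a..b}|lborel. \<psi> x *\<^sub>R (LINT t:{a..x}|lborel. h t)) = (LINT x:{a..b}|lborel. - (\<theta> x *\<^sub>R h x))"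
      by (subst Fubini_primitive[OF ih[OF ab(2)] \<theta>(4) c ab(1)]) (simp add: \<theta>b)
    also have "\<dots> = - (LINT x:{a..b}|lborel. \<theta> x *\<^sub>R h x)"
      by (rule set_integral_uminus, rule set_integrable_continuous_scaleR[OF ih[OF ab(2)]])
        (use \<theta>(5) continuous_on_subset in blast)
    finally have 2: "(LINT x:{a..b}|lborel. \<psi> x *\<^sub>R H x) = - (LINT x:{a..b}|lborel. \<theta> x *\<^sub>R h x)" by simp
    have "(LINT x:{a..b}|lborel. \<psi> x *\<^sub>R (g x - H x)) = (LINT x:{a..b}|lborel. \<psi> x *\<^sub>R g x) - (LINT x:{a..b}|lborel. \<psi> x *\<^sub>R H x)"
      unfolding scaleR_right_diff_distrib
      by (rule set_integral_diff(2)) (auto intro!: set_integrable_continuous_scaleR ig iH ab cS)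
    then show "(LINT x:{a..b}|lborel. \<psi> x *\<^sub>R (g x - H x)) = 0" using 1 2 by simp
  qed
  then obtain k where k: "AE x\<in>I in lborel. g x - H x = k" by blast
  show ?thesis
  proof (rule that[of "\<lambda>x. H x + k"])
    show "AE x\<in>I in lborel. g x = H x + k" using k by eventually_elim (auto simp: algebra_simps)
    show "continuous_on I (\<lambda>x. H x + k)"
    proof (intro continuous_intros continuous_at_imp_continuous_on ballI)
      fix x assume "x \<in> I"
      then obtain e where e: "e > 0" "\<And>y. \<bar>y - x\<bar> < e \<Longrightarrow> y \<in> I" using op unfolding open_real by auto
      have "continuous_on {x - e/2..x + e/2} H" by (rule Hc) (use e in auto)
      then show "isCont H x" by (rule continuous_on_interior) (use e in \<open>auto simp: interior_atLeastAtMost_real\<close>)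
    qed
    show "\<And>x y. x \<in> I \<Longrightarrow> y \<in> I \<Longrightarrow> x \<le> y \<Longrightarrow> H y + k - (H x + k) = (LINT t:{x..y}|lborel. h t)"
      using Hd by auto
  qed
qed


lemma continuous_AE_eq_imp_eq:
  fixes c d :: "real \<Rightarrow> 'a::real_normed_vector"
  assumes op: "open \<Omega>" and c: "continuous_on \<Omega> c" "continuous_on \<Omega> d" and ae: "AE x\<in>\<Omega> in lborel. c x = d x" and x: "x \<in> \<Omega>"
  shows "c x = d x"
proof (rule ccontr)
  assume ne: "c x \<noteq> d x"
  let ?U = "\<Omega> \<inter> (\<lambda>x. c x - d x) -` (- {0})"
  have "open ?U"
    by (rule continuous_open_preimage) (use c op in \<open>auto intro: continuous_intros\<close>)
  moreover have "x \<in> ?U" using x ne by auto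
  ultimately obtain e where e: "e > 0" "\<And>y. \<bar>y - x\<bar> < e \<Longrightarrow> y \<in> ?U" unfolding open_real by blast
  have "AE y in lborel. y \<notin> {x<..<x+e}"
    using ae
  proof eventually_elim
    case (elim y)
    then show ?case using e(2)[of y] by auto
  qed
  then have "emeasure lborel {x<..<x+e} = 0"
    by (subst (asm) AE_iff_measurable[of "{x<..<x+e}"]) auto
  then show False using e by simp
qed

lemma cont_rep_eq:
  assumes op: "open \<Omega>" and c: "continuous_on \<Omega> c" and ae: "AE x\<in>\<Omega> in lborel. c x = g x" and x: "x \<in> \<Omega>"
  shows "cont_rep \<Omega> g x = c x"
proof -
  have *: "continuous_on \<Omega> (cont_rep \<Omega> g) \<and> (AE x\<in>\<Omega> in lborel. cont_rep \<Omega> g x = g x)"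
    unfolding cont_rep_def by (rule someI[of _ c]) (use c ae in auto)
  have "AE x\<in>\<Omega> in lborel. cont_rep \<Omega> g x = c x"
    using conjunct2[OF *] ae by eventually_elim auto
  then show ?thesis using continuous_AE_eq_imp_eq[OF op _ c _ x] * by blast
qed

text \<open>
  A test function on \<open>I\<close> is one on \<open>\<Omega>\<close>, and it vanishes with its derivative outside \<open>I\<close>.
\<close>
lemma has_weak_deriv_subset:
  assumes w: "has_weak_deriv \<Omega> g h" and I: "I \<subseteq> \<Omega>" "open I"
  shows "has_weak_deriv I g h"
proof -
  have L2: "f \<in> L2_on I" if "f \<in> L2_on \<Omega>" for f
    using that I set_borel_measurable_subset[of lborel \<Omega> f I] set_integrable_subset[of lborel \<Omega> _ I]
    by (auto simp: L2_on_def)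
  have z: "\<theta> x = 0" "deriv \<theta> x = 0" if "\<theta> \<in> test_functions I" "x \<notin> I" for \<theta> x
  proof -
    define U where "U = - closure {x. \<theta> x \<noteq> 0}"
    have U: "open U" "x \<in> U" using that by (auto simp: test_functions_def U_def)
    have zero: "\<theta> y = 0" if "y \<in> U" for y using that closure_subset[of "{x. \<theta> x \<noteq> 0}"] unfolding U_def by blast
    show "\<theta> x = 0" using zero U by blast
    have "(\<theta> has_real_derivative 0) (at x)"
      by (rule has_field_derivative_transform_within_open[OF DERIV_const U]) (use zero in auto)
    then show "deriv \<theta> x = 0" by (rule DERIV_imp_deriv)
  qed
  show ?thesis unfolding has_weak_deriv_def
  proof (intro conjI ballI)
    show "g \<in> L2_on I" "h \<in> L2_on I" using w L2 by (auto simp: has_weak_deriv_def)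
    fix \<theta> assume t: "\<theta> \<in> test_functions I"
    then have "\<theta> \<in> test_functions \<Omega>" using I by (auto simp: test_functions_def)
    then have e: "(LINT x:\<Omega>|lborel. deriv \<theta> x *\<^sub>R g x) = - (LINT x:\<Omega>|lborel. \<theta> x *\<^sub>R h x)"
      using w by (auto simp: has_weak_deriv_def)
    have r: "(LINT x:\<Omega>|lborel. f x) = (LINT x:I|lborel. f x)" if "\<And>x. x \<notin> I \<Longrightarrow> f x = 0" for f :: "real \<Rightarrow> complex"
      unfolding set_lebesgue_integral_def
      by (rule Bochner_Integration.integral_cong) (use that I in \<open>auto simp: indicator_def\<close>)
    show "(LINT x:I|lborel. deriv \<theta> x *\<^sub>R g x) = - (LINT x:I|lborel. \<theta> x *\<^sub>R h x)"
      using e z[OF t] by (simp add: r)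
  qed
qed

lemma has_weak_deriv_cong_AE:
  assumes w: "has_weak_deriv \<Omega> g h" and O: "\<Omega> \<in> sets borel"
    and ae: "AE x\<in>\<Omega> in lborel. g x = g' x" and m: "set_borel_measurable lborel \<Omega> g'"
  shows "has_weak_deriv \<Omega> g' h"
proof -
  have g: "g \<in> L2_on \<Omega>" using w by (auto simp: has_weak_deriv_def)
  have "set_integrable lborel \<Omega> (\<lambda>x. (cmod (g' x))\<^sup>2)"
  proof -
    have "(\<lambda>x. (norm (indicat_real \<Omega> x *\<^sub>R g' x))\<^sup>2) \<in> borel_measurable lborel"
      using m unfolding set_borel_measurable_def by measurable
    moreover have "(\<lambda>x. (norm (indicat_real \<Omega> x *\<^sub>R g' x))\<^sup>2) = (\<lambda>x. indicat_real \<Omega> x *\<^sub>R (cmod (g' x))\<^sup>2)"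
      by (auto simp: indicator_def)
    ultimately have m2: "(\<lambda>x. indicat_real \<Omega> x *\<^sub>R (cmod (g' x))\<^sup>2) \<in> borel_measurable lborel" by simp
    have "integrable lborel (\<lambda>x. indicat_real \<Omega> x *\<^sub>R (cmod (g x))\<^sup>2)"
      using g by (auto simp: L2_on_def set_integrable_def)
    moreover have "AE x in lborel. indicat_real \<Omega> x *\<^sub>R (cmod (g x))\<^sup>2 = indicat_real \<Omega> x *\<^sub>R (cmod (g' x))\<^sup>2"
      using ae by eventually_elim (auto simp: indicator_def)
    ultimately show ?thesis unfolding set_integrable_def
      using integrable_cong_AE_imp[OF _ m2] by (auto elim: eventually_mono)
  qed
  then have "g' \<in> L2_on \<Omega>" using m by (simp add: L2_on_def)
  moreover have "(LINT x:\<Omega>|lborel. deriv \<theta> x *\<^sub>R g x) = (LINT x:\<Omega>|lborel. deriv \<theta> x *\<^sub>R g' x)"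
    if t: "\<theta> \<in> test_functions \<Omega>" for \<theta>
  proof -
    obtain D where D: "\<And>x. (\<theta> has_vector_derivative D x) (at x)" "continuous_on UNIV D"
      using t unfolding test_functions_def C1_differentiable_on_def by blast
    then have "deriv \<theta> x = D x" for x by (simp add: DERIV_imp_deriv has_real_derivative_iff_has_vector_derivative)
    then have "deriv \<theta> = D" by auto
    then have [measurable]: "deriv \<theta> \<in> borel_measurable borel" using D(2) by (simp add: borel_measurable_continuous_onI)
    have [measurable]: "(\<lambda>x. indicat_real \<Omega> x *\<^sub>R g x) \<in> borel_measurable borel" "(\<lambda>x. indicat_real \<Omega> x *\<^sub>R g' x) \<in> borel_measurable borel"
      using g m by (auto simp: L2_on_def set_borel_measurable_def)
    have e: "(\<lambda>x. indicat_real \<Omega> x *\<^sub>R (deriv \<theta> x *\<^sub>R f x)) = (\<lambda>x. deriv \<theta> x *\<^sub>R (indicat_real \<Omega> x *\<^sub>R f x))" for f :: "real \<Rightarrow> complex"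
      by (auto simp: indicator_def)
    show ?thesis unfolding set_lebesgue_integral_def e
    proof (rule Bochner_Integration.integral_cong_AE)
      show "AE x in lborel. deriv \<theta> x *\<^sub>R indicat_real \<Omega> x *\<^sub>R g x = deriv \<theta> x *\<^sub>R indicat_real \<Omega> x *\<^sub>R g' x"
        using ae by eventually_elim (auto simp: indicator_def)
      show "(\<lambda>x. deriv \<theta> x *\<^sub>R (indicat_real \<Omega> x *\<^sub>R g x)) \<in> borel_measurable lborel"
        "(\<lambda>x. deriv \<theta> x *\<^sub>R (indicat_real \<Omega> x *\<^sub>R g' x)) \<in> borel_measurable lborel"
        unfolding measurable_lborel1 by measurable
    qed
  qed
  ultimately show ?thesis using w by (simp add: has_weak_deriv_def)
qed

text \<open>
  Primitives of two weak derivatives differ by a constant on each interval, so the weak derivatives have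
  the same integrals over intervals.
\<close>
lemma weak_deriv_unique_AE:
  assumes op: "open \<Omega>" and w: "has_weak_deriv \<Omega> g h1" "has_weak_deriv \<Omega> g h2"
  shows "AE x\<in>\<Omega> in lborel. h1 x = h2 x"
proof (rule AE_on_open_if_AE_on_Icc[OF op])
  fix a b :: real assume ab: "{a..b} \<subseteq> \<Omega>"
  have i: "set_integrable lborel {a..b} h1" "set_integrable lborel {a..b} h2"
    by (rule L2_on_imp_set_integrable[OF _ ab]; use w in \<open>simp add: has_weak_deriv_def\<close>)+
  have "AE x\<in>{a<..<b} in lborel. h1 x - h2 x = 0"
  proof (rule AE_on_open_if_AE_on_Icc)
    fix c d :: real assume cd: "{c..d} \<subseteq> {a<..<b}"
    let ?I = "{a<..<b}"
    have I: "?I \<subseteq> \<Omega>" "open ?I" "is_interval ?I" using ab by (auto simp: is_interval_1)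
    obtain C1 where C1: "AE x\<in>?I in lborel. g x = C1 x" "continuous_on ?I C1"
      "\<And>x y. x \<in> ?I \<Longrightarrow> y \<in> ?I \<Longrightarrow> x \<le> y \<Longrightarrow> C1 y - C1 x = (LINT t:{x..y}|lborel. h1 t)"
      using weak_deriv_imp_primitive[OF I(2,3) has_weak_deriv_subset[OF w(1) I(1,2)]] by blast
    obtain C2 where C2: "AE x\<in>?I in lborel. g x = C2 x" "continuous_on ?I C2"
      "\<And>x y. x \<in> ?I \<Longrightarrow> y \<in> ?I \<Longrightarrow> x \<le> y \<Longrightarrow> C2 y - C2 x = (LINT t:{x..y}|lborel. h2 t)"
      using weak_deriv_imp_primitive[OF I(2,3) has_weak_deriv_subset[OF w(2) I(1,2)]] by blast
    have "AE x\<in>?I in lborel. C1 x = C2 x" using C1(1) C2(1) by eventually_elim auto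
    then have eq: "C1 x = C2 x" if "x \<in> ?I" for x using continuous_AE_eq_imp_eq[OF I(2) C1(2) C2(2)] that by blast
    have ii: "set_integrable lborel {p..q} h1" "set_integrable lborel {p..q} h2" if "{p..q} \<subseteq> {c..d}" for p q
    proof -
      have s: "{p..q} \<subseteq> {a..b}" using that cd by (meson greaterThanLessThan_subseteq_atLeastAtMost_iff order_trans order_refl)
      show "set_integrable lborel {p..q} h1" "set_integrable lborel {p..q} h2"
        by (rule set_integrable_subset[OF i(1) _ s], simp) (rule set_integrable_subset[OF i(2) _ s], simp)
    qed
    show "AE x\<in>{c..d} in lborel. h1 x - h2 x = 0"
    proof (rule zero_interval_integrals_AE)
      show "set_integrable lborel {c..d} (\<lambda>x. h1 x - h2 x)"
        by (rule set_integral_diff(1)) (use ii in auto)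
      fix p q assume pq: "c \<le> p" "p \<le> q" "q \<le> d"
      then have I2: "p \<in> ?I" "q \<in> ?I" using cd by (auto simp: subset_eq)
      have "(LINT x:{p..q}|lborel. h1 x - h2 x) = (LINT x:{p..q}|lborel. h1 x) - (LINT x:{p..q}|lborel. h2 x)"
        by (rule set_integral_diff(2)) (use ii pq in auto)
      then show "(LINT x:{p..q}|lborel. h1 x - h2 x) = 0"
        using C1(3)[OF I2 pq(2)] C2(3)[OF I2 pq(2)] eq I2 by simp
    qed
  qed simp
  moreover have "AE x in lborel. x \<noteq> a \<and> x \<noteq> b" using AE_lborel_singleton[of a] AE_lborel_singleton[of b] by auto
  ultimately show "AE x\<in>{a..b} in lborel. h1 x = h2 x" by eventually_elim auto
qed

text \<open>
  The product of \<open>g\<close> with a test function is continuous and compactly supported on the whole line, and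
  the fundamental theorem of calculus tolerates finitely many corners, so its derivative integrates to zero.
\<close>
lemma has_weak_deriv_piecewise:
  fixes g h :: "real \<Rightarrow> complex"
  assumes op: "open \<Omega>" and S: "finite S" and c: "continuous_on \<Omega> g"
    and d: "\<And>x. x \<in> \<Omega> - S \<Longrightarrow> (g has_vector_derivative h x) (at x)"
    and L2: "g \<in> L2_on \<Omega>" "h \<in> L2_on \<Omega>"
  shows "has_weak_deriv \<Omega> g h"
  unfolding has_weak_deriv_def
proof (intro conjI ballI L2)
  fix \<theta> assume t: "\<theta> \<in> test_functions \<Omega>"
  obtain D where D: "\<And>x. (\<theta> has_vector_derivative D x) (at x)" "continuous_on UNIV D"
    using t unfolding test_functions_def C1_differentiable_on_def by blast
  have dD: "deriv \<theta> = D" using D(1) by (auto simp: DERIV_imp_deriv has_real_derivative_iff_has_vector_derivative)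
  define K where "K = closure {x. \<theta> x \<noteq> 0}"
  have K: "compact K" "K \<subseteq> \<Omega>" using t by (auto simp: test_functions_def K_def)
  have oK: "open (- K)" unfolding K_def by (intro open_Compl closed_closure)
  obtain N where N: "K \<subseteq> {-N..N}"
  proof -
    obtain N where "\<forall>x\<in>K. \<bar>x\<bar> \<le> N" using compact_imp_bounded[OF K(1)] by (auto simp: bounded_iff)
    then show ?thesis using that[of N] by (fastforce simp: abs_le_iff)
  qed
  have t0: "\<theta> x = 0" if "x \<notin> K" for x using that closure_subset[of "{x. \<theta> x \<noteq> 0}"] unfolding K_def by blast
  have D0: "D x = 0" if "x \<notin> K" for x
  proof -
    have "(\<theta> has_vector_derivative 0) (at x)"
      by (rule has_vector_derivative_transform_within_open[OF has_vector_derivative_const oK])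
        (use that t0 in auto)
    then show ?thesis using vector_derivative_unique_at D(1) by blast
  qed
  define F where "F x = \<theta> x *\<^sub>R g x" for x
  define G where "G x = D x *\<^sub>R g x + \<theta> x *\<^sub>R h x" for x
  have \<theta>c: "continuous_on A \<theta>" for A
    using D(1) by (meson continuous_at_imp_continuous_on has_vector_derivative_continuous)
  have Dc: "continuous_on A D" for A using D(2) continuous_on_subset by blast
  have Fd: "(F has_vector_derivative G x) (at x)" if "x \<notin> S" for x
  proof (cases "x \<in> \<Omega>")
    case True
    then show ?thesis unfolding F_def G_def
      using has_vector_derivative_scaleR[OF D(1)[unfolded has_real_derivative_iff_has_vector_derivative[symmetric]] d, of x] that
      by (simp add: add.commute)
  next
    case False
    then have "x \<notin> K" using K by auto
    then have "(F has_vector_derivative 0) (at x)"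
      by (intro has_vector_derivative_transform_within_open[OF has_vector_derivative_const oK])
        (use t0 in \<open>auto simp: F_def\<close>)
    then show ?thesis using t0[OF \<open>x \<notin> K\<close>] D0[OF \<open>x \<notin> K\<close>] by (simp add: G_def)
  qed
  have Fc: "isCont F x" for x
  proof (cases "x \<in> \<Omega>")
    case True
    then have "isCont g x" using c op continuous_on_eq_continuous_at by blast
    moreover have "isCont \<theta> x" using D(1) has_vector_derivative_continuous by blast
    ultimately show ?thesis unfolding F_def by (intro continuous_intros)
  next
    case False
    then have "x \<notin> K" using K by auto
    then have "(F has_vector_derivative 0) (at x)"
      by (intro has_vector_derivative_transform_within_open[OF has_vector_derivative_const oK])
        (use t0 in \<open>auto simp: F_def\<close>)
    then show ?thesis using has_vector_derivative_continuous by blast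
  qed
  let ?J = "{-\<bar>N\<bar>-1..\<bar>N\<bar>+1}"
  have end0: "F (\<bar>N\<bar>+1) = 0" "F (-\<bar>N\<bar>-1) = 0" 
  proof -
    have "\<bar>N\<bar>+1 \<notin> K" "-\<bar>N\<bar>-1 \<notin> K" using N by force+
    then show "F (\<bar>N\<bar>+1) = 0" "F (-\<bar>N\<bar>-1) = 0" using t0 by (simp_all add: F_def)
  qed
  have hi: "(G has_integral 0) ?J"
    using fundamental_theorem_of_calculus_strong[OF S, of "-\<bar>N\<bar>-1" "\<bar>N\<bar>+1" F G] Fd Fc end0
    by (simp add: continuous_at_imp_continuous_on)
  have loc: "integrable lborel (\<lambda>x. indicator \<Omega> x *\<^sub>R (\<phi> x *\<^sub>R f x))"
    if f: "f \<in> L2_on \<Omega>" and p: "continuous_on UNIV \<phi>" "\<And>x. x \<notin> K \<Longrightarrow> \<phi> x = 0" for f :: "real \<Rightarrow> complex" and \<phi> :: "real \<Rightarrow> real"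
  proof -
    obtain M where M: "\<And>x. x \<in> K \<Longrightarrow> norm (\<phi> x) \<le> M"
      using compact_imp_bounded[OF compact_continuous_image[OF continuous_on_subset[OF p(1)] K(1)]]
      unfolding bounded_iff by blast
    have [measurable]: "(\<lambda>x. indicat_real \<Omega> x *\<^sub>R f x) \<in> borel_measurable borel"
      using f by (auto simp: L2_on_def set_borel_measurable_def)
    have [measurable]: "\<phi> \<in> borel_measurable borel" using p(1) by (rule borel_measurable_continuous_onI)
    have e: "(\<lambda>x. indicat_real \<Omega> x *\<^sub>R (\<phi> x *\<^sub>R f x)) = (\<lambda>x. \<phi> x *\<^sub>R (indicat_real \<Omega> x *\<^sub>R f x))"
      by (auto simp: indicator_def)
    have i1: "integrable lborel (\<lambda>x. indicat_real ?J x *\<^sub>R (1::real))"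
      using borel_integrable_atLeastAtMost'[of "-\<bar>N\<bar>-1" "\<bar>N\<bar>+1" "\<lambda>_. 1::real"] by (simp add: set_integrable_def)
    have i2: "integrable lborel (\<lambda>x. indicat_real \<Omega> x *\<^sub>R (cmod (f x))\<^sup>2)"
      using f by (auto simp: L2_on_def set_integrable_def)
    show ?thesis unfolding e
    proof (rule Bochner_Integration.integrable_bound)
      show "integrable lborel (\<lambda>x. M * (indicat_real ?J x *\<^sub>R (1::real) + indicat_real \<Omega> x *\<^sub>R (cmod (f x))\<^sup>2))"
        using i1 i2 by auto
      show "AE x in lborel. norm (\<phi> x *\<^sub>R indicat_real \<Omega> x *\<^sub>R f x) \<le> norm (M * (indicat_real ?J x *\<^sub>R (1::real) + indicat_real \<Omega> x *\<^sub>R (cmod (f x))\<^sup>2))"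
      proof (rule AE_I2)
        fix x
        show "norm (\<phi> x *\<^sub>R indicat_real \<Omega> x *\<^sub>R f x) \<le> norm (M * (indicat_real ?J x *\<^sub>R (1::real) + indicat_real \<Omega> x *\<^sub>R (cmod (f x))\<^sup>2))"
        proof (cases "x \<in> K")
          case True
          then have x: "x \<in> \<Omega>" "x \<in> ?J" using K N by fastforce+
          have "\<bar>\<phi> x\<bar> * cmod (f x) \<le> M * (1 + (cmod (f x))\<^sup>2)"
            using M[OF True] le_one_plus_square[of "cmod (f x)"] by (intro mult_mono) auto
          moreover have "M \<ge> 0" using M[OF True] by auto
          ultimately show ?thesis using x by (auto simp: indicator_def abs_mult)
        next
          case False then show ?thesis using p(2) by simp
        qed
      qed
    qed measurable
  qed
  have i: "integrable lborel (\<lambda>x. indicat_real \<Omega> x *\<^sub>R (D x *\<^sub>R g x))" "integrable lborel (\<lambda>x. indicat_real \<Omega> x *\<^sub>R (\<theta> x *\<^sub>R h x))"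
    using loc[OF L2(1) Dc D0] loc[OF L2(2) \<theta>c t0] by auto
  have GJ: "indicat_real ?J x *\<^sub>R G x = indicat_real \<Omega> x *\<^sub>R (D x *\<^sub>R g x) + indicat_real \<Omega> x *\<^sub>R (\<theta> x *\<^sub>R h x)" for x
  proof (cases "x \<in> K")
    case True
    then have x: "x \<in> \<Omega>" "x \<in> ?J" using K N by fastforce+
    then show ?thesis by (simp add: G_def)
  next
    case False then show ?thesis using t0 D0 by (simp add: G_def)
  qed
  have si: "set_integrable lborel ?J G" unfolding set_integrable_def GJ using i by auto
  have "(LINT x:\<Omega>|lborel. D x *\<^sub>R g x) + (LINT x:\<Omega>|lborel. \<theta> x *\<^sub>R h x) = (LINT x:?J|lborel. G x)"
    unfolding set_lebesgue_integral_def GJ using i by simp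
  also have "\<dots> = integral ?J G" by (rule set_borel_integral_eq_integral(2)[OF si])
  also have "\<dots> = 0" using hi by (rule integral_unique)
  finally show "(LINT x:\<Omega>|lborel. deriv \<theta> x *\<^sub>R g x) = - (LINT x:\<Omega>|lborel. \<theta> x *\<^sub>R h x)"
    unfolding dD by (simp add: eq_neg_iff_add_eq_0)
qed

section \<open>Jost functions of an exponentially decaying potential\<close>

lemma LINT_shift:
  fixes q :: "real \<Rightarrow> real"
  shows "(LINT z:{0..}|lborel. q (x + z)) = (LINT t:{x..}|lborel. q t)"
    "set_integrable lborel {0..} (\<lambda>z. q (x + z)) \<longleftrightarrow> set_integrable lborel {x..} q"
proof -
  have e: "(\<lambda>z. indicat_real {x..} (x + z) *\<^sub>R q (x + z)) = (\<lambda>z. indicat_real {0..} z *\<^sub>R q (x + z))"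
    by (auto simp: indicator_def)
  show "(LINT z:{0..}|lborel. q (x + z)) = (LINT t:{x..}|lborel. q t)"
    unfolding set_lebesgue_integral_def
    using lborel_integral_real_affine[of 1 "\<lambda>t. indicat_real {x..} t *\<^sub>R q t" x]
    by (simp only: abs_one scaleR_one mult_1 e zero_neq_one not_False_eq_True simp_thms)
  show "set_integrable lborel {0..} (\<lambda>z. q (x + z)) \<longleftrightarrow> set_integrable lborel {x..} q"
    unfolding set_integrable_def
    using lborel_integrable_real_affine_iff[of 1 "\<lambda>t. indicat_real {x..} t *\<^sub>R q t" x]
    by (simp only: mult_1 e one_neq_zero not_False_eq_True simp_thms)
qed

lemma tail_integral_has_derivative:
  fixes q :: "real \<Rightarrow> real"
  assumes c: "continuous_on UNIV q" and i: "\<And>a. set_integrable lborel {a..} q"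
  shows "((\<lambda>x. LINT t:{x..}|lborel. q t) has_real_derivative - q x) (at x)"
proof -
  define a where "a = x - 1"
  have cS: "continuous_on S q" for S using c continuous_on_subset by blast
  have split: "(LINT t:{y..}|lborel. q t) = (LINT t:{a..}|lborel. q t) - integral {a..y} q" if "y > a" for y
  proof -
    have si: "set_integrable lborel {a..y} q" by (rule borel_integrable_atLeastAtMost'[OF cS])
    have "(LINT t:{a..y} \<union> {y..}|lborel. q t) = (LINT t:{a..y}|lborel. q t) + (LINT t:{y..}|lborel. q t)"
    proof (rule set_integral_Un_AE)
      show "AE x in lborel. \<not> (x \<in> {a..y} \<and> x \<in> {y..})"
        using AE_lborel_singleton[of y] by eventually_elim auto
    qed (use si i in auto)
    moreover have "{a..y} \<union> {y..} = {a..}" using that by auto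
    ultimately show ?thesis using set_borel_integral_eq_integral(2)[OF si] by simp
  qed
  have "((\<lambda>y. integral {a..y} q) has_vector_derivative q x) (at x within {a..x+1})"
    by (rule integral_has_vector_derivative[OF cS]) (auto simp: a_def)
  then have "((\<lambda>y. integral {a..y} q) has_real_derivative q x) (at x)"
    by (subst (asm) at_within_interior) (auto simp: has_real_derivative_iff_has_vector_derivative a_def interior_atLeastAtMost_real)
  then have "((\<lambda>y. (LINT t:{a..}|lborel. q t) - integral {a..y} q) has_real_derivative 0 - q x) (at x)"
    by (intro DERIV_diff DERIV_const)
  then have "((\<lambda>y. LINT t:{y..}|lborel. q t) has_real_derivative 0 - q x) (at x)"
    by (rule has_field_derivative_transform_within_open[of _ _ _ "{a<..}"]) (auto simp: split, simp_all add: a_def)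
  then show ?thesis by simp
qed

text \<open>
  The solution of \<open>f'' = (\<kappa>\<^sup>2 - W) f\<close> that behaves like \<open>exp (- \<kappa> * x)\<close> at infinity is written
  as \<open>f x = exp (- \<kappa> * x) * h x\<close>. The factor \<open>h\<close> solves the Volterra equation
  \<open>h x = 1 - \<integral>z\<ge>0. (1 - exp (- 2 * \<kappa> * z)) / (2 * \<kappa>) * W (x + z) * h (x + z)\<close>.
  It is found for all rates at once, as the fixed point of a contraction of the bounded continuous
  functions of the pair \<open>(x, \<kappa>)\<close>; continuity of the solution in \<open>\<kappa>\<close> then comes for free.
\<close>
locale exponentially_decaying_potential =
  fixes W :: "real \<Rightarrow> real" and C \<delta> \<kappa>0 :: real
  assumes W_cont: "continuous_on UNIV W" and C_pos: "C > 0" and \<delta>_pos: "\<delta> > 0" and \<kappa>0_pos: "\<kappa>0 > 0"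
    and W_bound: "\<And>t. \<bar>W t\<bar> \<le> C * exp (- \<delta> * t)"
begin

text \<open>
  A weight that grows to the left turns the Volterra map into a contraction on the whole line. Its
  exponent is chosen so that \<open>- \<kappa>0 * weight\<close> is an antiderivative of the majorant of \<open>W * weight\<close>,
  which makes the contraction factor equal to one half.
\<close>
definition weight :: "real \<Rightarrow> real" where "weight x = exp (C / (\<kappa>0 * \<delta>) * exp (- \<delta> * x))"

definition majorant :: "real \<Rightarrow> real" where "majorant t = C * exp (- \<delta> * t) * weight t"

lemma weight_gt_1: "weight x > 1"
  using C_pos \<delta>_pos \<kappa>0_pos by (simp add: weight_def)

lemma weight_cont: "continuous_on S weight"
  unfolding weight_def by (intro continuous_intros)

lemma weight_tendsto: "(weight \<longlongrightarrow> 1) at_top"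
proof -
  have "((\<lambda>x. exp (- \<delta> * x)) \<longlongrightarrow> 0) at_top"
    using \<delta>_pos by (intro filterlim_compose[OF exp_at_bot] filterlim_tendsto_neg_mult_at_bot[OF tendsto_const _ filterlim_ident]) auto
  then have "((\<lambda>x. exp (C / (\<kappa>0 * \<delta>) * exp (- \<delta> * x))) \<longlongrightarrow> exp (C / (\<kappa>0 * \<delta>) * 0)) at_top"
    by (intro tendsto_intros)
  then show ?thesis by (simp add: weight_def[abs_def])
qed

lemma weight_deriv: "((\<lambda>t. - \<kappa>0 * weight t) has_real_derivative majorant t) (at t)"
  unfolding weight_def majorant_def
  by (auto intro!: derivative_eq_intros simp: field_simps) (use \<delta>_pos \<kappa>0_pos in auto)

lemma majorant_nonneg: "majorant t \<ge> 0"
  using C_pos weight_gt_1[of t] by (auto simp: majorant_def)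

lemma majorant_cont: "continuous_on S majorant"
  unfolding majorant_def by (intro continuous_intros weight_cont)

lemma majorant_antimono: "s \<le> t \<Longrightarrow> majorant t \<le> majorant s"
  unfolding majorant_def weight_def using C_pos \<delta>_pos \<kappa>0_pos
  by (intro mult_mono) (auto intro!: divide_right_mono mult_left_mono)

lemma majorant_integral: "has_bochner_integral lborel (\<lambda>t. indicator {x..} t *\<^sub>R majorant t) (\<kappa>0 * (weight x - 1))"
proof (rule has_bochner_integral_nn_integral)
  have "(\<integral>\<^sup>+t. ennreal (majorant t) * indicator {x..} t \<partial>lborel) = - \<kappa>0 * 1 - (- \<kappa>0 * weight x)"
    by (rule nn_integral_FTC_atLeast[OF borel_measurable_continuous_onI[OF majorant_cont] weight_deriv majorant_nonneg])
      (intro tendsto_intros weight_tendsto)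
  then show "(\<integral>\<^sup>+t. ennreal (indicator {x..} t *\<^sub>R majorant t) \<partial>lborel) = ennreal (\<kappa>0 * (weight x - 1))"
    by (simp add: algebra_simps indicator_mult_ennreal mult.commute)
  show "(\<lambda>t. indicator {x..} t *\<^sub>R majorant t) \<in> borel_measurable lborel"
    using borel_measurable_continuous_onI[OF majorant_cont] by measurable
qed (use majorant_nonneg weight_gt_1[of x] \<kappa>0_pos in auto)

lemma majorant_integrable: "set_integrable lborel {x..} majorant"
  and majorant_LINT: "(LINT t:{x..}|lborel. majorant t) = \<kappa>0 * (weight x - 1)"
  using majorant_integral[of x]
  by (auto simp: set_integrable_def set_lebesgue_integral_def has_bochner_integral_iff)

text \<open>
  The bounds on the Volterra integral, for a general kernel \<open>p\<close> because the derivative of the solution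
  involves a second kernel.
\<close>
lemma
  fixes p :: "real \<Rightarrow> real" and F :: "real \<Rightarrow> real"
  assumes pc: "continuous_on UNIV p" and pb: "\<And>z. z \<ge> 0 \<Longrightarrow> \<bar>p z\<bar> \<le> P"
    and Fc: "continuous_on UNIV F" and Fb: "\<And>t. \<bar>F t\<bar> \<le> B * majorant t"
  shows kernel_integrable: "set_integrable lborel {0..} (\<lambda>z. p z * F (x + z))"
    and kernel_bound: "\<bar>LINT z:{0..}|lborel. p z * F (x + z)\<bar> \<le> P * B * (\<kappa>0 * (weight x - 1))"
proof -
  have P0: "P \<ge> 0" using pb[of 0] by auto
  have mi: "set_integrable lborel {0..} (\<lambda>z. majorant (x + z))"
    using majorant_integrable LINT_shift(2) by blast
  have Fc': "continuous_on UNIV (\<lambda>z. F (x + z))"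
    by (rule continuous_on_compose2[OF Fc]) (auto intro!: continuous_intros)
  have bd: "\<bar>p z * F (x + z)\<bar> \<le> P * B * majorant (x + z)" if "z \<ge> 0" for z
    using mult_mono[OF pb[OF that] Fb[of "x+z"] P0] by (simp add: abs_mult mult.assoc)
  show i: "set_integrable lborel {0..} (\<lambda>z. p z * F (x + z))"
  proof (rule set_integrable_bound)
    show "set_integrable lborel {0..} (\<lambda>z. P * B * majorant (x + z))" using mi by (rule set_integrable_mult_right)
    have "(\<lambda>z. p z * F (x + z)) \<in> borel_measurable borel"
      by (intro borel_measurable_continuous_onI continuous_intros pc Fc')
    then show "set_borel_measurable lborel {0..} (\<lambda>z. p z * F (x + z))"
      unfolding set_borel_measurable_def by measurable
    show "AE z in lborel. z \<in> {0..} \<longrightarrow> norm (p z * F (x + z)) \<le> norm (P * B * majorant (x + z))"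
      using bd by (auto intro!: AE_I2 order_trans[OF bd])
  qed
  have "\<bar>LINT z:{0..}|lborel. p z * F (x + z)\<bar> \<le> (LINT z:{0..}|lborel. \<bar>p z * F (x + z)\<bar>)"
    using set_integral_norm_bound[OF i] by simp
  also have "\<dots> \<le> (LINT z:{0..}|lborel. P * B * majorant (x + z))"
    by (rule set_integral_mono) (use i mi bd in \<open>auto intro: set_integrable_abs\<close>)
  also have "\<dots> = P * B * (LINT z:{0..}|lborel. majorant (x + z))" by simp
  also have "(LINT z:{0..}|lborel. majorant (x + z)) = \<kappa>0 * (weight x - 1)"
    using majorant_LINT LINT_shift(1) by simp
  finally show "\<bar>LINT z:{0..}|lborel. p z * F (x + z)\<bar> \<le> P * B * (\<kappa>0 * (weight x - 1))" .
qed

text \<open>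
  Along a convergent sequence of parameters the points \<open>x\<close> stay to the right of some \<open>L\<close>; since the
  majorant is decreasing, its translate by \<open>L\<close> dominates all integrands.
\<close>
lemma kernel_continuous:
  fixes p :: "real \<times> real \<Rightarrow> real" and F :: "real \<times> real \<Rightarrow> real"
  assumes pc: "continuous_on UNIV p" and pb: "\<And>\<kappa> z. z \<ge> 0 \<Longrightarrow> \<bar>p (\<kappa>, z)\<bar> \<le> P"
    and Fc: "continuous_on UNIV F" and Fb: "\<And>t \<kappa>. \<bar>F (t, \<kappa>)\<bar> \<le> B * majorant t"
  shows "continuous_on UNIV (\<lambda>(x, \<kappa>). LINT z:{0..}|lborel. p (\<kappa>, z) * F (x + z, \<kappa>))"
  unfolding continuous_on_eq_continuous_within continuous_at_sequentially
proof (intro ballI allI impI)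
  fix a :: "real \<times> real" and X :: "nat \<Rightarrow> real \<times> real" assume X: "X \<longlonglongrightarrow> a"
  have P0: "P \<ge> 0" using pb[of 0 0] by auto
  have B0: "B \<ge> 0"
  proof -
    have "0 \<le> B * majorant 0" using Fb[of 0 0] by linarith
    moreover have "majorant 0 > 0" using C_pos weight_gt_1[of 0] by (simp add: majorant_def)
    ultimately show ?thesis by (simp add: zero_le_mult_iff)
  qed
  have X1: "(\<lambda>n. fst (X n)) \<longlonglongrightarrow> fst a" and X2: "(\<lambda>n. snd (X n)) \<longlonglongrightarrow> snd a"
    using X by (auto intro: tendsto_fst tendsto_snd)
  obtain L where L: "\<And>n. L \<le> fst (X n)"
  proof -
    have "Bseq (\<lambda>n. fst (X n))" using X1 by (rule convergentI[THEN convergent_imp_Bseq])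
    then obtain K where "\<And>n. norm (fst (X n)) \<le> K" unfolding Bseq_def by blast
    then show ?thesis using that[of "- K"] by (simp add: abs_le_iff minus_le_iff)
  qed
  have slice: "continuous_on UNIV (\<lambda>z. p (\<kappa>, z) * F (x + z, \<kappa>))" for x \<kappa>
    by (intro continuous_on_mult continuous_on_compose2[OF pc] continuous_on_compose2[OF Fc]) (auto intro!: continuous_intros)
  have meas: "(\<lambda>z. indicat_real {0..} z *\<^sub>R (p (\<kappa>, z) * F (x + z, \<kappa>))) \<in> borel_measurable lborel" for x \<kappa>
    using borel_measurable_continuous_onI[OF slice] by measurable
  have "(\<lambda>n. LINT z|lborel. indicat_real {0..} z *\<^sub>R (p (snd (X n), z) * F (fst (X n) + z, snd (X n)))) \<longlonglongrightarrow>
      (LINT z|lborel. indicat_real {0..} z *\<^sub>R (p (snd a, z) * F (fst a + z, snd a)))"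
  proof (rule integral_dominated_convergence)
    show "integrable lborel (\<lambda>z. P * B * (indicat_real {0..} z *\<^sub>R majorant (L + z)))"
      using majorant_integrable[of L] LINT_shift(2)[of majorant L] by (simp add: set_integrable_def)
    show "AE z in lborel. (\<lambda>n. indicat_real {0..} z *\<^sub>R (p (snd (X n), z) * F (fst (X n) + z, snd (X n)))) \<longlonglongrightarrow>
       indicat_real {0..} z *\<^sub>R (p (snd a, z) * F (fst a + z, snd a))"
    proof (rule AE_I2)
      fix z
      have "(\<lambda>n. p (snd (X n), z)) \<longlonglongrightarrow> p (snd a, z)"
        by (rule continuous_on_tendsto_compose[OF pc]) (auto intro!: tendsto_intros X2)
      moreover have "(\<lambda>n. F (fst (X n) + z, snd (X n))) \<longlonglongrightarrow> F (fst a + z, snd a)"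
        by (rule continuous_on_tendsto_compose[OF Fc]) (auto intro!: tendsto_intros X1 X2)
      ultimately show "(\<lambda>n. indicat_real {0..} z *\<^sub>R (p (snd (X n), z) * F (fst (X n) + z, snd (X n)))) \<longlonglongrightarrow>
       indicat_real {0..} z *\<^sub>R (p (snd a, z) * F (fst a + z, snd a))"
        by (intro tendsto_intros)
    qed
    show "AE z in lborel. norm (indicat_real {0..} z *\<^sub>R (p (snd (X n), z) * F (fst (X n) + z, snd (X n)))) \<le> P * B * (indicat_real {0..} z *\<^sub>R majorant (L + z))" for n
    proof (rule AE_I2)
      fix z
      show "norm (indicat_real {0..} z *\<^sub>R (p (snd (X n), z) * F (fst (X n) + z, snd (X n)))) \<le> P * B * (indicat_real {0..} z *\<^sub>R majorant (L + z))"
      proof (cases "z \<ge> 0")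
        case True
        have "\<bar>p (snd (X n), z)\<bar> * \<bar>F (fst (X n) + z, snd (X n))\<bar> \<le> P * (B * majorant (L + z))"
          by (intro mult_mono pb True P0 order_trans[OF Fb] mult_left_mono majorant_antimono B0) (use L in auto)
        then show ?thesis using True by (simp add: abs_mult mult.assoc)
      qed simp
    qed
  qed (use meas in auto)
  then show "((\<lambda>(x, \<kappa>). LINT z:{0..}|lborel. p (\<kappa>, z) * F (x + z, \<kappa>)) \<circ> X) \<longlonglongrightarrow>
     (\<lambda>(x, \<kappa>). LINT z:{0..}|lborel. p (\<kappa>, z) * F (x + z, \<kappa>)) a"
    by (simp add: o_def case_prod_unfold set_lebesgue_integral_def)
qed


text \<open>
  Rates below \<open>\<kappa>0\<close> are replaced by \<open>\<kappa>0\<close>, so that the kernel is bounded for every real parameter.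
\<close>
definition decay_rate :: "real \<Rightarrow> real" where "decay_rate \<kappa> = max \<kappa> \<kappa>0"

definition volterra_kernel :: "real \<times> real \<Rightarrow> real" where
  "volterra_kernel = (\<lambda>(\<kappa>, z). (1 - exp (- 2 * decay_rate \<kappa> * z)) / (2 * decay_rate \<kappa>))"

lemma decay_rate_ge: "decay_rate \<kappa> \<ge> \<kappa>0" and decay_rate_pos: "decay_rate \<kappa> > 0"
  using \<kappa>0_pos by (auto simp: decay_rate_def)

lemma decay_rate_cont: "continuous_on S decay_rate"
  unfolding decay_rate_def by (intro continuous_intros)

lemma volterra_kernel_cont: "continuous_on UNIV volterra_kernel"
  unfolding volterra_kernel_def case_prod_unfold
  by (intro continuous_intros continuous_on_compose2[OF decay_rate_cont]) (use decay_rate_pos in \<open>auto simp: less_le\<close>)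

lemma volterra_kernel_bound: "z \<ge> 0 \<Longrightarrow> \<bar>volterra_kernel (\<kappa>, z)\<bar> \<le> 1 / (2 * decay_rate \<kappa>)"
  using decay_rate_pos[of \<kappa>] by (auto simp: volterra_kernel_def abs_mult divide_right_mono)

lemma volterra_kernel_bound': "z \<ge> 0 \<Longrightarrow> \<bar>volterra_kernel (\<kappa>, z)\<bar> \<le> 1 / (2 * \<kappa>0)"
  by (rule order_trans[OF volterra_kernel_bound]) (use decay_rate_ge[of \<kappa>] \<kappa>0_pos in \<open>auto intro!: divide_left_mono\<close>)

definition weighted_source :: "((real \<times> real) \<Rightarrow>\<^sub>C real) \<Rightarrow> real \<times> real \<Rightarrow> real" where
  "weighted_source b = (\<lambda>(t, \<kappa>). W t * weight t * apply_bcontfun b (t, \<kappa>))"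

lemma weighted_source_cont: "continuous_on UNIV (weighted_source b)"
  unfolding weighted_source_def case_prod_unfold
  by (intro continuous_intros continuous_on_compose2[OF W_cont] continuous_on_compose2[OF weight_cont]
      continuous_on_compose2[OF continuous_on_apply_bcontfun[of UNIV b]]) auto

lemma weighted_source_bound: "\<bar>weighted_source b (t, \<kappa>)\<bar> \<le> norm b * majorant t"
proof -
  have "\<bar>W t\<bar> * weight t * \<bar>apply_bcontfun b (t, \<kappa>)\<bar> \<le> (C * exp (- \<delta> * t)) * weight t * norm b"
    using norm_bounded[of b "(t, \<kappa>)"] W_bound[of t] weight_gt_1[of t] C_pos
    by (intro mult_mono) auto
  then show ?thesis using weight_gt_1[of t] by (simp add: weighted_source_def majorant_def abs_mult ac_simps)
qed

definition volterra_integral :: "((real \<times> real) \<Rightarrow>\<^sub>C real) \<Rightarrow> real \<times> real \<Rightarrow> real" where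
  "volterra_integral b = (\<lambda>(x, \<kappa>). LINT z:{0..}|lborel. volterra_kernel (\<kappa>, z) * weighted_source b (x + z, \<kappa>))"

lemma weighted_source_slice_cont: "continuous_on UNIV (\<lambda>t. weighted_source b (t, \<kappa>))"
  by (rule continuous_on_compose2[OF weighted_source_cont]) (auto intro!: continuous_intros)

lemma volterra_kernel_slice_cont: "continuous_on UNIV (\<lambda>z. volterra_kernel (\<kappa>, z))"
  by (rule continuous_on_compose2[OF volterra_kernel_cont]) (auto intro!: continuous_intros)

lemma volterra_integral_bound: "\<bar>volterra_integral b (x, \<kappa>)\<bar> \<le> norm b / 2 * (weight x - 1)"
proof -
  have "\<bar>volterra_integral b (x, \<kappa>)\<bar> \<le> 1 / (2 * \<kappa>0) * norm b * (\<kappa>0 * (weight x - 1))"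
    unfolding volterra_integral_def prod.case
    by (rule kernel_bound[OF volterra_kernel_slice_cont volterra_kernel_bound' weighted_source_slice_cont weighted_source_bound])
  then show ?thesis using \<kappa>0_pos by simp
qed

lemma volterra_integral_bound_rate: "\<bar>volterra_integral b (x, \<kappa>)\<bar> \<le> \<kappa>0 * norm b / (2 * decay_rate \<kappa>) * (weight x - 1)"
proof -
  have "\<bar>volterra_integral b (x, \<kappa>)\<bar> \<le> 1 / (2 * decay_rate \<kappa>) * norm b * (\<kappa>0 * (weight x - 1))"
    unfolding volterra_integral_def prod.case
    by (rule kernel_bound[OF volterra_kernel_slice_cont volterra_kernel_bound weighted_source_slice_cont weighted_source_bound])
  then show ?thesis by (simp add: ac_simps)
qed

lemma volterra_integral_diff: "volterra_integral (b - c) p = volterra_integral b p - volterra_integral c p"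
proof -
  obtain x \<kappa> where p: "p = (x, \<kappa>)" by (cases p)
  have i: "set_integrable lborel {0..} (\<lambda>z. volterra_kernel (\<kappa>, z) * weighted_source b (x + z, \<kappa>))" for b
    by (rule kernel_integrable[OF volterra_kernel_slice_cont volterra_kernel_bound' weighted_source_slice_cont weighted_source_bound])
  have "(\<lambda>z. volterra_kernel (\<kappa>, z) * weighted_source (b - c) (x + z, \<kappa>)) = (\<lambda>z. volterra_kernel (\<kappa>, z) * weighted_source b (x + z, \<kappa>) - volterra_kernel (\<kappa>, z) * weighted_source c (x + z, \<kappa>))"
    by (auto simp: weighted_source_def algebra_simps)
  then show ?thesis using set_integral_diff(2)[OF i[of b] i[of c]] by (simp add: p volterra_integral_def)
qed

definition volterra_map :: "((real \<times> real) \<Rightarrow>\<^sub>C real) \<Rightarrow> ((real \<times> real) \<Rightarrow>\<^sub>C real)" where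
  "volterra_map b = Bcontfun (\<lambda>p. (1 - volterra_integral b p) / weight (fst p))"

lemma apply_volterra_map: "apply_bcontfun (volterra_map b) p = (1 - volterra_integral b p) / weight (fst p)"
proof -
  have "continuous_on UNIV (volterra_integral b)"
    unfolding volterra_integral_def
    by (rule kernel_continuous[OF volterra_kernel_cont volterra_kernel_bound' weighted_source_cont weighted_source_bound])
  then have c: "continuous_on UNIV (\<lambda>p. (1 - volterra_integral b p) / weight (fst p))"
  proof (intro continuous_on_divide continuous_on_diff continuous_on_const)
    show "continuous_on UNIV (\<lambda>p :: real \<times> real. weight (fst p))"
      by (rule continuous_on_compose2[OF weight_cont[of UNIV]]) (auto intro!: continuous_intros)
    show "\<forall>p\<in>UNIV. weight (fst p) \<noteq> 0" using weight_gt_1 by (metis less_asym zero_less_one)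
  qed
  have "norm ((1 - volterra_integral b p) / weight (fst p)) \<le> 1 + norm b / 2" for p
  proof -
    have w: "weight (fst p) > 1" by (rule weight_gt_1)
    have "\<bar>1 - volterra_integral b p\<bar> \<le> 1 + norm b / 2 * (weight (fst p) - 1)"
      using volterra_integral_bound[of b "fst p" "snd p"] by simp
    also have "\<dots> \<le> weight (fst p) * 1 + norm b / 2 * weight (fst p)"
      using w by (intro add_mono mult_left_mono) auto
    also have "\<dots> = (1 + norm b / 2) * weight (fst p)" by (simp add: algebra_simps)
    finally show ?thesis using w by (simp add: divide_le_eq)
  qed
  then have "(\<lambda>p. (1 - volterra_integral b p) / weight (fst p)) \<in> bcontfun"
    using c by (intro bcontfun_normI)
  then show ?thesis by (simp add: volterra_map_def Bcontfun_inverse)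
qed

lemma volterra_map_contraction: "dist (volterra_map b) (volterra_map c) \<le> 1 / 2 * dist b c"
proof (rule dist_bound)
  fix p :: "real \<times> real"
  have w: "weight (fst p) > 1" by (rule weight_gt_1)
  have "dist (apply_bcontfun (volterra_map b) p) (apply_bcontfun (volterra_map c) p) = \<bar>volterra_integral (b - c) p\<bar> / weight (fst p)"
    using w by (simp add: apply_volterra_map dist_real_def volterra_integral_diff diff_divide_distrib[symmetric] abs_minus_commute)
  also have "\<dots> \<le> (norm (b - c) / 2 * (weight (fst p) - 1)) / weight (fst p)"
    using volterra_integral_bound[of "b - c" "fst p" "snd p"] w by (intro divide_right_mono) auto
  also have "\<dots> \<le> norm (b - c) / 2"
    using w by (simp add: divide_le_eq mult_left_mono)
  finally show "dist (apply_bcontfun (volterra_map b) p) (apply_bcontfun (volterra_map c) p) \<le> 1 / 2 * dist b c"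
    by (simp add: dist_norm)
qed

definition jost_bcontfun :: "(real \<times> real) \<Rightarrow>\<^sub>C real" where
  "jost_bcontfun = (THE b. volterra_map b = b)"

lemma volterra_map_jost: "volterra_map jost_bcontfun = jost_bcontfun"
proof -
  have "\<exists>!b. volterra_map b = b"
    by (rule banach_fix_type[of "1/2"]) (use volterra_map_contraction in auto)
  then show ?thesis unfolding jost_bcontfun_def by (rule theI')
qed

text \<open>
  The modulation is the factor \<open>h\<close> of the Volterra equation; the fixed point is this factor divided by the weight.
\<close>
definition modulation :: "real \<Rightarrow> real \<Rightarrow> real" where
  "modulation \<kappa> x = weight x * apply_bcontfun jost_bcontfun (x, \<kappa>)"

definition modulation_slope :: "real \<Rightarrow> real \<Rightarrow> real" where
  "modulation_slope \<kappa> x = (LINT z:{0..}|lborel. exp (- 2 * decay_rate \<kappa> * z) * (W (x + z) * modulation \<kappa> (x + z)))"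

lemma weighted_source_jost: "weighted_source jost_bcontfun (t, \<kappa>) = W t * modulation \<kappa> t"
  by (simp add: weighted_source_def modulation_def)

lemma modulation_eq: "modulation \<kappa> x = 1 - volterra_integral jost_bcontfun (x, \<kappa>)"
  using arg_cong[OF volterra_map_jost, of "\<lambda>b. apply_bcontfun b (x, \<kappa>)"] weight_gt_1[of x]
  by (simp add: apply_volterra_map modulation_def field_simps)

lemma modulation_bound: "\<bar>modulation \<kappa> x - 1\<bar> \<le> \<kappa>0 * norm jost_bcontfun / (2 * decay_rate \<kappa>) * (weight x - 1)"
  using volterra_integral_bound_rate[of jost_bcontfun x \<kappa>] by (simp add: modulation_eq)

lemma exp_kernel:
  "continuous_on UNIV (\<lambda>(\<kappa>, z). exp (- 2 * decay_rate \<kappa> * z))"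
  "z \<ge> 0 \<Longrightarrow> \<bar>(\<lambda>(\<kappa>, z). exp (- 2 * decay_rate \<kappa> * z)) (\<kappa>, z)\<bar> \<le> 1"
  using decay_rate_pos[of \<kappa>]
  by (auto simp: case_prod_unfold intro!: continuous_intros continuous_on_compose2[OF decay_rate_cont])

lemma modulation_slope_bound: "\<bar>modulation_slope \<kappa> x\<bar> \<le> \<kappa>0 * norm jost_bcontfun * (weight x - 1)"
proof -
  have "\<bar>modulation_slope \<kappa> x\<bar> \<le> 1 * norm jost_bcontfun * (\<kappa>0 * (weight x - 1))"
    unfolding modulation_slope_def weighted_source_jost[symmetric]
    by (rule kernel_bound[OF _ _ weighted_source_slice_cont weighted_source_bound])
      (use exp_kernel(2) in \<open>auto intro!: continuous_intros\<close>)
  then show ?thesis by (simp add: ac_simps)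
qed

lemma modulation_cont_rate: "continuous_on S (\<lambda>\<kappa>. modulation \<kappa> x)"
  unfolding modulation_def
  by (intro continuous_intros continuous_on_compose2[OF continuous_on_apply_bcontfun[of UNIV]]) auto

lemma modulation_slope_cont_rate: "continuous_on S (\<lambda>\<kappa>. modulation_slope \<kappa> x)"
proof -
  have "continuous_on UNIV (\<lambda>(x, \<kappa>). LINT z:{0..}|lborel. (\<lambda>(\<kappa>, z). exp (- 2 * decay_rate \<kappa> * z)) (\<kappa>, z) * weighted_source jost_bcontfun (x + z, \<kappa>))"
    by (rule kernel_continuous[OF exp_kernel weighted_source_cont weighted_source_bound])
  then have "continuous_on S (\<lambda>\<kappa>. (\<lambda>(x, \<kappa>). LINT z:{0..}|lborel. (\<lambda>(\<kappa>, z). exp (- 2 * decay_rate \<kappa> * z)) (\<kappa>, z) * weighted_source jost_bcontfun (x + z, \<kappa>)) (x, \<kappa>))"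
    by (rule continuous_on_compose2) (auto intro!: continuous_intros)
  then show ?thesis by (simp add: modulation_slope_def weighted_source_jost)
qed

text \<open>
  Splitting the kernel, \<open>2 * k * h = 2 * k - J + N\<close> with the tail integral \<open>J\<close> of \<open>q = W * h\<close> and the
  slope \<open>N x = exp (2 * k * x) * (\<integral>t\<ge>x. exp (- 2 * k * t) * q t)\<close>. Here \<open>J' = - q\<close> and
  \<open>N' = 2 * k * N - q\<close>, so the terms \<open>q\<close> cancel in \<open>h'\<close>.
\<close>
lemma
  shows modulation_slope_deriv: "(modulation_slope \<kappa> has_real_derivative 2 * decay_rate \<kappa> * modulation_slope \<kappa> x - W x * modulation \<kappa> x) (at x)"
    and modulation_deriv: "(modulation \<kappa> has_real_derivative modulation_slope \<kappa> x) (at x)"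
proof -
  define k where "k = decay_rate \<kappa>"
  have k: "k > 0" by (simp add: k_def decay_rate_pos)
  define q where "q t = W t * modulation \<kappa> t" for t
  have q: "continuous_on UNIV q" "\<bar>q t\<bar> \<le> norm jost_bcontfun * majorant t" for t
    using weighted_source_slice_cont[of jost_bcontfun \<kappa>] weighted_source_bound[of jost_bcontfun t \<kappa>]
    by (simp_all add: weighted_source_jost q_def[abs_def])
  have ib: "set_integrable lborel {0..} (\<lambda>z. p z * q (x + z))" if "continuous_on UNIV p" "\<And>z. z \<ge> 0 \<Longrightarrow> \<bar>p z\<bar> \<le> 1" for p x
    by (rule kernel_integrable[OF that q])
  have i0: "set_integrable lborel {0..} (\<lambda>z. q (x + z))" for x
    using ib[of "\<lambda>_. 1" x] by simp
  have i1: "set_integrable lborel {0..} (\<lambda>z. exp (- 2 * k * z) * q (x + z))" for x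
    by (rule ib) (use k in \<open>auto intro!: continuous_intros\<close>)
  define J where "J x = (LINT t:{x..}|lborel. q t)" for x
  define E where "E x = (LINT t:{x..}|lborel. exp (- 2 * k * t) * q t)" for x
  have Jd: "(J has_real_derivative - q x) (at x)" for x
    unfolding J_def by (rule tail_integral_has_derivative) (use q i0 LINT_shift(2) in auto)
  have e: "exp (- 2 * k * (x + z)) * q (x + z) = exp (- 2 * k * x) * (exp (- 2 * k * z) * q (x + z))" for x z
    by (simp add: exp_add[symmetric] algebra_simps)
  have i2: "set_integrable lborel {x..} (\<lambda>t. exp (- 2 * k * t) * q t)" for x
    by (subst LINT_shift(2)[symmetric], unfold e) (rule set_integrable_mult_right[OF i1])
  have Ed: "(E has_real_derivative - (exp (- 2 * k * x) * q x)) (at x)" for x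
    unfolding E_def by (rule tail_integral_has_derivative) (use q i2 in \<open>auto intro!: continuous_intros\<close>)
  have slope: "modulation_slope \<kappa> x = exp (2 * k * x) * E x" for x
  proof -
    have "E x = exp (- 2 * k * x) * modulation_slope \<kappa> x"
      unfolding E_def by (subst LINT_shift(1)[symmetric], unfold e) (simp add: modulation_slope_def q_def k_def)
    then show ?thesis by (simp add: mult.assoc[symmetric] exp_add[symmetric])
  qed
  have ms: "modulation_slope \<kappa> = (\<lambda>x. exp (2 * k * x) * E x)" using slope by auto
  show sd: "(modulation_slope \<kappa> has_real_derivative 2 * decay_rate \<kappa> * modulation_slope \<kappa> x - W x * modulation \<kappa> x) (at x)" for x
  proof -
    have "((\<lambda>x. exp (2 * k * x) * E x) has_real_derivative exp (2 * k * x) * (2 * k) * E x + - (exp (- 2 * k * x) * q x) * exp (2 * k * x)) (at x)"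
      by (rule DERIV_mult'[THEN DERIV_cong]) (auto intro!: derivative_eq_intros Ed)
    moreover have "- (exp (- 2 * k * x) * q x) * exp (2 * k * x) = - q x"
      by (simp add: exp_minus)
    ultimately have "((\<lambda>x. exp (2 * k * x) * E x) has_real_derivative 2 * k * (exp (2 * k * x) * E x) - q x) (at x)"
      by (simp only: mult_ac diff_conv_add_uminus)
    then show ?thesis unfolding ms q_def k_def .
  qed
  have sd': "(modulation_slope \<kappa> has_real_derivative 2 * k * modulation_slope \<kappa> x - q x) (at x)"
    using sd unfolding q_def k_def .
  have mod: "modulation \<kappa> = (\<lambda>x. 1 - (J x - modulation_slope \<kappa> x) / (2 * k))"
  proof
    fix x
    have "volterra_integral jost_bcontfun (x, \<kappa>) = (LINT z:{0..}|lborel. (q (x + z) - exp (- 2 * k * z) * q (x + z)) / (2 * k))"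
      by (simp add: volterra_integral_def volterra_kernel_def weighted_source_jost q_def k_def algebra_simps diff_divide_distrib)
    also have "\<dots> = (LINT z:{0..}|lborel. (q (x + z) - exp (- 2 * k * z) * q (x + z))) / (2 * k)"
      by (rule set_integral_divide_zero)
    also have "(LINT z:{0..}|lborel. (q (x + z) - exp (- 2 * k * z) * q (x + z))) = (LINT z:{0..}|lborel. q (x + z)) - (LINT z:{0..}|lborel. exp (- 2 * k * z) * q (x + z))"
      by (rule set_integral_diff(2)[OF i0 i1])
    also have "\<dots> = J x - modulation_slope \<kappa> x"
      unfolding J_def LINT_shift(1)[of q x] by (simp only: modulation_slope_def q_def k_def)
    finally show "modulation \<kappa> x = 1 - (J x - modulation_slope \<kappa> x) / (2 * k)" by (simp add: modulation_eq)
  qed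
  have "((\<lambda>x. 1 - (J x - modulation_slope \<kappa> x) / (2 * k)) has_real_derivative modulation_slope \<kappa> x) (at x)"
    by (rule DERIV_cong[OF DERIV_diff[OF DERIV_const DERIV_cdivide[OF DERIV_diff[OF Jd sd']]]]) (use k in simp)
  then show "(modulation \<kappa> has_real_derivative modulation_slope \<kappa> x) (at x)" unfolding mod[symmetric] .
qed

definition jost :: "real \<Rightarrow> real \<Rightarrow> real" where "jost \<kappa> x = exp (- \<kappa> * x) * modulation \<kappa> x"

definition jost_deriv :: "real \<Rightarrow> real \<Rightarrow> real" where
  "jost_deriv \<kappa> x = exp (- \<kappa> * x) * (modulation_slope \<kappa> x - \<kappa> * modulation \<kappa> x)"

lemma jost_has_derivative: "(jost \<kappa> has_real_derivative jost_deriv \<kappa> x) (at x)"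
  unfolding jost_def[abs_def] jost_deriv_def
  by (rule DERIV_mult'[THEN DERIV_cong, OF _ modulation_deriv]) (auto intro!: derivative_eq_intros simp: algebra_simps)

lemma jost_deriv_has_derivative:
  assumes "\<kappa> \<ge> \<kappa>0"
  shows "(jost_deriv \<kappa> has_real_derivative (\<kappa>\<^sup>2 - W x) * jost \<kappa> x) (at x)"
proof -
  have d: "decay_rate \<kappa> = \<kappa>" using assms by (simp add: decay_rate_def)
  have D: "((\<lambda>x. modulation_slope \<kappa> x - \<kappa> * modulation \<kappa> x) has_real_derivative
     (2 * \<kappa> * modulation_slope \<kappa> x - W x * modulation \<kappa> x) - \<kappa> * modulation_slope \<kappa> x) (at x)"
    using modulation_slope_deriv[of \<kappa> x] modulation_deriv[of \<kappa> x] unfolding d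
    by (intro DERIV_diff DERIV_cmult)
  have "((\<lambda>x. exp (- \<kappa> * x)) has_real_derivative - \<kappa> * exp (- \<kappa> * x)) (at x)"
    by (auto intro!: derivative_eq_intros)
  from DERIV_mult[OF this D] show ?thesis
    unfolding jost_def[abs_def] jost_deriv_def[abs_def]
    by (rule DERIV_cong) (simp add: algebra_simps power2_eq_square)
qed

lemma jost_cont_rate: "continuous_on S (\<lambda>\<kappa>. jost \<kappa> x)"
  unfolding jost_def by (intro continuous_intros modulation_cont_rate)

lemma jost_deriv_cont_rate: "continuous_on S (\<lambda>\<kappa>. jost_deriv \<kappa> x)"
  unfolding jost_deriv_def by (intro continuous_intros modulation_cont_rate modulation_slope_cont_rate)

lemma modulation_tendsto: "(modulation \<kappa> \<longlongrightarrow> 1) at_top"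
proof -
  have "((\<lambda>x. \<kappa>0 * norm jost_bcontfun / (2 * decay_rate \<kappa>) * (weight x - 1)) \<longlongrightarrow> \<kappa>0 * norm jost_bcontfun / (2 * decay_rate \<kappa>) * (1 - 1)) at_top"
    by (intro tendsto_intros weight_tendsto)
  then have l: "((\<lambda>x. \<kappa>0 * norm jost_bcontfun / (2 * decay_rate \<kappa>) * (weight x - 1)) \<longlongrightarrow> 0) at_top" by simp
  have "((\<lambda>x. modulation \<kappa> x - 1) \<longlongrightarrow> 0) at_top"
    by (rule Lim_null_comparison[OF always_eventually l]) (simp only: real_norm_def modulation_bound simp_thms)
  then show ?thesis by (simp only: LIM_zero_iff)
qed

lemma modulation_slope_tendsto: "(modulation_slope \<kappa> \<longlongrightarrow> 0) at_top"
proof -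
  have "((\<lambda>x. \<kappa>0 * norm jost_bcontfun * (weight x - 1)) \<longlongrightarrow> \<kappa>0 * norm jost_bcontfun * (1 - 1)) at_top"
    by (intro tendsto_intros weight_tendsto)
  then have l: "((\<lambda>x. \<kappa>0 * norm jost_bcontfun * (weight x - 1)) \<longlongrightarrow> 0) at_top" by simp
  show ?thesis
    by (rule Lim_null_comparison[OF always_eventually l]) (simp only: real_norm_def modulation_slope_bound simp_thms)
qed

lemma jost_eventually_pos: "\<forall>\<^sub>F x in at_top. jost \<kappa> x > 0"
proof -
  have "\<forall>\<^sub>F x in at_top. 0 < modulation \<kappa> x"
    by (rule order_tendstoD(1)[OF modulation_tendsto]) simp
  then show ?thesis by eventually_elim (simp add: jost_def)
qed

text \<open>The kernel is of order \<open>1 / \<kappa>\<close>, so for large rates the potential is negligible.\<close>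
lemma modulation_large_rate: "((\<lambda>\<kappa>. modulation \<kappa> x) \<longlongrightarrow> 1) at_top"
proof -
  have "((\<lambda>\<kappa>. \<kappa>0 * norm jost_bcontfun / (2 * \<kappa>) * (weight x - 1)) \<longlongrightarrow> 0) at_top"
  proof -
    have "((\<lambda>\<kappa>. \<kappa>0 * norm jost_bcontfun * (weight x - 1) / 2 * inverse \<kappa>) \<longlongrightarrow> \<kappa>0 * norm jost_bcontfun * (weight x - 1) / 2 * 0) at_top"
      by (intro tendsto_intros tendsto_inverse_0_at_top filterlim_ident)
    then show ?thesis by (simp add: field_simps)
  qed
  moreover have "\<forall>\<^sub>F \<kappa> in at_top. norm (modulation \<kappa> x - 1) \<le> \<kappa>0 * norm jost_bcontfun / (2 * \<kappa>) * (weight x - 1)"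
    using eventually_ge_at_top[of \<kappa>0]
  proof eventually_elim
    case (elim \<kappa>)
    then show ?case using modulation_bound[of \<kappa> x] by (simp add: decay_rate_def max_def)
  qed
  ultimately have "((\<lambda>\<kappa>. modulation \<kappa> x - 1) \<longlongrightarrow> 0) at_top"
    by (rule Lim_null_comparison[rotated])
  then show ?thesis by (simp only: LIM_zero_iff)
qed

lemma jost_large_rate_pos: "\<forall>\<^sub>F \<kappa> in at_top. jost \<kappa> x > 0"
proof -
  have "\<forall>\<^sub>F \<kappa> in at_top. 0 < modulation \<kappa> x"
    by (rule order_tendstoD(1)[OF modulation_large_rate]) simp
  then show ?thesis by eventually_elim (simp add: jost_def)
qed

text \<open>
  With the exponential factored out, the expression is \<open>N - (\<kappa> - c) * h\<close>, where \<open>N\<close> is bounded and \<open>h\<close>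
  tends to one as \<open>\<kappa>\<close> grows.
\<close>
lemma jost_large_rate_Robin_neg: "\<forall>\<^sub>F \<kappa> in at_top. jost_deriv \<kappa> x + c * jost \<kappa> x < 0"
proof -
  define K where "K = \<kappa>0 * norm jost_bcontfun * (weight x - 1)"
  have "\<forall>\<^sub>F \<kappa> in at_top. modulation \<kappa> x > 1/2"
    by (rule order_tendstoD(1)[OF modulation_large_rate]) simp
  then show ?thesis using eventually_gt_at_top[of "c + 2 * K"] eventually_gt_at_top[of "c"]
  proof eventually_elim
    case (elim \<kappa>)
    have "(\<kappa> - c) * (1/2) \<le> (\<kappa> - c) * modulation \<kappa> x" using elim by (intro mult_left_mono) auto
    moreover have "modulation_slope \<kappa> x \<le> K" using modulation_slope_bound[of \<kappa> x] by (simp add: K_def)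
    ultimately have "modulation_slope \<kappa> x - \<kappa> * modulation \<kappa> x + c * modulation \<kappa> x < 0"
      using elim unfolding left_diff_distrib by linarith
    moreover have "jost_deriv \<kappa> x + c * jost \<kappa> x = exp (- \<kappa> * x) * (modulation_slope \<kappa> x - \<kappa> * modulation \<kappa> x + c * modulation \<kappa> x)"
      by (simp add: jost_def jost_deriv_def algebra_simps)
    ultimately show ?case by (simp add: mult_less_0_iff)
  qed
qed

end

section \<open>Sturm comparison on a half line\<close>

text \<open>
  The energy \<open>y\<^sup>2 + y'\<^sup>2\<close> satisfies a differential inequality of Gronwall type in both directions.
\<close>
lemma linear_ode_unique:
  fixes y y' Q :: "real \<Rightarrow> real"
  assumes d: "\<And>x. x \<in> {p..q} \<Longrightarrow> (y has_real_derivative y' x) (at x)"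
    and d': "\<And>x. x \<in> {p..q} \<Longrightarrow> (y' has_real_derivative Q x * y x) (at x)"
    and Q: "continuous_on {p..q} Q" and x0: "x0 \<in> {p..q}" "y x0 = 0" "y' x0 = 0" and x: "x \<in> {p..q}"
  shows "y x = 0 \<and> y' x = 0"
proof -
  obtain M where M: "\<And>x. x \<in> {p..q} \<Longrightarrow> norm (Q x) \<le> M"
    using compact_imp_bounded[OF compact_continuous_image[OF Q compact_Icc]] unfolding bounded_iff by blast
  define L where "L = 1 + M"
  define E where "E x = (y x)\<^sup>2 + (y' x)\<^sup>2" for x
  define D where "D x = (1 + Q x) * (2 * (y x * y' x))" for x
  have Ed: "(E has_real_derivative D x) (at x)" if "x \<in> {p..q}" for x
    unfolding E_def D_def
    by (rule DERIV_cong[OF DERIV_add[OF DERIV_power[OF d[OF that]] DERIV_power[OF d'[OF that]]]]) (simp add: algebra_simps)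
  have DE: "\<bar>D x\<bar> \<le> L * E x" if "x \<in> {p..q}" for x
  proof -
    have "\<bar>1 + Q x\<bar> \<le> L" using M[OF that] by (simp add: L_def abs_le_iff)
    moreover have "2 * \<bar>y x * y' x\<bar> \<le> E x"
      using sum_squares_bound[of "\<bar>y x\<bar>" "\<bar>y' x\<bar>"] by (simp add: E_def abs_mult)
    ultimately have "\<bar>1 + Q x\<bar> * (2 * \<bar>y x * y' x\<bar>) \<le> L * E x"
      by (intro mult_mono) auto
    then show ?thesis by (simp only: D_def abs_mult abs_numeral)
  qed
  have E0: "E x0 = 0" using x0 by (simp add: E_def)
  have "E x \<le> 0"
  proof (cases "x0 \<le> x")
    case True
    have "exp (- L * x) * E x \<le> exp (- L * x0) * E x0"
    proof (rule DERIV_nonpos_imp_nonincreasing[OF True])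
      fix t assume "x0 \<le> t" "t \<le> x"
      then have t: "t \<in> {p..q}" using x x0 by auto
      have "((\<lambda>x. exp (- L * x) * E x) has_real_derivative exp (- L * t) * (D t - L * E t)) (at t)"
        by (rule DERIV_cong, rule DERIV_mult[OF _ Ed[OF t]], rule derivative_eq_intros)
          (auto intro!: derivative_eq_intros simp: algebra_simps)
      moreover have "exp (- L * t) * (D t - L * E t) \<le> 0"
        using DE[OF t] by (intro mult_nonneg_nonpos) auto
      ultimately show "\<exists>d. ((\<lambda>x. exp (- L * x) * E x) has_real_derivative d) (at t) \<and> d \<le> 0" by blast
    qed
    then show ?thesis using E0 by (simp add: mult_le_0_iff)
  next
    case False
    have "exp (L * x) * E x \<le> exp (L * x0) * E x0"
    proof (rule DERIV_nonneg_imp_nondecreasing[of x x0 "\<lambda>x. exp (L * x) * E x"])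
      show "x \<le> x0" using False by simp
      fix t assume "x \<le> t" "t \<le> x0"
      then have t: "t \<in> {p..q}" using x x0 by auto
      have "((\<lambda>x. exp (L * x) * E x) has_real_derivative exp (L * t) * (D t + L * E t)) (at t)"
        by (rule DERIV_cong, rule DERIV_mult[OF _ Ed[OF t]], rule derivative_eq_intros)
          (auto intro!: derivative_eq_intros simp: algebra_simps)
      moreover have "0 \<le> exp (L * t) * (D t + L * E t)"
        using DE[OF t] by (intro mult_nonneg_nonneg) auto
      ultimately show "\<exists>d. ((\<lambda>x. exp (L * x) * E x) has_real_derivative d) (at t) \<and> 0 \<le> d" by blast
    qed
    then show ?thesis using E0 by (simp add: mult_le_0_iff)
  qed
  then show ?thesis using sum_power2_le_zero_iff[of "y x" "y' x"] by (simp add: E_def)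
qed

text \<open>
  The comparison behind the uniqueness of eigenvalues. Write \<open>r = p' / p\<close>, which solves the Riccati
  equation \<open>r' = V - r\<^sup>2\<close> away from the zero of \<open>p\<close>, and let \<open>g = c1 * g1 + c2 * g2\<close> vanish at that
  zero if it lies in the interval. Then
  \<open>(g * g' - r * g\<^sup>2)' = (g' - r * g)\<^sup>2 - (c1 * \<mu>1 * g1 + c2 * \<mu>2 * g2) * g\<close>,
  and the mixed term \<open>c1 * c2 * (\<mu>1 + \<mu>2) * g1 * g2\<close> on the right is a multiple of the derivative of the
  Wronskian of \<open>g1\<close> and \<open>g2\<close>. After the corresponding correction the derivative is a sum of nonnegative
  terms, while the function itself is nonnegative at \<open>a\<close> and tends to zero; so all these terms vanish.
\<close>
lemma Sturm_Picone:
  fixes V p p' g1 g1' g2 g2' :: "real \<Rightarrow> real"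
  assumes p: "\<And>y. (p has_real_derivative p' y) (at y)" "\<And>y. (p' has_real_derivative V y * p y) (at y)"
    and p_zero: "\<And>y. p y = 0 \<longleftrightarrow> y = 0" and p'0: "p' 0 \<noteq> 0"
    and p_lim: "((\<lambda>y. p' y / p y) \<longlongrightarrow> l) at_top"
    and g1: "\<And>y. (g1 has_real_derivative g1' y) (at y)" "\<And>y. (g1' has_real_derivative (V y - \<mu>1) * g1 y) (at y)"
    and g2: "\<And>y. (g2 has_real_derivative g2' y) (at y)" "\<And>y. (g2' has_real_derivative (V y - \<mu>2) * g2 y) (at y)"
    and lim: "(g1 \<longlongrightarrow> 0) at_top" "(g1' \<longlongrightarrow> 0) at_top" "(g2 \<longlongrightarrow> 0) at_top" "(g2' \<longlongrightarrow> 0) at_top"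
    and \<mu>: "\<mu>1 < 0" "\<mu>2 < 0" "\<mu>1 \<noteq> \<mu>2"
    and a: "a \<noteq> 0" "a < 0 \<Longrightarrow> c1 * g1 0 + c2 * g2 0 = 0"
    and wa: "c1 * c2 * (g1 a * g2' a - g1' a * g2 a) = 0"
    and bd: "(c1 * g1 a + c2 * g2 a) * (c1 * g1' a + c2 * g2' a) - p' a / p a * (c1 * g1 a + c2 * g2 a)\<^sup>2 \<ge> 0"
    and y: "y > a" "y \<noteq> 0"
  shows "c1 * g1 y = 0 \<and> c2 * g2 y = 0"
proof -
  define g where "g y = c1 * g1 y + c2 * g2 y" for y
  define g' where "g' y = c1 * g1' y + c2 * g2' y" for y
  define r where "r y = p' y / p y" for y
  define c where "c = c1 * c2 * (\<mu>1 + \<mu>2) / (\<mu>1 - \<mu>2)"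
  define w where "w y = g1 y * g2' y - g1' y * g2 y" for y
  define K where "K y = g y * g' y - r y * (g y)\<^sup>2 + c * w y" for y
  define D where "D y = (g' y - r y * g y)\<^sup>2 + c1\<^sup>2 * (- \<mu>1) * (g1 y)\<^sup>2 + c2\<^sup>2 * (- \<mu>2) * (g2 y)\<^sup>2" for y
  have gd: "(g has_real_derivative g' y) (at y)" for y
    unfolding g_def g'_def by (intro DERIV_add DERIV_cmult g1 g2)
  have g'd: "(g' has_real_derivative V y * g y - (c1 * \<mu>1 * g1 y + c2 * \<mu>2 * g2 y)) (at y)" for y
    unfolding g_def g'_def[abs_def]
    by (rule DERIV_cong[OF DERIV_add[OF DERIV_cmult[OF g1(2)] DERIV_cmult[OF g2(2)]]]) (simp add: algebra_simps)
  have wd: "(w has_real_derivative (\<mu>1 - \<mu>2) * (g1 y * g2 y)) (at y)" for y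
    unfolding w_def[abs_def]
    by (rule DERIV_cong[OF DERIV_diff[OF DERIV_mult[OF g1(1) g2(2)] DERIV_mult[OF g1(2) g2(1)]]]) (simp add: algebra_simps)
  have rd: "(r has_real_derivative V y - (r y)\<^sup>2) (at y)" if "y \<noteq> 0" for y
    unfolding r_def[abs_def]
    by (rule DERIV_cong[OF DERIV_divide[OF p(2,1)]]) (use that p_zero in \<open>auto simp: field_simps power2_eq_square\<close>)
  have Kd: "(K has_real_derivative D y) (at y)" if "y \<noteq> 0" for y
  proof -
    have "(K has_real_derivative (g' y * g' y + (V y * g y - (c1 * \<mu>1 * g1 y + c2 * \<mu>2 * g2 y)) * g y)
       - ((V y - (r y)\<^sup>2) * (g y)\<^sup>2 + (real 2 * (g' y * g y ^ (2 - Suc 0))) * r y) + c * ((\<mu>1 - \<mu>2) * (g1 y * g2 y))) (at y)"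
      unfolding K_def[abs_def]
      by (intro DERIV_add DERIV_diff DERIV_mult DERIV_cmult DERIV_power gd g'd wd rd[OF that])
    moreover have "(g' y * g' y + (V y * g y - (c1 * \<mu>1 * g1 y + c2 * \<mu>2 * g2 y)) * g y)
       - ((V y - (r y)\<^sup>2) * (g y)\<^sup>2 + (real 2 * (g' y * g y ^ (2 - Suc 0))) * r y) + c * ((\<mu>1 - \<mu>2) * (g1 y * g2 y)) = D y"
    proof -
      have e1: "c * ((\<mu>1 - \<mu>2) * (g1 y * g2 y)) = c1 * c2 * (\<mu>1 + \<mu>2) * (g1 y * g2 y)"
      using \<mu> by (simp add: c_def)
      have e2: "(g' y * g' y + (V y * g y - (c1 * \<mu>1 * g1 y + c2 * \<mu>2 * g2 y)) * g y)
       - ((V y - (r y)\<^sup>2) * (g y)\<^sup>2 + (real 2 * (g' y * g y ^ (2 - Suc 0))) * r y) = (g' y - r y * g y)\<^sup>2 - (c1 * \<mu>1 * g1 y + c2 * \<mu>2 * g2 y) * g y"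
      by (simp add: power2_eq_square algebra_simps)
      have e3: "(c1 * \<mu>1 * g1 y + c2 * \<mu>2 * g2 y) * g y = c1\<^sup>2 * \<mu>1 * (g1 y)\<^sup>2 + c2\<^sup>2 * \<mu>2 * (g2 y)\<^sup>2 + c1 * c2 * (\<mu>1 + \<mu>2) * (g1 y * g2 y)"
      by (simp add: g_def power2_eq_square algebra_simps)
      show ?thesis unfolding e1 e2 e3 D_def by simp
    qed
    ultimately show ?thesis by simp
  qed
  have D0: "D y \<ge> 0" for y
    unfolding D_def using \<mu> by (intro add_nonneg_nonneg mult_nonneg_nonneg) auto
  \<comment> \<open>Here \<open>r 0 = 0\<close>, a division by zero. The term \<open>r * g\<^sup>2\<close> is continuous with this value, because \<open>g\<close>
    vanishes at \<open>0\<close> and the zero of \<open>p\<close> there is simple.\<close>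
  have Kc0: "isCont K 0" if "a < 0"
  proof -
    have g0: "g 0 = 0" using a(2)[OF that] by (simp add: g_def)
    have l: "((\<lambda>h. g h / h) \<longlongrightarrow> g' 0) (at 0)" "((\<lambda>h. p h / h) \<longlongrightarrow> p' 0) (at 0)"
      using gd[of 0] p(1)[of 0] g0 p_zero[of 0] by (simp_all add: DERIV_def)
    have cg: "(g \<longlongrightarrow> g 0) (at 0)" and cg': "(g' \<longlongrightarrow> g' 0) (at 0)" and cp': "(p' \<longlongrightarrow> p' 0) (at 0)" and cw: "(w \<longlongrightarrow> w 0) (at 0)"
      using DERIV_isCont[OF gd, of 0] DERIV_isCont[OF g'd, of 0] DERIV_isCont[OF p(2), of 0] DERIV_isCont[OF wd, of 0]
      by (simp_all add: isCont_def)
    have "((\<lambda>h. p' h * g h * ((g h / h) / (p h / h))) \<longlongrightarrow> p' 0 * g 0 * (g' 0 / p' 0)) (at 0)"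
      by (intro tendsto_intros l cg cp' p'0)
    then have "((\<lambda>h. p' h * g h * ((g h / h) / (p h / h))) \<longlongrightarrow> 0) (at 0)" using g0 by simp
    then have "((\<lambda>h. r h * (g h)\<^sup>2) \<longlongrightarrow> 0) (at 0)"
      by (rule Lim_transform_eventually)
        (use p_zero in \<open>auto simp: eventually_at_filter r_def power2_eq_square intro!: always_eventually\<close>)
    then have "(K \<longlongrightarrow> g 0 * g' 0 - 0 + c * w 0) (at 0)"
      unfolding K_def[abs_def] by (intro tendsto_intros cg cg' cw)
    then show ?thesis using g0 by (simp add: isCont_def K_def)
  qed
  have Kc: "isCont K y" if "y \<ge> a" for y
    using Kc0 DERIV_isCont[OF Kd] that a by (cases "y = 0") force+
  have inc0: "K u \<le> K v" if "a \<le> u" "u \<le> v" "0 \<notin> {u<..<v}" for u v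
  proof (cases "u = v")
    case False
    show ?thesis
    proof (rule DERIV_nonneg_imp_increasing_open[of u v K])
      show "u \<le> v" using that by simp
      show "\<exists>z. (K has_real_derivative z) (at x) \<and> 0 \<le> z" if "u < x" "x < v" for x
        using Kd[of x] D0 that \<open>0 \<notin> {u<..<v}\<close> by auto
      show "continuous_on {u..v} K" using Kc that by (intro continuous_at_imp_continuous_on) auto
    qed
  qed simp
  have inc: "K u \<le> K v" if "a \<le> u" "u \<le> v" for u v
  proof (cases "0 \<in> {u<..<v}")
    case True
    then have "K u \<le> K 0" "K 0 \<le> K v" using that by (auto intro!: inc0)
    then show ?thesis by simp
  qed (use inc0 that in auto)
  have Klim: "(K \<longlongrightarrow> 0) at_top"
  proof -
    have gl: "(g \<longlongrightarrow> c1 * 0 + c2 * 0) at_top" "(g' \<longlongrightarrow> c1 * 0 + c2 * 0) at_top"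
      unfolding g_def[abs_def] g'_def[abs_def] by (intro tendsto_intros lim)+
    have wl: "(w \<longlongrightarrow> 0 * 0 - 0 * 0) at_top"
      unfolding w_def[abs_def] by (intro tendsto_intros lim)
    have "(K \<longlongrightarrow> (c1 * 0 + c2 * 0) * (c1 * 0 + c2 * 0) - l * (c1 * 0 + c2 * 0)\<^sup>2 + c * (0 * 0 - 0 * 0)) at_top"
      unfolding K_def[abs_def] by (intro tendsto_intros gl wl p_lim[folded r_def])
    then show ?thesis by simp
  qed
  have "c * w a = (\<mu>1 + \<mu>2) / (\<mu>1 - \<mu>2) * (c1 * c2 * (g1 a * g2' a - g1' a * g2 a))"
    by (simp add: c_def w_def)
  then have cw: "c * w a = 0" unfolding wa by simp
  have Ka: "K a \<ge> 0" unfolding K_def cw g_def g'_def r_def using bd by simp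
  have K0: "K u = 0" if "u \<ge> a" for u
  proof -
    have "K u \<le> 0"
      by (rule tendsto_lowerbound[OF Klim]) (use inc that in \<open>auto intro!: eventually_mono[OF eventually_ge_at_top[of u]]\<close>)
    then show ?thesis using inc[of a u] Ka that by simp
  qed
  have "(K has_real_derivative 0) (at y)"
    by (rule has_field_derivative_transform_within_open[OF DERIV_const, of "{a<..}"]) (use y K0 in auto)
  then have Dy: "D y = 0" using Kd[OF y(2)] DERIV_unique by blast
  have "c1\<^sup>2 * (- \<mu>1) * (g1 y)\<^sup>2 \<ge> 0" "c2\<^sup>2 * (- \<mu>2) * (g2 y)\<^sup>2 \<ge> 0" "(g' y - r y * g y)\<^sup>2 \<ge> 0"
    using \<mu>(1,2) by (intro mult_nonneg_nonneg zero_le_power2; simp)+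
  then have "c1\<^sup>2 * (- \<mu>1) * (g1 y)\<^sup>2 = 0" "c2\<^sup>2 * (- \<mu>2) * (g2 y)\<^sup>2 = 0"
    using Dy unfolding D_def by linarith+
  then show ?thesis using \<mu> by auto
qed


context exponentially_decaying_potential
begin

lemma exp_rate_tendsto: "(\<kappa>::real) > 0 \<Longrightarrow> ((\<lambda>x. exp (- \<kappa> * x)) \<longlongrightarrow> 0) at_top"
  by (intro filterlim_compose[OF exp_at_bot] filterlim_tendsto_neg_mult_at_bot[OF tendsto_const _ filterlim_ident]) auto

lemma jost_tendsto: assumes "\<kappa> > 0" shows "(jost \<kappa> \<longlongrightarrow> 0) at_top"
proof -
  have "((\<lambda>x. exp (- \<kappa> * x) * modulation \<kappa> x) \<longlongrightarrow> 0 * 1) at_top"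
    by (intro tendsto_mult exp_rate_tendsto modulation_tendsto assms)
  then show ?thesis by (simp add: jost_def[abs_def])
qed

lemma jost_deriv_tendsto: assumes "\<kappa> > 0" shows "(jost_deriv \<kappa> \<longlongrightarrow> 0) at_top"
proof -
  have "((\<lambda>x. exp (- \<kappa> * x) * (modulation_slope \<kappa> x - \<kappa> * modulation \<kappa> x)) \<longlongrightarrow> 0 * (0 - \<kappa> * 1)) at_top"
    by (intro tendsto_intros exp_rate_tendsto modulation_tendsto modulation_slope_tendsto assms)
  then show ?thesis by (simp add: jost_deriv_def[abs_def])
qed

lemma jost_log_deriv_tendsto: "((\<lambda>x. jost_deriv \<kappa> x / jost \<kappa> x) \<longlongrightarrow> - \<kappa>) at_top"
proof -
  have "((\<lambda>x. (modulation_slope \<kappa> x - \<kappa> * modulation \<kappa> x) / modulation \<kappa> x) \<longlongrightarrow> (0 - \<kappa> * 1) / 1) at_top"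
    by (intro tendsto_intros modulation_tendsto modulation_slope_tendsto) simp
  then show ?thesis by (simp add: jost_def jost_deriv_def)
qed

text \<open>
  Otherwise it would vanish identically by uniqueness, but it is positive far to the right.
\<close>
lemma jost_nontrivial:
  assumes "\<kappa> \<ge> \<kappa>0" shows "jost \<kappa> x \<noteq> 0 \<or> jost_deriv \<kappa> x \<noteq> 0"
proof (rule ccontr)
  assume z: "\<not> ?thesis"
  obtain y where y: "y > x" "jost \<kappa> y > 0"
    using eventually_conj[OF jost_eventually_pos eventually_gt_at_top, of \<kappa> x] by (auto dest: eventually_happens)
  have "jost \<kappa> y = 0 \<and> jost_deriv \<kappa> y = 0"
    by (rule linear_ode_unique[where p = x and q = y and Q = "\<lambda>x. \<kappa>\<^sup>2 - W x" and ?x0.0 = x])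
      (use z y assms in \<open>auto intro!: jost_has_derivative jost_deriv_has_derivative continuous_intros continuous_on_subset[OF W_cont]\<close>)
  then show False using y by simp
qed

end

section \<open>The soliton well and its zero mode\<close>

lemma powr_eq_mult_powr: "0 < x \<Longrightarrow> x * x powr a = x powr (a + 1)" for x a :: real
  by (simp add: powr_add)

lemma tendsto_mult_zero_bounded:
  fixes f g :: "real \<Rightarrow> real"
  assumes f: "(f \<longlongrightarrow> 0) F" and g: "\<And>x. \<bar>g x\<bar> \<le> M"
  shows "((\<lambda>x. f x * g x) \<longlongrightarrow> 0) F"
proof (rule Lim_null_comparison[OF always_eventually])
  show "\<forall>x. norm (f x * g x) \<le> \<bar>f x\<bar> * M" using g by (auto simp: abs_mult intro!: mult_left_mono)
  show "((\<lambda>x. \<bar>f x\<bar> * M) \<longlongrightarrow> 0) F" using tendsto_mult_right[OF tendsto_rabs[OF f], of M] by simp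
qed

locale soliton =
  fixes s A B :: real
  assumes s_pos: "s > 0" and A_pos: "A > 0" and B_pos: "B > 0"
begin

text \<open>
  If \<open>\<phi>\<close> denotes the soliton on the whole line, this is \<open>1 / \<phi>\<^sup>2\<close>; the well is the potential of the
  linearisation at \<open>\<phi>\<close>, expressed through \<open>s\<close>, \<open>A\<close> and \<open>B\<close>.
\<close>
definition inv_square_amplitude :: "real \<Rightarrow> real" where "inv_square_amplitude y = A + B * cosh (2 * s * y)"

definition well :: "real \<Rightarrow> real" where
  "well y = 12 * s\<^sup>2 * A / inv_square_amplitude y + 15 * s\<^sup>2 * (B\<^sup>2 - A\<^sup>2) / (inv_square_amplitude y)\<^sup>2"

text \<open>
  By translation invariance, \<open>\<phi>'\<close> solves the linearised equation at energy zero. The zero mode is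
  \<open>\<phi>'\<close> divided by the constant \<open>- (s * B)\<close>, which makes it positive to the right.
\<close>
definition zero_mode :: "real \<Rightarrow> real" where
  "zero_mode y = sinh (2 * s * y) * inv_square_amplitude y powr (- 3 / 2)"

definition zero_mode_deriv :: "real \<Rightarrow> real" where
  "zero_mode_deriv y = s * (2 * A * cosh (2 * s * y) - B * (cosh (2 * s * y))\<^sup>2 + 3 * B) * inv_square_amplitude y powr (- 5 / 2)"

abbreviation "q \<equiv> inv_square_amplitude"

lemma q_ge: "q y \<ge> A + B"
  using cosh_real_ge_1[of "2 * s * y"] B_pos by (simp add: inv_square_amplitude_def)

lemma q_pos: "q y > 0" and q_ge_A: "q y \<ge> A"
  using q_ge[of y] A_pos B_pos by linarith+

lemma q_cosh: "cosh (2 * s * y) \<le> q y / B"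
  using A_pos B_pos by (simp add: inv_square_amplitude_def field_simps)

lemma q_deriv: "(q has_real_derivative 2 * s * B * sinh (2 * s * y)) (at y)"
  unfolding inv_square_amplitude_def[abs_def] by (auto intro!: derivative_eq_intros)

lemma q_cont: "continuous_on S q"
  unfolding inv_square_amplitude_def by (intro continuous_intros)

lemma q_powr_deriv: "((\<lambda>y. q y powr m) has_real_derivative m * q y powr (m - 1) * (2 * s * B * sinh (2 * s * y))) (at y)"
  using DERIV_fun_powr[OF q_deriv q_pos, of m y] by (simp add: ac_simps)

lemma zero_mode_has_derivative: "(zero_mode has_real_derivative zero_mode_deriv y) (at y)"
proof -
  let ?c = "cosh (2 * s * y)" and ?S = "sinh (2 * s * y)"
  have "((\<lambda>y. sinh (2 * s * y)) has_real_derivative 2 * s * ?c) (at y)"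
    by (auto intro!: derivative_eq_intros)
  from DERIV_mult[OF this q_powr_deriv[of "- 3 / 2"]]
  have d: "(zero_mode has_real_derivative 2 * s * ?c * q y powr (- 3 / 2) + - 3 / 2 * q y powr (- 3 / 2 - 1) * (2 * s * B * ?S) * ?S) (at y)"
    by (simp add: zero_mode_def[abs_def])
  define x where "x = q y powr (- 5 / 2)"
  have p: "q y powr (- 3 / 2) = q y * x" "q y powr (- 3 / 2 - 1) = x"
    using powr_eq_mult_powr[OF q_pos] by (simp_all add: x_def)
  have "2 * s * ?c * (q y * x) + - 3 / 2 * x * (2 * s * B * ?S) * ?S = s * (2 * ?c * q y - 3 * B * ?S\<^sup>2) * x"
    by (simp add: algebra_simps power2_eq_square)
  also have "2 * ?c * q y - 3 * B * ?S\<^sup>2 = 2 * A * ?c - B * ?c\<^sup>2 + 3 * B"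
    unfolding sinh_square_eq inv_square_amplitude_def by (simp add: algebra_simps power2_eq_square)
  finally show ?thesis using d unfolding p zero_mode_deriv_def x_def[symmetric] by simp
qed

lemma zero_mode_deriv_has_derivative: "(zero_mode_deriv has_real_derivative (s\<^sup>2 - well y) * zero_mode y) (at y)"
proof -
  let ?c = "cosh (2 * s * y)" and ?S = "sinh (2 * s * y)"
  define x where "x = q y powr (- 7 / 2)"
  have "((\<lambda>y. s * (2 * A * cosh (2 * s * y) - B * (cosh (2 * s * y))\<^sup>2 + 3 * B)) has_real_derivative s * (4 * s * A * ?S - 4 * s * B * ?c * ?S)) (at y)"
    by (auto intro!: derivative_eq_intros simp: algebra_simps)
  from DERIV_mult[OF this q_powr_deriv[of "- 5 / 2"]]
  have d: "(zero_mode_deriv has_real_derivative s * (4 * s * A * ?S - 4 * s * B * ?c * ?S) * q y powr (- 5 / 2) + - 5 / 2 * q y powr (- 5 / 2 - 1) * (2 * s * B * ?S) * (s * (2 * A * ?c - B * ?c\<^sup>2 + 3 * B))) (at y)"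
    by (simp add: zero_mode_deriv_def[abs_def])
  have p: "q y powr (- 5 / 2) = q y * x" "q y powr (- 3 / 2) = q y * (q y * x)" "q y powr (- 5 / 2 - 1) = x"
    using powr_eq_mult_powr[OF q_pos] by (simp_all add: x_def)
  have "(s\<^sup>2 - well y) * zero_mode y = (s\<^sup>2 * (q y)\<^sup>2 - 12 * s\<^sup>2 * A * q y - 15 * s\<^sup>2 * (B\<^sup>2 - A\<^sup>2)) * ?S * x"
    unfolding zero_mode_def well_def p using q_pos[of y] by (simp add: field_simps power2_eq_square)
  also have "\<dots> = s * (4 * s * A * ?S - 4 * s * B * ?c * ?S) * (q y * x) + - 5 / 2 * x * (2 * s * B * ?S) * (s * (2 * A * ?c - B * ?c\<^sup>2 + 3 * B))"
    unfolding inv_square_amplitude_def by (simp add: field_simps power2_eq_square)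
  finally show ?thesis using d unfolding p by simp
qed

lemma zero_mode_eq_0_iff: "zero_mode y = 0 \<longleftrightarrow> y = 0"
  and zero_mode_pos: "y > 0 \<Longrightarrow> zero_mode y > 0"
  and zero_mode_neg: "y < 0 \<Longrightarrow> zero_mode y < 0"
  using s_pos q_pos[of y] by (auto simp: zero_mode_def mult_pos_pos mult_neg_pos mult_pos_neg)

lemma zero_mode_deriv_0: "zero_mode_deriv 0 > 0"
  using s_pos A_pos B_pos q_pos[of 0] by (simp add: zero_mode_deriv_def mult_pos_pos)

text \<open>
  The added coefficient is \<open>- \<phi>' / \<phi>\<close> at \<open>a\<close>. The left side is thus a negative multiple of
  \<open>\<phi> * (\<phi>' / \<phi>)'\<close>, and its positivity says that the soliton is logarithmically concave.
\<close>
lemma Robin_identity: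
  "zero_mode_deriv a + s * B * sinh (2 * s * a) / q a * zero_mode a = 2 * s * (A * cosh (2 * s * a) + B) * q a powr (- 5 / 2)"
proof -
  have "q a powr (- 3 / 2) = q a * q a powr (- 5 / 2)" using powr_eq_mult_powr[OF q_pos] by simp
  then have "zero_mode_deriv a + s * B * sinh (2 * s * a) / q a * zero_mode a
    = s * (2 * A * cosh (2 * s * a) - B * (cosh (2 * s * a))\<^sup>2 + 3 * B + B * (sinh (2 * s * a))\<^sup>2) * q a powr (- 5 / 2)"
    using q_pos[of a] by (simp add: zero_mode_def zero_mode_deriv_def field_simps power2_eq_square)
  also have "\<dots> = 2 * s * (A * cosh (2 * s * a) + B) * q a powr (- 5 / 2)"
    by (simp add: sinh_square_eq algebra_simps)
  finally show ?thesis .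
qed

lemma Robin_positive: "zero_mode_deriv a + s * B * sinh (2 * s * a) / q a * zero_mode a > 0"
  unfolding Robin_identity using s_pos A_pos B_pos q_pos[of a] cosh_real_pos[of "2 * s * a"]
  by (intro mult_pos_pos add_pos_pos) auto

text \<open>
  Boundedness suffices for the Wronskian with a decaying solution to vanish at infinity.
\<close>
lemma zero_mode_bounded: "\<bar>zero_mode y\<bar> \<le> A powr (- 1 / 2) / B"
proof -
  have "\<bar>sinh (2 * s * y)\<bar> \<le> cosh (2 * s * y)"
    by (rule abs_leI) (auto simp: sinh_le_cosh_real sinh_le_cosh_real[of "- (2 * s * y)", simplified])
  then have "\<bar>sinh (2 * s * y)\<bar> \<le> q y / B" using q_cosh[of y] by linarith
  then have "\<bar>zero_mode y\<bar> \<le> q y / B * q y powr (- 3 / 2)"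
    unfolding zero_mode_def abs_mult by (intro mult_mono) auto
  also have "\<dots> = q y powr (- 1 / 2) / B" using powr_eq_mult_powr[OF q_pos, of y "- 3 / 2"] by simp
  also have "\<dots> \<le> A powr (- 1 / 2) / B"
    using B_pos A_pos q_ge_A[of y] by (intro divide_right_mono powr_mono2') auto
  finally show ?thesis .
qed

lemma zero_mode_deriv_bounded: "\<exists>M. \<forall>y. \<bar>zero_mode_deriv y\<bar> \<le> M"
proof (intro exI allI)
  fix y
  define K where "K = 2 / B + 1 / B + 3 * B / A\<^sup>2"
  have K0: "K \<ge> 0" using A_pos B_pos by (simp add: K_def)
  let ?c = "cosh (2 * s * y)"
  have c: "0 \<le> ?c" "?c \<le> q y / B" using q_cosh by auto
  have A2: "A\<^sup>2 \<le> (q y)\<^sup>2" using q_ge_A[of y] A_pos by (intro power_mono) auto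
  have "2 * A * ?c \<le> 2 * q y * (q y / B)" using q_ge_A[of y] A_pos c by (intro mult_mono) auto
  moreover have "B * ?c\<^sup>2 \<le> B * (q y / B)\<^sup>2" using B_pos c by (intro mult_left_mono power_mono) auto
  moreover have "3 * B * 1 \<le> 3 * B * ((q y)\<^sup>2 / A\<^sup>2)" using B_pos A2 A_pos by (intro mult_left_mono) auto
  moreover have "0 \<le> 2 * A * ?c" "0 \<le> B * ?c\<^sup>2" "0 \<le> 3 * B" using A_pos B_pos by auto
  ultimately have "\<bar>2 * A * ?c - B * ?c\<^sup>2 + 3 * B\<bar> \<le> 2 * q y * (q y / B) + B * (q y / B)\<^sup>2 + 3 * B * ((q y)\<^sup>2 / A\<^sup>2)"
    by linarith
  also have "\<dots> = K * (q y)\<^sup>2" using B_pos A_pos by (simp add: K_def field_simps power2_eq_square)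
  finally have "\<bar>zero_mode_deriv y\<bar> \<le> s * (K * (q y)\<^sup>2) * q y powr (- 5 / 2)"
    unfolding zero_mode_deriv_def abs_mult using s_pos by (intro mult_mono) auto
  also have "\<dots> = s * K * (q y * (q y * q y powr (- 5 / 2)))" by (simp add: power2_eq_square)
  also have "q y * (q y * q y powr (- 5 / 2)) = q y powr (- 1 / 2)" by (simp add: powr_eq_mult_powr q_pos)
  also have "s * K * q y powr (- 1 / 2) \<le> s * K * A powr (- 1 / 2)"
    using K0 s_pos A_pos q_ge_A[of y] by (intro mult_left_mono powr_mono2') auto
  finally show "\<bar>zero_mode_deriv y\<bar> \<le> s * (2 / B + 1 / B + 3 * B / A\<^sup>2) * A powr (- 1 / 2)" unfolding K_def .
qed

definition well_decay :: real where "well_decay = 2 * s"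

definition well_const :: real where
  "well_const = (12 * s\<^sup>2 * A + 15 * s\<^sup>2 * \<bar>B\<^sup>2 - A\<^sup>2\<bar> / A) * (2 / B)"

lemma well_bound: "\<bar>well y\<bar> \<le> well_const * exp (- well_decay * y)"
proof -
  have q: "q y \<ge> B / 2 * exp (2 * s * y)"
    using A_pos B_pos by (simp add: inv_square_amplitude_def cosh_def algebra_simps add_nonneg_nonneg)
  have i: "1 / q y \<le> 2 / B * exp (- (2 * s) * y)"
    using q q_pos[of y] B_pos by (simp add: exp_minus divide_simps)
  have "\<bar>15 * s\<^sup>2 * (B\<^sup>2 - A\<^sup>2) / (q y)\<^sup>2\<bar> = 15 * s\<^sup>2 * \<bar>B\<^sup>2 - A\<^sup>2\<bar> / q y * (1 / q y)"
    using q_pos[of y] by (simp add: abs_mult power2_eq_square)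
  also have "\<dots> \<le> 15 * s\<^sup>2 * \<bar>B\<^sup>2 - A\<^sup>2\<bar> / A * (1 / q y)"
    using q_pos[of y] q_ge_A[of y] A_pos by (intro mult_right_mono divide_left_mono) auto
  finally have "\<bar>well y\<bar> \<le> 12 * s\<^sup>2 * A * (1 / q y) + 15 * s\<^sup>2 * \<bar>B\<^sup>2 - A\<^sup>2\<bar> / A * (1 / q y)"
    unfolding well_def using A_pos q_pos[of y] by (intro order_trans[OF abs_triangle_ineq add_mono]) (auto simp: abs_mult)
  also have "\<dots> = (12 * s\<^sup>2 * A + 15 * s\<^sup>2 * \<bar>B\<^sup>2 - A\<^sup>2\<bar> / A) * (1 / q y)" by (simp only: distrib_right)
  also have "\<dots> \<le> (12 * s\<^sup>2 * A + 15 * s\<^sup>2 * \<bar>B\<^sup>2 - A\<^sup>2\<bar> / A) * (2 / B * exp (- (2 * s) * y))"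
    using i A_pos by (intro mult_left_mono) auto
  finally show ?thesis by (simp only: well_const_def well_decay_def mult.assoc)
qed

sublocale exponentially_decaying_potential well well_const well_decay s
proof
  show "continuous_on UNIV well"
    unfolding well_def by (intro continuous_intros q_cont) (use q_pos in \<open>auto simp: less_le\<close>)
  show "well_const > 0" using s_pos A_pos B_pos by (simp add: well_const_def add_pos_nonneg divide_nonneg_pos)
  show "well_decay > 0" using s_pos by (simp add: well_decay_def)
qed (use s_pos well_bound in auto)

text \<open>
  The Wronskian of the two solutions is constant and tends to zero. So they are proportional, and the
  factor is positive because both are positive far to the right.
\<close>
lemma jost_zero_energy:
  obtains c where "c > 0" "\<And>y. jost s y = c * zero_mode y" "\<And>y. jost_deriv s y = c * zero_mode_deriv y"
proof -
  define w where "w y = jost s y * zero_mode_deriv y - jost_deriv s y * zero_mode y" for y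
  have "(w has_real_derivative 0) (at y)" for y
    unfolding w_def[abs_def]
    by (rule DERIV_cong[OF DERIV_diff[OF DERIV_mult[OF jost_has_derivative zero_mode_deriv_has_derivative] DERIV_mult[OF jost_deriv_has_derivative[OF order_refl] zero_mode_has_derivative]]])
      (simp add: algebra_simps)
  then have const: "w y = w 0" for y using DERIV_isconst_all by blast
  obtain M where M: "\<And>y. \<bar>zero_mode_deriv y\<bar> \<le> M" using zero_mode_deriv_bounded by blast
  have "((\<lambda>y. jost s y * zero_mode_deriv y) \<longlongrightarrow> 0) at_top"
    by (rule tendsto_mult_zero_bounded) (use jost_tendsto[OF s_pos] M in auto)
  moreover have "((\<lambda>y. jost_deriv s y * zero_mode y) \<longlongrightarrow> 0) at_top"
    by (rule tendsto_mult_zero_bounded) (use jost_deriv_tendsto[OF s_pos] zero_mode_bounded in auto)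
  ultimately have "(w \<longlongrightarrow> 0 - 0) at_top" unfolding w_def[abs_def] by (rule tendsto_diff)
  moreover have "(w \<longlongrightarrow> w 0) at_top" using const by (intro tendsto_eventually always_eventually) auto
  ultimately have w0: "w y = 0" for y using const[of y] tendsto_unique[OF trivial_limit_at_top_linorder] by fastforce
  obtain Y where Y: "Y > 0" "jost s Y > 0"
    using eventually_conj[OF jost_eventually_pos eventually_gt_at_top, of s 0] by (auto dest: eventually_happens)
  define c where "c = jost s Y / zero_mode Y"
  have zY: "zero_mode Y > 0" by (rule zero_mode_pos[OF Y(1)])
  have "c > 0" using Y zY by (simp add: c_def)
  have "jost s y - c * zero_mode y = 0 \<and> jost_deriv s y - c * zero_mode_deriv y = 0" for y
  proof (rule linear_ode_unique[where y = "\<lambda>y. jost s y - c * zero_mode y" and y' = "\<lambda>y. jost_deriv s y - c * zero_mode_deriv y" and p = "min y Y" and q = "max y Y" and Q = "\<lambda>y. s\<^sup>2 - well y" and ?x0.0 = Y])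
    show "((\<lambda>y. jost s y - c * zero_mode y) has_real_derivative jost_deriv s x - c * zero_mode_deriv x) (at x)" for x
      by (intro DERIV_diff DERIV_cmult jost_has_derivative zero_mode_has_derivative)
    show "((\<lambda>y. jost_deriv s y - c * zero_mode_deriv y) has_real_derivative (s\<^sup>2 - well x) * (jost s x - c * zero_mode x)) (at x)" for x
      by (rule DERIV_cong[OF DERIV_diff[OF jost_deriv_has_derivative[OF order_refl] DERIV_cmult[OF zero_mode_deriv_has_derivative]]]) (simp add: algebra_simps)
    show "continuous_on {min y Y..max y Y} (\<lambda>y. s\<^sup>2 - well y)" by (intro continuous_intros continuous_on_subset[OF W_cont]) auto
    show "jost s Y - c * zero_mode Y = 0" using zY by (simp add: c_def)
    show "jost_deriv s Y - c * zero_mode_deriv Y = 0" using w0[of Y] zY by (simp add: c_def w_def field_simps)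
  qed auto
  then show ?thesis using that[OF \<open>c > 0\<close>] by simp
qed

section \<open>Dirichlet and Robin rates on the half line\<close>

text \<open>
  The zero mode enters through the Jost function at the rate \<open>s\<close>, whose logarithmic derivative has a
  limit at infinity.
\<close>
lemma jost_comparison:
  assumes k: "\<kappa>1 > s" "\<kappa>2 > s" "\<kappa>1 \<noteq> \<kappa>2" and a: "a \<noteq> 0"
    and c: "a < 0 \<Longrightarrow> c1 * jost \<kappa>1 0 + c2 * jost \<kappa>2 0 = 0"
    and wa: "c1 * c2 * (jost \<kappa>1 a * jost_deriv \<kappa>2 a - jost_deriv \<kappa>1 a * jost \<kappa>2 a) = 0"
    and bd: "(c1 * jost \<kappa>1 a + c2 * jost \<kappa>2 a) * (c1 * jost_deriv \<kappa>1 a + c2 * jost_deriv \<kappa>2 a)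
       - zero_mode_deriv a / zero_mode a * (c1 * jost \<kappa>1 a + c2 * jost \<kappa>2 a)\<^sup>2 \<ge> 0"
  shows "c1 = 0 \<and> c2 = 0"
proof -
  obtain c where jz: "c > 0" "\<And>y. jost s y = c * zero_mode y" "\<And>y. jost_deriv s y = c * zero_mode_deriv y"
    using jost_zero_energy by blast
  have "\<forall>\<^sub>F y in at_top. jost \<kappa>1 y > 0 \<and> jost \<kappa>2 y > 0 \<and> y > max a 0"
    by (intro eventually_conj jost_eventually_pos eventually_gt_at_top)
  then obtain y where y: "jost \<kappa>1 y > 0" "jost \<kappa>2 y > 0" "y > max a 0" by (auto dest: eventually_happens)
  have kk: "s\<^sup>2 < \<kappa>1\<^sup>2" "s\<^sup>2 < \<kappa>2\<^sup>2" using k s_pos by (auto intro!: power_strict_mono)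
  have ode: "(jost_deriv \<kappa> has_real_derivative (s\<^sup>2 - well y - (s\<^sup>2 - \<kappa>\<^sup>2)) * jost \<kappa> y) (at y)" if "\<kappa> > s" for \<kappa> y
    using jost_deriv_has_derivative[of \<kappa> y] that by simp
  have "c1 * jost \<kappa>1 y = 0 \<and> c2 * jost \<kappa>2 y = 0"
  proof (rule Sturm_Picone[OF jost_has_derivative jost_deriv_has_derivative[OF order_refl] _ _ jost_log_deriv_tendsto
        jost_has_derivative ode[OF k(1)] jost_has_derivative ode[OF k(2)]])
    show "jost s y = 0 \<longleftrightarrow> y = 0" for y using jz zero_mode_eq_0_iff by simp
    show "jost_deriv s 0 \<noteq> 0" using jz zero_mode_deriv_0 by simp
    show "(jost \<kappa>1 \<longlongrightarrow> 0) at_top" "(jost \<kappa>2 \<longlongrightarrow> 0) at_top" "(jost_deriv \<kappa>1 \<longlongrightarrow> 0) at_top" "(jost_deriv \<kappa>2 \<longlongrightarrow> 0) at_top"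
      using k s_pos by (auto intro!: jost_tendsto jost_deriv_tendsto)
    show "s\<^sup>2 - \<kappa>1\<^sup>2 \<noteq> s\<^sup>2 - \<kappa>2\<^sup>2" using k s_pos by (auto simp: power2_eq_iff)
    show "(c1 * jost \<kappa>1 a + c2 * jost \<kappa>2 a) * (c1 * jost_deriv \<kappa>1 a + c2 * jost_deriv \<kappa>2 a)
       - jost_deriv s a / jost s a * (c1 * jost \<kappa>1 a + c2 * jost \<kappa>2 a)\<^sup>2 \<ge> 0"
      using bd jz by simp
  qed (use kk a c wa y in auto)
  then show ?thesis using y by simp
qed

text \<open>
  Half the strength of the point interaction whose standing wave is the soliton cut at \<open>a\<close> and reflected.
\<close>
definition Robin_const :: "real \<Rightarrow> real" where "Robin_const a = s * B * sinh (2 * s * a) / q a"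

lemma jost_common_zero:
  obtains c1 c2 :: real where "c1 * jost \<kappa>1 p + c2 * jost \<kappa>2 p = 0" "c1 \<noteq> 0 \<or> c2 \<noteq> 0"
proof (cases "jost \<kappa>1 p = 0 \<and> jost \<kappa>2 p = 0")
  case True then show ?thesis using that[of 1 0] by simp
next
  case False then show ?thesis using that[of "jost \<kappa>2 p" "- jost \<kappa>1 p"] by auto
qed

text \<open>
  Two rates always admit a nontrivial combination with a zero at a prescribed point. For negative \<open>a\<close>
  it is placed at the zero \<open>0\<close> of the zero mode, for positive \<open>a\<close> at the end point \<open>a\<close>, where it makes the
  boundary term vanish.
\<close>
lemma jost_comparison_common_zero:
  assumes k: "\<kappa>1 > s" "\<kappa>2 > s" "\<kappa>1 \<noteq> \<kappa>2" and a: "a \<noteq> 0"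
    and wa: "jost \<kappa>1 a * jost_deriv \<kappa>2 a = jost_deriv \<kappa>1 a * jost \<kappa>2 a"
    and bd: "\<And>c1 c2. a < 0 \<Longrightarrow> (c1 * jost \<kappa>1 a + c2 * jost \<kappa>2 a) * (c1 * jost_deriv \<kappa>1 a + c2 * jost_deriv \<kappa>2 a)
       - zero_mode_deriv a / zero_mode a * (c1 * jost \<kappa>1 a + c2 * jost \<kappa>2 a)\<^sup>2 \<ge> 0"
  shows False
proof -
  obtain c1 c2 where c: "c1 * jost \<kappa>1 (max a 0) + c2 * jost \<kappa>2 (max a 0) = 0" "c1 \<noteq> 0 \<or> c2 \<noteq> 0"
    using jost_common_zero by blast
  have "c1 = 0 \<and> c2 = 0"
  proof (rule jost_comparison[OF k a])
    show "c1 * c2 * (jost \<kappa>1 a * jost_deriv \<kappa>2 a - jost_deriv \<kappa>1 a * jost \<kappa>2 a) = 0" using wa by simp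
    show "c1 * jost \<kappa>1 0 + c2 * jost \<kappa>2 0 = 0" if "a < 0" using c that by simp
    show "(c1 * jost \<kappa>1 a + c2 * jost \<kappa>2 a) * (c1 * jost_deriv \<kappa>1 a + c2 * jost_deriv \<kappa>2 a)
       - zero_mode_deriv a / zero_mode a * (c1 * jost \<kappa>1 a + c2 * jost \<kappa>2 a)\<^sup>2 \<ge> 0"
      using bd c a by (cases "a < 0") (auto simp: max_def split: if_splits)
  qed
  then show False using c by simp
qed

text \<open>
  To the right of a positive \<open>a\<close> the zero mode has no zero, so the comparison applies to a single
  function; the rate \<open>\<kappa> + 1\<close> enters with coefficient zero.
\<close>
lemma Dirichlet_none:
  assumes "a > 0" "\<kappa> > s" shows "jost \<kappa> a \<noteq> 0"
proof
  assume z: "jost \<kappa> a = 0"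
  have "(1::real) = 0 \<and> (0::real) = 0"
  proof (rule jost_comparison[of \<kappa> "\<kappa> + 1" a])
  qed (use assms z in auto)
  then show False by simp
qed

text \<open>
  Existence is the intermediate value theorem in the rate: the value at \<open>a\<close> has the sign of the zero
  mode, hence is negative, at the rate \<open>s\<close>, and it is positive for large rates.
\<close>
lemma Dirichlet_unique:
  assumes "a < 0" shows "\<exists>!\<kappa>. \<kappa> > s \<and> jost \<kappa> a = 0"
proof (rule ex_ex1I)
  obtain c where jz: "c > 0" "\<And>y. jost s y = c * zero_mode y" using jost_zero_energy by metis
  have neg: "jost s a < 0" using jz zero_mode_neg[OF assms] by (simp add: mult_pos_neg)
  obtain K where K: "K > s" "jost K a > 0"
    using eventually_conj[OF jost_large_rate_pos eventually_gt_at_top, of a s] by (auto dest: eventually_happens)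
  obtain \<kappa> where "s \<le> \<kappa>" "\<kappa> \<le> K" "jost \<kappa> a = 0"
    using IVT'[of "\<lambda>\<kappa>. jost \<kappa> a" s 0 K] neg K jost_cont_rate by auto
  then show "\<exists>\<kappa>. s < \<kappa> \<and> jost \<kappa> a = 0" using neg by (intro exI[of _ \<kappa>]) (auto simp: less_le)
next
  fix \<kappa>1 \<kappa>2 assume "s < \<kappa>1 \<and> jost \<kappa>1 a = 0" "s < \<kappa>2 \<and> jost \<kappa>2 a = 0"
  then show "\<kappa>1 = \<kappa>2" using jost_comparison_common_zero[of \<kappa>1 \<kappa>2 a] assms by fastforce
qed

text \<open>
  Existence again follows from the signs at the rate \<open>s\<close>, given by logarithmic concavity, and at large
  rates. For uniqueness with negative \<open>a\<close> the boundary term has the right sign because the zero mode is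
  negative there; for positive \<open>a\<close> it is made to vanish.
\<close>
lemma Robin_unique:
  assumes a: "a \<noteq> 0" shows "\<exists>!\<kappa>. \<kappa> > s \<and> jost_deriv \<kappa> a + Robin_const a * jost \<kappa> a = 0"
proof (rule ex_ex1I)
  obtain c where jz: "c > 0" "\<And>y. jost s y = c * zero_mode y" "\<And>y. jost_deriv s y = c * zero_mode_deriv y"
    using jost_zero_energy by blast
  have "jost_deriv s a + Robin_const a * jost s a = c * (zero_mode_deriv a + Robin_const a * zero_mode a)"
    by (simp add: jz algebra_simps)
  then have pos: "jost_deriv s a + Robin_const a * jost s a > 0"
    using Robin_positive[of a] jz by (simp add: Robin_const_def)
  obtain K where K: "K > s" "jost_deriv K a + Robin_const a * jost K a < 0"
    using eventually_conj[OF jost_large_rate_Robin_neg eventually_gt_at_top, of a "Robin_const a" s] by (auto dest: eventually_happens)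
  have "continuous_on {s..K} (\<lambda>\<kappa>. jost_deriv \<kappa> a + Robin_const a * jost \<kappa> a)"
    by (intro continuous_intros jost_cont_rate jost_deriv_cont_rate)
  then obtain \<kappa> where "s \<le> \<kappa>" "\<kappa> \<le> K" "jost_deriv \<kappa> a + Robin_const a * jost \<kappa> a = 0"
    using IVT2'[of "\<lambda>\<kappa>. jost_deriv \<kappa> a + Robin_const a * jost \<kappa> a" K 0 s] pos K by auto
  then show "\<exists>\<kappa>. s < \<kappa> \<and> jost_deriv \<kappa> a + Robin_const a * jost \<kappa> a = 0"
    using pos by (intro exI[of _ \<kappa>]) (auto simp: less_le)
next
  fix \<kappa>1 \<kappa>2 assume k: "s < \<kappa>1 \<and> jost_deriv \<kappa>1 a + Robin_const a * jost \<kappa>1 a = 0" "s < \<kappa>2 \<and> jost_deriv \<kappa>2 a + Robin_const a * jost \<kappa>2 a = 0"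
  then have d: "jost_deriv \<kappa>1 a = - Robin_const a * jost \<kappa>1 a" "jost_deriv \<kappa>2 a = - Robin_const a * jost \<kappa>2 a" by auto
  show "\<kappa>1 = \<kappa>2"
  proof (rule ccontr)
    assume "\<kappa>1 \<noteq> \<kappa>2"
    then show False
    proof (rule jost_comparison_common_zero[rotated 2, OF _ a])
      show "jost \<kappa>1 a * jost_deriv \<kappa>2 a = jost_deriv \<kappa>1 a * jost \<kappa>2 a" unfolding d by simp
      fix c1 c2 assume "a < 0"
      let ?g = "c1 * jost \<kappa>1 a + c2 * jost \<kappa>2 a"
      have "zero_mode_deriv a / zero_mode a + Robin_const a = (zero_mode_deriv a + Robin_const a * zero_mode a) / zero_mode a"
        using zero_mode_neg[OF \<open>a < 0\<close>] by (simp add: field_simps)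
      also have "\<dots> \<le> 0" using Robin_positive[of a] zero_mode_neg[OF \<open>a < 0\<close>]
        by (simp add: Robin_const_def divide_le_0_iff)
      finally have "(zero_mode_deriv a / zero_mode a + Robin_const a) * ?g\<^sup>2 \<le> 0" by (simp add: mult_le_0_iff)
      moreover have "?g * (c1 * jost_deriv \<kappa>1 a + c2 * jost_deriv \<kappa>2 a) - zero_mode_deriv a / zero_mode a * ?g\<^sup>2
          = - ((zero_mode_deriv a / zero_mode a + Robin_const a) * ?g\<^sup>2)"
        unfolding d by (simp add: algebra_simps power2_eq_square)
      ultimately show "?g * (c1 * jost_deriv \<kappa>1 a + c2 * jost_deriv \<kappa>2 a) - zero_mode_deriv a / zero_mode a * ?g\<^sup>2 \<ge> 0" by linarith
    qed (use k in auto)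
  qed
qed

end

section \<open>Square-integrable solutions on the half line\<close>

lemma primitive_has_vector_derivative:
  fixes C h k :: "real \<Rightarrow> complex"
  assumes op: "open I" and iv: "is_interval I"
    and C: "\<And>x y. x \<in> I \<Longrightarrow> y \<in> I \<Longrightarrow> x \<le> y \<Longrightarrow> C y - C x = (LINT t:{x..y}|lborel. h t)"
    and h: "\<And>x y. {x..y} \<subseteq> I \<Longrightarrow> set_integrable lborel {x..y} h"
    and ae: "AE x\<in>I in lborel. h x = k x" and k: "continuous_on I k" and x: "x \<in> I"
  shows "(C has_vector_derivative k x) (at x)"
proof -
  obtain e where e: "e > 0" "\<And>y. \<bar>y - x\<bar> < e \<Longrightarrow> y \<in> I" using op x unfolding open_real by auto
  let ?a = "x - e/2" and ?b = "x + e/2"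
  have sub: "{?a..?b} \<subseteq> I" using e by (auto simp: subset_eq abs_less_iff)
  have aI: "?a \<in> I" using e sub by auto
  have eq: "C y = C ?a + integral {?a..y} k" if y: "y \<in> {?a..?b}" for y
  proof -
    have s2: "{?a..y} \<subseteq> I" using y sub by auto
    have ik: "set_integrable lborel {?a..y} k" by (rule borel_integrable_atLeastAtMost'[OF continuous_on_subset[OF k s2]])
    have "C y - C ?a = (LINT t:{?a..y}|lborel. h t)" using C[OF aI] y sub by auto
    also have "\<dots> = (LINT t:{?a..y}|lborel. k t)"
      unfolding set_lebesgue_integral_def
    proof (rule Bochner_Integration.integral_cong_AE)
      show "AE x in lborel. indicat_real {?a..y} x *\<^sub>R h x = indicat_real {?a..y} x *\<^sub>R k x"
        using ae by eventually_elim (use s2 in \<open>auto simp: indicator_def\<close>)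
      show "(\<lambda>x. indicat_real {?a..y} x *\<^sub>R h x) \<in> borel_measurable lborel" "(\<lambda>x. indicat_real {?a..y} x *\<^sub>R k x) \<in> borel_measurable lborel"
        using borel_measurable_integrable[OF h[OF s2, unfolded set_integrable_def]] borel_measurable_integrable[OF ik[unfolded set_integrable_def]] .
    qed
    also have "\<dots> = integral {?a..y} k" by (rule set_borel_integral_eq_integral(2)[OF ik])
    finally show ?thesis by (simp add: algebra_simps)
  qed
  have "((\<lambda>y. integral {?a..y} k) has_vector_derivative k x) (at x within {?a..?b})"
    by (rule integral_has_vector_derivative[OF continuous_on_subset[OF k sub]]) (use e in auto)
  then have "((\<lambda>y. integral {?a..y} k) has_vector_derivative k x) (at x)"
    by (subst (asm) at_within_interior) (use e in \<open>auto simp: interior_atLeastAtMost_real\<close>)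
  then have "((\<lambda>y. C ?a + integral {?a..y} k) has_vector_derivative 0 + k x) (at x)"
    by (intro has_vector_derivative_add has_vector_derivative_const)
  then have "(C has_vector_derivative 0 + k x) (at x)"
  proof (rule has_vector_derivative_transform_within_open[of _ _ _ "{?a<..<?b}"])
    show "C ?a + integral {?a..y} k = C y" if "y \<in> {?a<..<?b}" for y
      by (rule eq[symmetric]) (use that in auto)
  qed (use e in auto)
  then show ?thesis by simp
qed

lemma set_borel_measurable_continuous_on_open:
  fixes f :: "real \<Rightarrow> complex"
  assumes "open I" "continuous_on I f" shows "set_borel_measurable lborel I f"
  using borel_measurable_continuous_on_indicator[of I f] assms by (simp add: set_borel_measurable_def)

text \<open>
  The function and its weak derivative are, almost everywhere, primitives of \<open>C1\<close> and of \<open>Q * C0\<close>.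
  These are continuous, so the weak equation is a classical one.
\<close>
lemma weak_linear_ode_regularity:
  fixes g h1 h2 Q :: "real \<Rightarrow> complex"
  assumes op: "open I" and iv: "is_interval I"
    and w: "has_weak_deriv I g h1" "has_weak_deriv I h1 h2"
    and ae: "AE x\<in>I in lborel. h2 x = Q x * g x" and Q: "continuous_on I Q"
  obtains C0 C1 where "AE x\<in>I in lborel. g x = C0 x" "AE x\<in>I in lborel. h1 x = C1 x"
    "continuous_on I C0" "continuous_on I C1" "C0 \<in> L2_on I" "C1 \<in> L2_on I"
    "\<And>x. x \<in> I \<Longrightarrow> (C0 has_vector_derivative C1 x) (at x)"
    "\<And>x. x \<in> I \<Longrightarrow> (C1 has_vector_derivative Q x * C0 x) (at x)"
proof -
  obtain C0 where C0: "AE x\<in>I in lborel. g x = C0 x" "continuous_on I C0"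
    "\<And>x y. x \<in> I \<Longrightarrow> y \<in> I \<Longrightarrow> x \<le> y \<Longrightarrow> C0 y - C0 x = (LINT t:{x..y}|lborel. h1 t)"
    using weak_deriv_imp_primitive[OF op iv w(1)] by blast
  obtain C1 where C1: "AE x\<in>I in lborel. h1 x = C1 x" "continuous_on I C1"
    "\<And>x y. x \<in> I \<Longrightarrow> y \<in> I \<Longrightarrow> x \<le> y \<Longrightarrow> C1 y - C1 x = (LINT t:{x..y}|lborel. h2 t)"
    using weak_deriv_imp_primitive[OF op iv w(2)] by blast
  have h: "set_integrable lborel {x..y} h1" "set_integrable lborel {x..y} h2" if "{x..y} \<subseteq> I" for x y
    using L2_on_imp_set_integrable[OF _ that] w by (auto simp: has_weak_deriv_def)
  have ae2: "AE x\<in>I in lborel. h2 x = Q x * C0 x" using ae C0(1) by eventually_elim auto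
  show ?thesis
  proof (rule that[OF C0(1) C1(1) C0(2) C1(2)])
    show "C0 \<in> L2_on I" 
      using has_weak_deriv_cong_AE[OF w(1) _ C0(1) set_borel_measurable_continuous_on_open[OF op C0(2)]] op
      by (simp add: has_weak_deriv_def)
    show "C1 \<in> L2_on I" 
      using has_weak_deriv_cong_AE[OF w(2) _ C1(1) set_borel_measurable_continuous_on_open[OF op C1(2)]] op
      by (simp add: has_weak_deriv_def)
    show "(C0 has_vector_derivative C1 x) (at x)" if "x \<in> I" for x
      by (rule primitive_has_vector_derivative[OF op iv C0(3) h(1) C1(1) C1(2) that])
    show "(C1 has_vector_derivative Q x * C0 x) (at x)" if "x \<in> I" for x
    proof -
      have "continuous_on I (\<lambda>x. Q x * C0 x)" by (intro continuous_intros Q C0(2))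
      from primitive_has_vector_derivative[OF op iv C1(3) h(2) ae2 this that] show ?thesis .
    qed
  qed
qed

lemma set_integrable_const_Ioi: "set_integrable lborel {0::real<..} (\<lambda>_. k :: real) \<Longrightarrow> k = 0"
proof (rule ccontr)
  assume i: "set_integrable lborel {0::real<..} (\<lambda>_. k)" and k: "k \<noteq> 0"
  have "integrable lborel (indicator {0::real<..} :: real \<Rightarrow> real)"
    using i k by (simp add: set_integrable_def)
  then have fin: "emeasure lborel {0::real<..} < \<infinity>" by (simp add: integrable_indicator_iff)
  then obtain r where r: "emeasure lborel {0::real<..} = ennreal r" "r \<ge> 0" by (cases "emeasure lborel {0::real<..}") auto
  have "ennreal (r + 1) = emeasure lborel {0<..r + 1}" using r by simp
  also have "\<dots> \<le> emeasure lborel {0::real<..}" by (rule emeasure_mono) auto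
  finally show False using r by simp
qed

lemma square_integrable_imp_prod_integrable:
  fixes f g :: "real \<Rightarrow> real"
  assumes "set_integrable lborel S (\<lambda>x. (f x)\<^sup>2)" "set_integrable lborel S (\<lambda>x. (g x)\<^sup>2)"
    and "open S" "continuous_on S f" "continuous_on S g"
  shows "set_integrable lborel S (\<lambda>x. f x * g x)"
proof (rule set_integrable_bound)
  show "set_integrable lborel S (\<lambda>x. (f x)\<^sup>2 + (g x)\<^sup>2)" using assms by (intro set_integral_add)
  have "continuous_on S (\<lambda>x. f x * g x)" using assms by (intro continuous_intros)
  then show "set_borel_measurable lborel S (\<lambda>x. f x * g x)"
    using borel_measurable_continuous_on_indicator[of S "\<lambda>x. f x * g x"] assms by (simp add: set_borel_measurable_def)
  have "\<bar>f x * g x\<bar> \<le> (f x)\<^sup>2 + (g x)\<^sup>2" for x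
    using sum_squares_bound[of "\<bar>f x\<bar>" "\<bar>g x\<bar>"] zero_le_power2[of "f x"] zero_le_power2[of "g x"] abs_ge_zero[of "f x * g x"]
    unfolding abs_mult power2_abs by linarith
  then show "AE x in lborel. x \<in> S \<longrightarrow> norm (f x * g x) \<le> norm ((f x)\<^sup>2 + (g x)\<^sup>2)"
    by (auto intro!: AE_I2)
qed

context soliton
begin

lemma exp_integrable: "set_integrable lborel {a..} (\<lambda>y. exp (- (2 * s) * y))"
proof (rule set_integrable_bound)
  have C: "well_const > 0" by (rule C_pos)
  show "set_integrable lborel {a..} (\<lambda>y. 1 / well_const * majorant y)" by (intro set_integrable_mult_right majorant_integrable)
  have "(\<lambda>y. exp (- (2 * s) * y)) \<in> borel_measurable borel" by (intro borel_measurable_continuous_onI continuous_intros)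
  then show "set_borel_measurable lborel {a..} (\<lambda>y. exp (- (2 * s) * y))"
    unfolding set_borel_measurable_def by measurable
  have "exp (- (2 * s) * y) \<le> 1 / well_const * majorant y" for y
  proof -
    have "exp (- well_decay * y) * 1 \<le> exp (- well_decay * y) * weight y"
      using weight_gt_1[of y] by (intro mult_left_mono) auto
    also have "\<dots> = 1 / well_const * majorant y" using C by (simp add: majorant_def)
    finally show ?thesis by (simp only: well_decay_def mult_1_right)
  qed
  then show "AE y in lborel. y \<in> {a..} \<longrightarrow> norm (exp (- (2 * s) * y)) \<le> norm (1 / well_const * majorant y)"
    using C by (auto intro!: AE_I2 simp: majorant_nonneg abs_mult)
qed

text \<open>
  The rate \<open>s\<close> is the weakest one that occurs; it is enough for square integrability.
\<close>
definition decaying :: "real \<Rightarrow> (real \<Rightarrow> real) \<Rightarrow> bool" where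
  "decaying a p \<longleftrightarrow> continuous_on UNIV p \<and> (\<exists>M. \<forall>y\<ge>a. \<bar>p y\<bar> \<le> M * exp (- s * y))"

lemma weight_mono: "a \<le> y \<Longrightarrow> weight y \<le> weight a"
  using C_pos \<delta>_pos \<kappa>0_pos unfolding weight_def
  by (auto intro!: divide_right_mono mult_left_mono)

lemma exp_rate_mono: "\<kappa> \<ge> s \<Longrightarrow> y \<ge> a \<Longrightarrow> exp (- \<kappa> * y) \<le> exp (- (\<kappa> - s) * a) * exp (- s * y)"
  using mult_left_mono[of a y "\<kappa> - s"] by (simp add: exp_add[symmetric] algebra_simps)

lemma modulations_bounded:
  "\<exists>M. \<forall>y\<ge>a. \<bar>modulation \<kappa> y\<bar> \<le> M \<and> \<bar>modulation_slope \<kappa> y\<bar> \<le> M"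
proof -
  define L where "L = s * norm jost_bcontfun * (weight a - 1)"
  define N where "N = s * norm jost_bcontfun / (2 * decay_rate \<kappa>) * (weight a - 1)"
  have nn: "N \<ge> 0" "L \<ge> 0" using weight_gt_1[of a] s_pos decay_rate_pos[of \<kappa>] by (auto simp: N_def L_def)
  have "\<bar>modulation \<kappa> y\<bar> \<le> 1 + N + L \<and> \<bar>modulation_slope \<kappa> y\<bar> \<le> 1 + N + L" if y: "y \<ge> a" for y
  proof -
    have "s * norm jost_bcontfun * (weight y - 1) \<le> L"
      unfolding L_def using weight_mono[OF y] s_pos by (intro mult_left_mono) auto
    moreover have "s * norm jost_bcontfun / (2 * decay_rate \<kappa>) * (weight y - 1) \<le> N"
      unfolding N_def using weight_mono[OF y] s_pos decay_rate_pos[of \<kappa>] by (intro mult_left_mono) auto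
    ultimately show ?thesis using modulation_bound[of \<kappa> y] modulation_slope_bound[of \<kappa> y] nn by linarith
  qed
  then show ?thesis by blast
qed

lemma decaying_exp_mult:
  assumes k: "\<kappa> \<ge> s" and c: "continuous_on UNIV (\<lambda>y. exp (- \<kappa> * y) * m y)" and b: "\<And>y. y \<ge> a \<Longrightarrow> \<bar>m y\<bar> \<le> M"
  shows "decaying a (\<lambda>y. exp (- \<kappa> * y) * m y)"
  unfolding decaying_def
proof (intro conjI c exI allI impI)
  fix y assume y: "y \<ge> a"
  have "\<bar>exp (- \<kappa> * y) * m y\<bar> \<le> (exp (- (\<kappa> - s) * a) * exp (- s * y)) * M"
    unfolding abs_mult using exp_rate_mono[OF k y] b[OF y] by (intro mult_mono) auto
  then show "\<bar>exp (- \<kappa> * y) * m y\<bar> \<le> (exp (- (\<kappa> - s) * a) * M) * exp (- s * y)" by (simp add: ac_simps)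
qed

lemma jost_continuous: "continuous_on S (jost \<kappa>)"
  by (meson DERIV_isCont continuous_at_imp_continuous_on jost_has_derivative)

lemma jost_deriv_continuous: "\<kappa> \<ge> s \<Longrightarrow> continuous_on S (jost_deriv \<kappa>)"
  by (meson DERIV_isCont continuous_at_imp_continuous_on jost_deriv_has_derivative)

lemma jost_decaying: assumes "\<kappa> \<ge> s" shows "decaying a (jost \<kappa>)"
proof -
  obtain M where M: "\<And>y. y \<ge> a \<Longrightarrow> \<bar>modulation \<kappa> y\<bar> \<le> M" using modulations_bounded by blast
  show ?thesis unfolding jost_def[abs_def]
    by (rule decaying_exp_mult[OF assms _ M]) (use jost_continuous[of UNIV \<kappa>] in \<open>simp_all add: jost_def[abs_def]\<close>)
qed

lemma jost_deriv_decaying: assumes "\<kappa> \<ge> s" shows "decaying a (jost_deriv \<kappa>)"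
proof -
  obtain M where M: "\<And>y. y \<ge> a \<Longrightarrow> \<bar>modulation \<kappa> y\<bar> \<le> M" "\<And>y. y \<ge> a \<Longrightarrow> \<bar>modulation_slope \<kappa> y\<bar> \<le> M"
    using modulations_bounded by blast
  have "\<bar>modulation_slope \<kappa> y - \<kappa> * modulation \<kappa> y\<bar> \<le> M + \<kappa> * M" if "y \<ge> a" for y
  proof -
    have "\<bar>\<kappa> * modulation \<kappa> y\<bar> \<le> \<kappa> * M" using M(1)[OF that] assms s_pos by (simp add: abs_mult)
    then show ?thesis using M(2)[OF that] by linarith
  qed
  then show ?thesis unfolding jost_deriv_def[abs_def]
    by (rule decaying_exp_mult[OF assms, rotated]) (use jost_deriv_continuous[OF assms, of UNIV] in \<open>simp_all add: jost_deriv_def[abs_def]\<close>)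
qed

lemma decaying_mult_bounded:
  assumes p: "decaying a p" and c: "continuous_on UNIV m" and b: "\<And>y. y \<ge> a \<Longrightarrow> \<bar>m y\<bar> \<le> K"
  shows "decaying a (\<lambda>y. m y * p y)"
proof -
  obtain M where M: "\<And>y. y \<ge> a \<Longrightarrow> \<bar>p y\<bar> \<le> M * exp (- s * y)" using p unfolding decaying_def by blast
  have "\<bar>m y * p y\<bar> \<le> (K * M) * exp (- s * y)" if "y \<ge> a" for y
  proof -
    have "\<bar>m y\<bar> * \<bar>p y\<bar> \<le> K * (M * exp (- s * y))"
      using M[OF that] b[OF that] by (intro mult_mono) auto
    then show ?thesis by (simp add: abs_mult)
  qed
  then show ?thesis using p c unfolding decaying_def by (auto intro!: continuous_intros)
qed

lemma second_deriv_decaying: assumes "\<kappa> \<ge> s" shows "decaying a (\<lambda>y. (\<kappa>\<^sup>2 - well y) * jost \<kappa> y)"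
proof (rule decaying_mult_bounded[OF jost_decaying[OF assms]])
  show "continuous_on UNIV (\<lambda>y. \<kappa>\<^sup>2 - well y)" by (intro continuous_intros W_cont)
  fix y assume y: "y \<ge> a"
  have "well_const * exp (- well_decay * y) \<le> well_const * exp (- well_decay * a)"
    using y C_pos \<delta>_pos by (intro mult_left_mono) auto
  then show "\<bar>\<kappa>\<^sup>2 - well y\<bar> \<le> \<kappa>\<^sup>2 + well_const * exp (- well_decay * a)"
    using W_bound[of y] zero_le_power2[of \<kappa>] by linarith
qed

lemma decaying_square_integrable:
  assumes "decaying a p" shows "set_integrable lborel {a..} (\<lambda>y. (p y)\<^sup>2)"
proof -
  obtain M where M: "\<And>y. y \<ge> a \<Longrightarrow> \<bar>p y\<bar> \<le> M * exp (- s * y)" and c: "continuous_on UNIV p"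
    using assms unfolding decaying_def by blast
  show ?thesis
  proof (rule set_integrable_bound)
    show "set_integrable lborel {a..} (\<lambda>y. M\<^sup>2 * exp (- (2 * s) * y))" by (intro set_integrable_mult_right exp_integrable)
    have "(\<lambda>y. (p y)\<^sup>2) \<in> borel_measurable borel" using c by (intro borel_measurable_continuous_onI continuous_intros)
    then show "set_borel_measurable lborel {a..} (\<lambda>y. (p y)\<^sup>2)"
      unfolding set_borel_measurable_def by measurable
    have "(p y)\<^sup>2 \<le> M\<^sup>2 * exp (- (2 * s) * y)" if "y \<ge> a" for y
    proof -
      have "\<bar>p y\<bar>\<^sup>2 \<le> (M * exp (- s * y))\<^sup>2" by (rule power_mono[OF M[OF that]]) simp
      also have "\<dots> = M\<^sup>2 * exp (- (2 * s) * y)" by (simp add: power_mult_distrib exp_double[symmetric] algebra_simps)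
      finally show ?thesis by simp
    qed
    then show "AE y in lborel. y \<in> {a..} \<longrightarrow> norm ((p y)\<^sup>2) \<le> norm (M\<^sup>2 * exp (- (2 * s) * y))"
      by (auto intro!: AE_I2)
  qed
qed

text \<open>
  The Wronskian with the Jost function is constant, and integrable because all four functions are square
  integrable. So it vanishes, and both solutions have proportional initial data at \<open>1\<close>.
\<close>
lemma half_line_solution_real:
  fixes g g' :: "real \<Rightarrow> real"
  assumes k: "\<kappa> \<ge> s"
    and d: "\<And>x. x > 0 \<Longrightarrow> (g has_real_derivative g' x) (at x)"
    and d': "\<And>x. x > 0 \<Longrightarrow> (g' has_real_derivative (\<kappa>\<^sup>2 - well (a + x)) * g x) (at x)"
    and i: "set_integrable lborel {0<..} (\<lambda>x. (g x)\<^sup>2)" "set_integrable lborel {0<..} (\<lambda>x. (g' x)\<^sup>2)"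
  shows "\<exists>c. \<forall>x>0. g x = c * jost \<kappa> (a + x) \<and> g' x = c * jost_deriv \<kappa> (a + x)"
proof -
  define f where "f x = jost \<kappa> (a + x)" for x
  define f' where "f' x = jost_deriv \<kappa> (a + x)" for x
  have fd: "(f has_real_derivative f' x) (at x)" for x
    unfolding f_def[abs_def] f'_def using DERIV_shift[of "jost \<kappa>" "jost_deriv \<kappa> (a + x)" x a] jost_has_derivative[of \<kappa> "a + x"]
    by (simp add: add.commute)
  have f'd: "(f' has_real_derivative (\<kappa>\<^sup>2 - well (a + x)) * f x) (at x)" for x
    unfolding f_def f'_def[abs_def] using DERIV_shift[of "jost_deriv \<kappa>" "(\<kappa>\<^sup>2 - well (a + x)) * jost \<kappa> (a + x)" x a] jost_deriv_has_derivative[OF k, of "a + x"]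
    by (simp add: add.commute)
  define w where "w x = g x * f' x - g' x * f x" for x
  have wd: "(w has_real_derivative 0) (at x)" if "x > 0" for x
    unfolding w_def[abs_def]
    by (rule DERIV_cong[OF DERIV_diff[OF DERIV_mult[OF d[OF that] f'd] DERIV_mult[OF d'[OF that] fd]]]) (simp add: algebra_simps)
  obtain k0 where k0: "\<And>x. x > 0 \<Longrightarrow> w x = k0"
  proof -
    have "\<exists>k0. \<forall>x\<in>{0<..}. w x = k0"
      by (rule has_field_derivative_zero_constant) (use wd in \<open>auto intro: has_field_derivative_at_within\<close>)
    then show ?thesis using that by auto
  qed
  have cont: "continuous_on {0<..} g" "continuous_on {0<..} g'" "continuous_on {0<..} f" "continuous_on {0<..} f'"
    using d d' fd f'd by (auto intro!: continuous_at_imp_continuous_on DERIV_isCont)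
  have dec: "set_integrable lborel {0<..} (\<lambda>x. (p (a + x))\<^sup>2)" if "decaying a p" for p
  proof (rule set_integrable_subset)
    show "set_integrable lborel {0..} (\<lambda>x. (p (a + x))\<^sup>2)"
      using LINT_shift(2)[of "\<lambda>y. (p y)\<^sup>2" a] decaying_square_integrable[OF that] by blast
  qed auto
  have fi: "set_integrable lborel {0<..} (\<lambda>x. (f x)\<^sup>2)" "set_integrable lborel {0<..} (\<lambda>x. (f' x)\<^sup>2)"
    unfolding f_def f'_def by (rule dec[OF jost_decaying[OF k]], rule dec[OF jost_deriv_decaying[OF k]])
  have "set_integrable lborel {0<..} w"
    unfolding w_def[abs_def] by (intro set_integral_diff(1) square_integrable_imp_prod_integrable i fi cont) auto
  then have "set_integrable lborel {0::real<..} (\<lambda>_. k0)"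
    by (subst (asm) set_integrable_cong[OF refl refl, of _ _ "\<lambda>_. k0"]) (use k0 in auto)
  then have w0: "w 1 = 0" using set_integrable_const_Ioi k0 by simp
  obtain c where c: "g 1 = c * f 1" "g' 1 = c * f' 1"
  proof (cases "f 1 = 0")
    case False
    then show ?thesis using w0 that[of "g 1 / f 1"] by (simp add: w_def field_simps)
  next
    case True
    then have "f' 1 \<noteq> 0" using jost_nontrivial[OF k, of "a + 1"] by (simp add: f_def f'_def)
    then show ?thesis using w0 True that[of "g' 1 / f' 1"] by (simp add: w_def)
  qed
  have "g x - c * f x = 0 \<and> g' x - c * f' x = 0" if x: "x > 0" for x
  proof (rule linear_ode_unique[where y = "\<lambda>x. g x - c * f x" and y' = "\<lambda>x. g' x - c * f' x" and p = "min 1 x" and q = "max 1 x" and ?x0.0 = 1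
        and Q = "\<lambda>x. \<kappa>\<^sup>2 - well (a + x)"])
    show "((\<lambda>x. g x - c * f x) has_real_derivative g' t - c * f' t) (at t)" if "t \<in> {min 1 x..max 1 x}" for t
      using that x by (intro DERIV_diff DERIV_cmult d fd) auto
    show "((\<lambda>x. g' x - c * f' x) has_real_derivative (\<kappa>\<^sup>2 - well (a + t)) * (g t - c * f t)) (at t)" if "t \<in> {min 1 x..max 1 x}" for t
      by (rule DERIV_cong[OF DERIV_diff[OF d' DERIV_cmult[OF f'd]]]) (use that x in \<open>auto simp: algebra_simps\<close>)
    show "continuous_on {min 1 x..max 1 x} (\<lambda>x. \<kappa>\<^sup>2 - well (a + x))"
      by (intro continuous_intros continuous_on_compose2[OF W_cont]) auto
  qed (use c in auto)
  then show ?thesis by (intro exI[of _ c]) (auto simp: f_def f'_def)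
qed

lemma half_line_solution:
  fixes G G' :: "real \<Rightarrow> complex"
  assumes k: "\<kappa> \<ge> s"
    and d: "\<And>x. x > 0 \<Longrightarrow> (G has_vector_derivative G' x) (at x)"
    and d': "\<And>x. x > 0 \<Longrightarrow> (G' has_vector_derivative of_real (\<kappa>\<^sup>2 - well (a + x)) * G x) (at x)"
    and L2: "G \<in> L2_on {0<..}" "G' \<in> L2_on {0<..}"
  shows "\<exists>c. \<forall>x>0. G x = c * of_real (jost \<kappa> (a + x)) \<and> G' x = c * of_real (jost_deriv \<kappa> (a + x))"
proof -
  have part: "set_integrable lborel {0<..} (\<lambda>x. (P (F x))\<^sup>2)" if F: "F \<in> L2_on {0<..}" and P: "P = Re \<or> P = Im" for F P
  proof (rule set_integrable_bound)
    show "set_integrable lborel {0<..} (\<lambda>x. (cmod (F x))\<^sup>2)" using F by (simp add: L2_on_def)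
    have m: "(\<lambda>x. indicat_real {0<..} x *\<^sub>R F x) \<in> borel_measurable borel" using F by (simp add: L2_on_def set_borel_measurable_def)
    have Pb: "P \<in> borel_measurable borel" using P by auto
    then have "(\<lambda>x. (P (indicat_real {0<..} x *\<^sub>R F x))\<^sup>2) \<in> borel_measurable borel"
      by (intro borel_measurable_power measurable_compose[OF m Pb])
    moreover have "(\<lambda>x. (P (indicat_real {0<..} x *\<^sub>R F x))\<^sup>2) = (\<lambda>x. indicat_real {0<..} x *\<^sub>R (P (F x))\<^sup>2)"
      using P by (auto simp: indicator_def)
    ultimately show "set_borel_measurable lborel {0<..} (\<lambda>x. (P (F x))\<^sup>2)"
      by (simp add: set_borel_measurable_def)
    have "(P z)\<^sup>2 \<le> (cmod z)\<^sup>2" for z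
      using P abs_Re_le_cmod[of z] abs_Im_le_cmod[of z] power_mono[of "\<bar>P z\<bar>" "cmod z" 2] by auto
    then show "AE x in lborel. x \<in> {0<..} \<longrightarrow> norm ((P (F x))\<^sup>2) \<le> norm ((cmod (F x))\<^sup>2)"
      by (auto intro!: AE_I2)
  qed
  have "\<exists>c. \<forall>x>0. Re (G x) = c * jost \<kappa> (a + x) \<and> Re (G' x) = c * jost_deriv \<kappa> (a + x)"
  proof (rule half_line_solution_real[OF k])
    show "((\<lambda>x. Re (G x)) has_real_derivative Re (G' x)) (at x)" if "x > 0" for x
      using bounded_linear.has_vector_derivative[OF bounded_linear_Re d[OF that]] by (simp add: has_real_derivative_iff_has_vector_derivative)
    show "((\<lambda>x. Re (G' x)) has_real_derivative (\<kappa>\<^sup>2 - well (a + x)) * Re (G x)) (at x)" if "x > 0" for x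
      using bounded_linear.has_vector_derivative[OF bounded_linear_Re d'[OF that]] by (simp add: has_real_derivative_iff_has_vector_derivative)
  qed (use part L2 in auto)
  then obtain c1 where c1: "\<And>x. x > 0 \<Longrightarrow> Re (G x) = c1 * jost \<kappa> (a + x) \<and> Re (G' x) = c1 * jost_deriv \<kappa> (a + x)" by blast
  have "\<exists>c. \<forall>x>0. Im (G x) = c * jost \<kappa> (a + x) \<and> Im (G' x) = c * jost_deriv \<kappa> (a + x)"
  proof (rule half_line_solution_real[OF k])
    show "((\<lambda>x. Im (G x)) has_real_derivative Im (G' x)) (at x)" if "x > 0" for x
      using bounded_linear.has_vector_derivative[OF bounded_linear_Im d[OF that]] by (simp add: has_real_derivative_iff_has_vector_derivative)
    show "((\<lambda>x. Im (G' x)) has_real_derivative (\<kappa>\<^sup>2 - well (a + x)) * Im (G x)) (at x)" if "x > 0" for x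
      using bounded_linear.has_vector_derivative[OF bounded_linear_Im d'[OF that]] by (simp add: has_real_derivative_iff_has_vector_derivative)
  qed (use part L2 in auto)
  then obtain c2 where c2: "\<And>x. x > 0 \<Longrightarrow> Im (G x) = c2 * jost \<kappa> (a + x) \<and> Im (G' x) = c2 * jost_deriv \<kappa> (a + x)" by blast
  show ?thesis using c1 c2 by (intro exI[of _ "Complex c1 c2"]) (auto simp: complex_eq_iff)
qed

end

section \<open>Eigenspaces of the operator on the line\<close>

lemma weak_deriv_has_weak_deriv: "g \<in> H1_on \<Omega> \<Longrightarrow> has_weak_deriv \<Omega> g (weak_deriv \<Omega> g)"
proof -
  assume "g \<in> H1_on \<Omega>"
  then have "\<exists>h. has_weak_deriv \<Omega> g h" by (simp add: H1_on_def)
  then show ?thesis unfolding weak_deriv_def by (rule someI_ex)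
qed

lemma ae_dim_line:
  assumes g0: "g0 \<in> V" "\<not> (AE x in lborel. g0 x = 0)"
    and V: "\<And>g. g \<in> V \<Longrightarrow> \<exists>c. AE x in lborel. g x = c * g0 x"
  shows "ae_dim V = 1"
proof -
  let ?S = "{B. finite B \<and> B \<subseteq> V \<and> ae_independent B}"
  have "{g0} \<in> ?S"
  proof -
    have "c g0 = 0" if "AE x in lborel. c g0 * g0 x = 0" for c :: "(real \<Rightarrow> complex) \<Rightarrow> complex"
    proof (rule ccontr)
      assume "c g0 \<noteq> 0"
      with that have "AE x in lborel. g0 x = 0" by simp
      with g0 show False by blast
    qed
    then show ?thesis using g0 by (auto simp: ae_independent_def)
  qed
  moreover have "card B \<le> 1" if B: "B \<in> ?S" for B
  proof (rule ccontr)
    assume "\<not> card B \<le> 1"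
    then obtain u v where uv: "u \<in> B" "v \<in> B" "u \<noteq> v"
      by (metis B One_nat_def card_le_Suc0_iff_eq mem_Collect_eq)
    obtain cu cv where c: "AE x in lborel. u x = cu * g0 x" "AE x in lborel. v x = cv * g0 x"
      using V B uv by blast
    have fin: "finite B" and ind: "\<And>c. (AE x in lborel. (\<Sum>b\<in>B. c b * b x) = 0) \<Longrightarrow> (\<forall>b\<in>B. c b = 0)"
      using B by (auto simp: ae_independent_def)
    have two: "(\<Sum>b\<in>B. (if b = u then \<alpha> else if b = v then \<beta> else 0) * b x) = \<alpha> * u x + \<beta> * v x" for \<alpha> \<beta> :: complex and x
    proof -
      have "(\<Sum>b\<in>B. (if b = u then \<alpha> else if b = v then \<beta> else 0) * b x) = (\<Sum>b\<in>{u, v}. (if b = u then \<alpha> else if b = v then \<beta> else 0) * b x)"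
        by (rule sum.mono_neutral_right) (use fin uv in auto)
      then show ?thesis using uv by simp
    qed
    have zero: "\<alpha> = 0 \<and> \<beta> = 0" if "AE x in lborel. \<alpha> * u x + \<beta> * v x = 0" for \<alpha> \<beta>
      using ind[of "\<lambda>b. if b = u then \<alpha> else if b = v then \<beta> else 0"] that uv unfolding two by auto
    have "AE x in lborel. cv * u x + (- cu) * v x = 0" using c by eventually_elim simp
    from zero[OF this] have "cu = 0" by simp
    with c(1) have "AE x in lborel. 1 * u x + 0 * v x = 0" by simp
    from zero[OF this] show False by simp
  qed
  ultimately show ?thesis unfolding ae_dim_def
    by (intro antisym SUP_least SUP_upper2[of "{g0}"]) (auto simp: one_enat_def)
qed

lemma L2_on_reflect:
  assumes "C \<in> L2_on {..<0}" shows "(\<lambda>x. C (- x)) \<in> L2_on {0<..}"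
proof -
  have e: "(\<lambda>x. indicat_real {0<..} x *\<^sub>R f (- x)) = (\<lambda>x. indicat_real {..<0} (- x) *\<^sub>R f (- x))" for f :: "real \<Rightarrow> 'b::real_vector"
    by (auto simp: indicator_def)
  have "(\<lambda>x. indicat_real {..<0} x *\<^sub>R C x) \<in> borel_measurable borel"
    using assms by (simp add: L2_on_def set_borel_measurable_def)
  then have "(\<lambda>x. indicat_real {..<0} (- x) *\<^sub>R C (- x)) \<in> borel_measurable borel"
    by (rule measurable_compose[rotated]) simp
  moreover have "integrable lborel (\<lambda>x. indicat_real {..<0} (- x) *\<^sub>R (cmod (C (- x)))\<^sup>2)"
    using lborel_integrable_real_affine[of "\<lambda>x. indicat_real {..<0} x *\<^sub>R (cmod (C x))\<^sup>2" "-1" 0] assms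
    by (simp add: L2_on_def set_integrable_def)
  ultimately show ?thesis unfolding L2_on_def set_borel_measurable_def set_integrable_def mem_Collect_eq e e[of "\<lambda>x. (cmod (C x))\<^sup>2"]
    by simp
qed

text \<open>
  The two one-sided traces are limits of any continuous representative.
\<close>
lemma tendsto_cont_rep_right:
  assumes C: "continuous_on {0<..} C" and ae: "AE x\<in>{0<..} in lborel. C x = g x" and l: "(C \<longlongrightarrow> l) (at_right 0)"
  shows "trace_right g = l"
  unfolding trace_right_def
proof (rule tendsto_Lim)
  show "(cont_rep {0<..} g \<longlongrightarrow> l) (at_right 0)"
    by (rule Lim_transform_eventually[OF l]) (use cont_rep_eq[OF _ C ae] in \<open>auto simp: eventually_at_filter\<close>)
qed simp

lemma tendsto_cont_rep_left:
  assumes C: "continuous_on {..<0} C" and ae: "AE x\<in>{..<0} in lborel. C x = g x" and l: "(C \<longlongrightarrow> l) (at_left 0)"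
  shows "trace_left g = l"
  unfolding trace_left_def
proof (rule tendsto_Lim)
  show "(cont_rep {..<0} g \<longlongrightarrow> l) (at_left 0)"
    by (rule Lim_transform_eventually[OF l]) (use cont_rep_eq[OF _ C ae] in \<open>auto simp: eventually_at_filter\<close>)
qed simp

context soliton
begin

definition schroedinger_op :: "real \<Rightarrow> (real \<Rightarrow> complex) \<Rightarrow> real \<Rightarrow> complex" where
  "schroedinger_op a g = (\<lambda>x. - weak_deriv (- {0}) (weak_deriv (- {0}) g) x
     - of_real (well (\<bar>x\<bar> + a) - s\<^sup>2) * g x)"

lemma shifted_tendsto:
  fixes p :: "real \<Rightarrow> real"
  assumes "continuous_on UNIV p"
  shows "((\<lambda>x. c * of_real (p (a + x)) :: complex) \<longlongrightarrow> c * of_real (p a)) (at_right 0)"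
    and "((\<lambda>x. c * of_real (p (a - x)) :: complex) \<longlongrightarrow> c * of_real (p a)) (at_left 0)"
proof -
  have shift: "continuous_on UNIV (\<lambda>x::real. a + x)" "continuous_on UNIV (\<lambda>x::real. a - x)"
    by (rule continuous_on_add[OF continuous_on_const continuous_on_id], rule continuous_on_diff[OF continuous_on_const continuous_on_id])
  have i: "isCont (\<lambda>x. p (a + x)) 0" "isCont (\<lambda>x. p (a - x)) 0"
    using continuous_on_compose2[OF assms shift(1)] continuous_on_compose2[OF assms shift(2)]
    by (simp_all add: continuous_on_eq_continuous_at)
  have "isCont (\<lambda>x. c * of_real (p (a + x)) :: complex) 0" "isCont (\<lambda>x. c * of_real (p (a - x)) :: complex) 0"
    by (rule continuous_mult[OF continuous_const continuous_of_real[OF i(1)]],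
        rule continuous_mult[OF continuous_const continuous_of_real[OF i(2)]])
  then show "((\<lambda>x. c * of_real (p (a + x)) :: complex) \<longlongrightarrow> c * of_real (p a)) (at_right 0)"
    "((\<lambda>x. c * of_real (p (a - x)) :: complex) \<longlongrightarrow> c * of_real (p a)) (at_left 0)"
    by (simp_all add: isCont_def filterlim_at_split)
qed

text \<open>
  On each half line an eigenfunction is a multiple of the Jost function, by regularity and square
  integrability; on the left this is applied to the reflected function. The two conditions on the
  coefficients are continuity at the origin and the jump condition.
\<close>
lemma eigenfunction_structure:
  assumes k: "\<kappa> \<ge> s" and g: "g \<in> eigenspace (delta_domain Z) (schroedinger_op a) (s\<^sup>2 - \<kappa>\<^sup>2)"
  obtains cr cl where "AE x\<in>{0<..} in lborel. g x = cr * of_real (jost \<kappa> (a + x))"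
    "AE x\<in>{..<0} in lborel. g x = cl * of_real (jost \<kappa> (a - x))"
    "cr * of_real (jost \<kappa> a) = cl * of_real (jost \<kappa> a)"
    "(cr + cl) * of_real (jost_deriv \<kappa> a) = - of_real Z * cr * of_real (jost \<kappa> a)"
proof -
  define h1 where "h1 = weak_deriv (- {0}) g"
  define h2 where "h2 = weak_deriv (- {0}) h1"
  have gD: "g \<in> delta_domain Z" and ev: "AE x in lborel. schroedinger_op a g x = of_real (s\<^sup>2 - \<kappa>\<^sup>2) * g x"
    using g by (auto simp: eigenspace_def)
  have w: "has_weak_deriv (- {0}) g h1" "has_weak_deriv (- {0}) h1 h2"
    using gD unfolding delta_domain_def H2_on_def h1_def h2_def by (auto intro: weak_deriv_has_weak_deriv)
  define Q :: "real \<Rightarrow> complex" where "Q x = of_real (\<kappa>\<^sup>2 - well (\<bar>x\<bar> + a))" for x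
  have Qc: "continuous_on S Q" for S
    unfolding Q_def by (intro continuous_intros continuous_on_compose2[OF W_cont]) auto
  have ae: "AE x in lborel. h2 x = Q x * g x"
    using ev
  proof eventually_elim
    case (elim x)
    then have "- h2 x - of_real (well (\<bar>x\<bar> + a) - s\<^sup>2) * g x = of_real (s\<^sup>2 - \<kappa>\<^sup>2) * g x"
      by (simp add: schroedinger_op_def h1_def h2_def)
    then have "h2 x = - (of_real (s\<^sup>2 - \<kappa>\<^sup>2) * g x) - of_real (well (\<bar>x\<bar> + a) - s\<^sup>2) * g x" by (simp add: algebra_simps)
    then show ?case by (simp add: Q_def algebra_simps)
  qed
  have op: "open {0::real<..}" "open {..<0::real}" "is_interval {0::real<..}" "is_interval {..<0::real}"
    by (auto simp: is_interval_1)
  have sub: "{0<..} \<subseteq> - {0::real}" "{..<0} \<subseteq> - {0::real}" by auto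
  have aer: "AE x\<in>{0<..} in lborel. h2 x = Q x * g x" "AE x\<in>{..<0} in lborel. h2 x = Q x * g x"
    using ae by (auto elim: eventually_mono)
  obtain P0 P1 where P: "AE x\<in>{0<..} in lborel. g x = P0 x" "AE x\<in>{0<..} in lborel. h1 x = P1 x"
    "continuous_on {0<..} P0" "continuous_on {0<..} P1" "P0 \<in> L2_on {0<..}" "P1 \<in> L2_on {0<..}"
    "\<And>x. x \<in> {0<..} \<Longrightarrow> (P0 has_vector_derivative P1 x) (at x)"
    "\<And>x. x \<in> {0<..} \<Longrightarrow> (P1 has_vector_derivative Q x * P0 x) (at x)"
    using weak_linear_ode_regularity[OF op(1,3) has_weak_deriv_subset[OF w(1) sub(1) op(1)] has_weak_deriv_subset[OF w(2) sub(1) op(1)] aer(1) Qc] by blast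
  obtain N0 N1 where N: "AE x\<in>{..<0} in lborel. g x = N0 x" "AE x\<in>{..<0} in lborel. h1 x = N1 x"
    "continuous_on {..<0} N0" "continuous_on {..<0} N1" "N0 \<in> L2_on {..<0}" "N1 \<in> L2_on {..<0}"
    "\<And>x. x \<in> {..<0} \<Longrightarrow> (N0 has_vector_derivative N1 x) (at x)"
    "\<And>x. x \<in> {..<0} \<Longrightarrow> (N1 has_vector_derivative Q x * N0 x) (at x)"
    using weak_linear_ode_regularity[OF op(2,4) has_weak_deriv_subset[OF w(1) sub(2) op(2)] has_weak_deriv_subset[OF w(2) sub(2) op(2)] aer(2) Qc] by blast
  obtain cr where cr: "\<And>x. x > 0 \<Longrightarrow> P0 x = cr * of_real (jost \<kappa> (a + x)) \<and> P1 x = cr * of_real (jost_deriv \<kappa> (a + x))"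
  proof -
    have "\<exists>c. \<forall>x>0. P0 x = c * of_real (jost \<kappa> (a + x)) \<and> P1 x = c * of_real (jost_deriv \<kappa> (a + x))"
      by (rule half_line_solution[OF k]) (use P in \<open>auto simp: Q_def add.commute\<close>)
    then show ?thesis using that by blast
  qed
  obtain cl where cl: "\<And>x. x > 0 \<Longrightarrow> N0 (- x) = cl * of_real (jost \<kappa> (a + x)) \<and> - N1 (- x) = cl * of_real (jost_deriv \<kappa> (a + x))"
  proof -
    have m: "((\<lambda>x::real. - x) has_real_derivative - 1) (at x)" for x by (auto intro!: derivative_eq_intros)
    have "\<exists>c. \<forall>x>0. N0 (- x) = c * of_real (jost \<kappa> (a + x)) \<and> - N1 (- x) = c * of_real (jost_deriv \<kappa> (a + x))"
    proof (rule half_line_solution[OF k])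
      show "((\<lambda>x. N0 (- x)) has_vector_derivative - N1 (- x)) (at x)" if "x > 0" for x
        using vector_diff_chain_at[OF m[unfolded has_real_derivative_iff_has_vector_derivative] N(7)[of "- x"]] that by (simp add: o_def)
      show "((\<lambda>x. - N1 (- x)) has_vector_derivative of_real (\<kappa>\<^sup>2 - well (a + x)) * N0 (- x)) (at x)" if "x > 0" for x
        using has_vector_derivative_minus[OF vector_diff_chain_at[OF m[unfolded has_real_derivative_iff_has_vector_derivative] N(8)[of "- x"]]] that
        by (simp add: o_def Q_def add.commute)
      show "(\<lambda>x. N0 (- x)) \<in> L2_on {0<..}" by (rule L2_on_reflect[OF N(5)])
      show "(\<lambda>x. - N1 (- x)) \<in> L2_on {0<..}" using L2_on_reflect[OF N(6)] by (simp add: L2_on_def set_borel_measurable_def)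
    qed
    then show ?thesis using that by blast
  qed
  have cl': "N0 x = cl * of_real (jost \<kappa> (a - x))" "N1 x = - cl * of_real (jost_deriv \<kappa> (a - x))" if "x < 0" for x
    using cl[of "- x"] that by (auto simp: minus_equation_iff[of "N1 x"] eq_commute)
  have near: "\<forall>\<^sub>F x in at_right 0. x > (0::real)" "\<forall>\<^sub>F x in at_left 0. x < (0::real)"
    by (auto simp: eventually_at_filter)
  have lP: "(P0 \<longlongrightarrow> cr * of_real (jost \<kappa> a)) (at_right 0)" "(P1 \<longlongrightarrow> cr * of_real (jost_deriv \<kappa> a)) (at_right 0)"
    by (rule Lim_transform_eventually[OF shifted_tendsto(1)[OF jost_continuous]], rule eventually_mono[OF near(1)], use cr in simp)
      (rule Lim_transform_eventually[OF shifted_tendsto(1)[OF jost_deriv_continuous[OF k]]], rule eventually_mono[OF near(1)], use cr in simp)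
  have lN: "(N0 \<longlongrightarrow> cl * of_real (jost \<kappa> a)) (at_left 0)" "(N1 \<longlongrightarrow> - cl * of_real (jost_deriv \<kappa> a)) (at_left 0)"
    by (rule Lim_transform_eventually[OF shifted_tendsto(2)[OF jost_continuous]], rule eventually_mono[OF near(2)], use cl' in simp)
      (rule Lim_transform_eventually[OF shifted_tendsto(2)[OF jost_deriv_continuous[OF k]]], rule eventually_mono[OF near(2)], use cl' in simp)
  have tr: "trace_right h1 = cr * of_real (jost_deriv \<kappa> a)"
    by (rule tendsto_cont_rep_right[OF P(4) _ lP(2)]) (use P(2) in \<open>auto elim: eventually_mono\<close>)
  have tl: "trace_left h1 = - cl * of_real (jost_deriv \<kappa> a)"
    by (rule tendsto_cont_rep_left[OF N(4) _ lN(2)]) (use N(2) in \<open>auto elim: eventually_mono\<close>)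
  have "g \<in> H1_on UNIV" using gD by (simp add: delta_domain_def)
  from weak_deriv_has_weak_deriv[OF this]
  obtain C where C: "AE x\<in>UNIV in lborel. g x = C x" "continuous_on UNIV C"
    using weak_deriv_imp_primitive[OF open_UNIV is_interval_univ] by blast
  have CP: "C x = P0 x" if "x > 0" for x
  proof (rule continuous_AE_eq_imp_eq[OF op(1) _ P(3)])
    show "continuous_on {0<..} C" using C(2) continuous_on_subset by blast
    show "AE x\<in>{0<..} in lborel. C x = P0 x" using C(1) P(1) by eventually_elim auto
  qed (use that in auto)
  have CN: "C x = N0 x" if "x < 0" for x
  proof (rule continuous_AE_eq_imp_eq[OF op(2) _ N(3)])
    show "continuous_on {..<0} C" using C(2) continuous_on_subset by blast
    show "AE x\<in>{..<0} in lborel. C x = N0 x" using C(1) N(1) by eventually_elim auto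
  qed (use that in auto)
  have "isCont C 0" using C(2) by (simp add: continuous_on_eq_continuous_at)
  then have lC: "(C \<longlongrightarrow> C 0) (at_right 0)" "(C \<longlongrightarrow> C 0) (at_left 0)" by (auto simp: isCont_def filterlim_at_split)
  have C0r: "C 0 = cr * of_real (jost \<kappa> a)"
  proof (rule tendsto_unique[OF _ lC(1)])
    show "(C \<longlongrightarrow> cr * of_real (jost \<kappa> a)) (at_right 0)"
      by (rule Lim_transform_eventually[OF lP(1)], rule eventually_mono[OF near(1)]) (use CP in simp)
  qed simp
  have C0l: "C 0 = cl * of_real (jost \<kappa> a)"
  proof (rule tendsto_unique[OF _ lC(2)])
    show "(C \<longlongrightarrow> cl * of_real (jost \<kappa> a)) (at_left 0)"
      by (rule Lim_transform_eventually[OF lN(1)], rule eventually_mono[OF near(2)]) (use CN in simp)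
  qed simp
  have cr0: "cont_rep UNIV g 0 = C 0"
    by (rule cont_rep_eq[OF open_UNIV C(2)]) (use C(1) in \<open>auto elim: eventually_mono\<close>)
  have "trace_right h1 - trace_left h1 = - of_real Z * cont_rep UNIV g 0"
    using gD by (simp add: delta_domain_def h1_def)
  then have jump: "(cr + cl) * of_real (jost_deriv \<kappa> a) = - of_real Z * cr * of_real (jost \<kappa> a)"
    unfolding tr tl cr0 C0r by (simp add: algebra_simps)
  show ?thesis
  proof (rule that[OF _ _ _ jump])
    show "AE x\<in>{0<..} in lborel. g x = cr * of_real (jost \<kappa> (a + x))" using P(1) by eventually_elim (use cr in auto)
    show "AE x\<in>{..<0} in lborel. g x = cl * of_real (jost \<kappa> (a - x))" using N(1) by eventually_elim (use cl' in auto)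
    show "cr * of_real (jost \<kappa> a) = cl * of_real (jost \<kappa> a)" by (rule trans[OF C0r[symmetric] C0l])
  qed
qed

text \<open>
  Even reflection for \<open>\<sigma> = 1\<close> and odd reflection for \<open>\<sigma> = - 1\<close>; differentiation replaces \<open>\<sigma>\<close> by \<open>- \<sigma>\<close>.
\<close>
definition glue :: "real \<Rightarrow> (real \<Rightarrow> real) \<Rightarrow> real \<Rightarrow> real \<Rightarrow> complex" where
  "glue a p \<sigma> x = of_real (if x \<ge> 0 then p (a + x) else \<sigma> * p (a - x))"

lemma glue_L2:
  assumes p: "decaying a p" and O: "\<Omega> \<in> sets borel"
  shows "glue a p \<sigma> \<in> L2_on \<Omega>"
proof -
  have pc: "continuous_on UNIV p" using p by (simp add: decaying_def)
  have [measurable]: "p \<in> borel_measurable borel" using pc by (rule borel_measurable_continuous_onI)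
  have m: "glue a p \<sigma> \<in> borel_measurable borel" unfolding glue_def[abs_def] by measurable
  have i1: "set_integrable lborel {0..} (\<lambda>x. (p (a + x))\<^sup>2)"
    using decaying_square_integrable[OF p] LINT_shift(2)[of "\<lambda>y. (p y)\<^sup>2" a] by simp
  then have i2: "integrable lborel (\<lambda>x. indicat_real {0..} (- x) *\<^sub>R (p (a - x))\<^sup>2)"
    using lborel_integrable_real_affine[of "\<lambda>x. indicat_real {0..} x *\<^sub>R (p (a + x))\<^sup>2" "-1" 0]
    by (simp add: set_integrable_def)
  have "integrable lborel (\<lambda>x. (cmod (glue a p \<sigma> x))\<^sup>2)"
  proof (rule Bochner_Integration.integrable_bound)
    show "integrable lborel (\<lambda>x. indicat_real {0..} x *\<^sub>R (p (a + x))\<^sup>2 + \<sigma>\<^sup>2 * (indicat_real {0..} (- x) *\<^sub>R (p (a - x))\<^sup>2))"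
      using i1 i2 unfolding set_integrable_def by (intro Bochner_Integration.integrable_add integrable_mult_right)
    show "(\<lambda>x. (cmod (glue a p \<sigma> x))\<^sup>2) \<in> borel_measurable lborel" using m by simp
    show "AE x in lborel. norm ((cmod (glue a p \<sigma> x))\<^sup>2) \<le> norm (indicat_real {0..} x *\<^sub>R (p (a + x))\<^sup>2 + \<sigma>\<^sup>2 * (indicat_real {0..} (- x) *\<^sub>R (p (a - x))\<^sup>2))"
      by (rule AE_I2) (auto simp: glue_def indicator_def norm_mult power_mult_distrib)
  qed
  then have "set_integrable lborel \<Omega> (\<lambda>x. (cmod (glue a p \<sigma> x))\<^sup>2)"
    unfolding set_integrable_def using O by (intro integrable_mult_indicator) auto
  moreover have "set_borel_measurable lborel \<Omega> (glue a p \<sigma>)"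
    unfolding set_borel_measurable_def using m O by measurable
  ultimately show ?thesis by (simp add: L2_on_def)
qed

lemma glue_deriv:
  assumes d: "\<And>y. (p has_real_derivative p' y) (at y)" and x: "x \<noteq> 0"
  shows "(glue a p \<sigma> has_vector_derivative glue a p' (- \<sigma>) x) (at x)"
proof (cases "x > 0")
  case True
  have "((\<lambda>x. p (a + x)) has_real_derivative p' (a + x)) (at x)"
    by (rule DERIV_cong[OF DERIV_chain2[OF d]]) (auto intro!: derivative_eq_intros)
  then have "((\<lambda>x. of_real (p (a + x)) :: complex) has_vector_derivative of_real (p' (a + x))) (at x)"
    by (intro has_vector_derivative_of_real) (simp add: has_real_derivative_iff_has_vector_derivative)
  then have "(glue a p \<sigma> has_vector_derivative of_real (p' (a + x))) (at x)"
    by (rule has_vector_derivative_transform_within_open[of _ _ _ "{0<..}"]) (use True in \<open>auto simp: glue_def\<close>)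
  then show ?thesis using True by (simp add: glue_def)
next
  case False
  with x have x: "x < 0" by simp
  have "((\<lambda>x. \<sigma> * p (a - x)) has_real_derivative \<sigma> * (p' (a - x) * (0 - 1))) (at x)"
    by (intro DERIV_cmult DERIV_chain2[OF d] DERIV_diff DERIV_const DERIV_ident)
  then have "((\<lambda>x. of_real (\<sigma> * p (a - x)) :: complex) has_vector_derivative of_real (\<sigma> * (p' (a - x) * (0 - 1)))) (at x)"
    by (intro has_vector_derivative_of_real) (simp add: has_real_derivative_iff_has_vector_derivative)
  then have "(glue a p \<sigma> has_vector_derivative of_real (\<sigma> * (p' (a - x) * (0 - 1)))) (at x)"
    by (rule has_vector_derivative_transform_within_open[of _ _ _ "{..<0}"]) (use x in \<open>auto simp: glue_def\<close>)
  then show ?thesis using x by (simp add: glue_def)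
qed

lemma glue_continuous:
  assumes p: "continuous_on UNIV p" and a: "\<sigma> = 1 \<or> p a = 0"
  shows "continuous_on UNIV (glue a p \<sigma>)"
proof -
  have "continuous_on ({0..} \<union> {..0}) (\<lambda>x. if x \<ge> 0 then p (a + x) else \<sigma> * p (a - x))"
    by (rule continuous_on_cases) (use a in \<open>auto intro!: continuous_intros continuous_on_compose2[OF p]\<close>)
  moreover have "{0..} \<union> {..0} = (UNIV :: real set)" by auto
  ultimately show ?thesis unfolding glue_def[abs_def] by (intro continuous_on_of_real) simp
qed

lemma glue_eigenfunction:
  assumes k: "\<kappa> \<ge> s" and a: "\<sigma> = 1 \<or> jost \<kappa> a = 0"
    and j: "(1 + \<sigma>) * jost_deriv \<kappa> a = - Z * jost \<kappa> a"
  shows "glue a (jost \<kappa>) \<sigma> \<in> eigenspace (delta_domain Z) (schroedinger_op a) (s\<^sup>2 - \<kappa>\<^sup>2)"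
proof -
  define F0 where "F0 = glue a (jost \<kappa>) \<sigma>"
  define F1 where "F1 = glue a (jost_deriv \<kappa>) (- \<sigma>)"
  define F2 where "F2 = glue a (\<lambda>y. (\<kappa>\<^sup>2 - well y) * jost \<kappa> y) \<sigma>"
  have d: "(F0 has_vector_derivative F1 x) (at x)" "(F1 has_vector_derivative F2 x) (at x)" if "x \<noteq> 0" for x
    using glue_deriv[OF jost_has_derivative that] glue_deriv[OF jost_deriv_has_derivative[OF k] that, of a "- \<sigma>"]
    unfolding F0_def F1_def F2_def by auto
  have L2: "F0 \<in> L2_on \<Omega>" "F1 \<in> L2_on \<Omega>" "F2 \<in> L2_on \<Omega>" if "\<Omega> \<in> sets borel" for \<Omega>
    unfolding F0_def F1_def F2_def by (intro glue_L2 jost_decaying jost_deriv_decaying second_deriv_decaying k that)+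
  have F0c: "continuous_on UNIV F0" unfolding F0_def by (rule glue_continuous[OF jost_continuous a])
  have wU: "has_weak_deriv UNIV F0 F1"
    by (rule has_weak_deriv_piecewise[of _ "{0}"]) (use F0c d L2 in auto)
  have op: "open (- {0::real})" by auto
  have cont: "continuous_on (- {0}) F0" "continuous_on (- {0}) F1"
    using d by (auto intro!: continuous_at_imp_continuous_on has_vector_derivative_continuous)
  have w0: "has_weak_deriv (- {0}) F0 F1" "has_weak_deriv (- {0}) F1 F2"
    by (rule has_weak_deriv_piecewise[OF op, of "{}"]; use cont d L2 in auto)+
  have H1: "F0 \<in> H1_on UNIV" "F0 \<in> H1_on (- {0})" using wU w0 L2 by (auto simp: H1_on_def)
  define h1 where "h1 = weak_deriv (- {0}) F0"
  have wh1: "has_weak_deriv (- {0}) F0 h1" unfolding h1_def by (rule weak_deriv_has_weak_deriv[OF H1(2)])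
  have ae1: "AE x\<in>- {0} in lborel. F1 x = h1 x" by (rule weak_deriv_unique_AE[OF op w0(1) wh1])
  have wh2: "has_weak_deriv (- {0}) h1 F2"
    by (rule has_weak_deriv_cong_AE[OF w0(2) _ ae1]) (use wh1 in \<open>auto simp: has_weak_deriv_def L2_on_def\<close>)
  then have H1h: "h1 \<in> H1_on (- {0})" by (auto simp: H1_on_def has_weak_deriv_def)
  have ae2: "AE x\<in>- {0} in lborel. F2 x = weak_deriv (- {0}) h1 x"
    by (rule weak_deriv_unique_AE[OF op wh2 weak_deriv_has_weak_deriv[OF H1h]])
  have near: "\<forall>\<^sub>F x in at_right 0. x > (0::real)" "\<forall>\<^sub>F x in at_left 0. x < (0::real)"
    by (auto simp: eventually_at_filter)
  have tr: "trace_right h1 = of_real (jost_deriv \<kappa> a)"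
  proof (rule tendsto_cont_rep_right)
    show "continuous_on {0<..} F1" by (rule continuous_on_subset[OF cont(2)]) auto
    show "AE x\<in>{0<..} in lborel. F1 x = h1 x" using ae1 by eventually_elim auto
    show "(F1 \<longlongrightarrow> of_real (jost_deriv \<kappa> a)) (at_right 0)"
      using shifted_tendsto(1)[OF jost_deriv_continuous[OF k], of 1 a, unfolded mult_1]
      by (rule Lim_transform_eventually) (rule eventually_mono[OF near(1)], simp add: F1_def glue_def)
  qed
  have tl: "trace_left h1 = of_real (- \<sigma> * jost_deriv \<kappa> a)"
  proof (rule tendsto_cont_rep_left)
    show "continuous_on {..<0} F1" by (rule continuous_on_subset[OF cont(2)]) auto
    show "AE x\<in>{..<0} in lborel. F1 x = h1 x" using ae1 by eventually_elim auto
    have "((\<lambda>x. of_real (- \<sigma>) * of_real (jost_deriv \<kappa> (a - x))) \<longlongrightarrow> (of_real (- \<sigma> * jost_deriv \<kappa> a) :: complex)) (at_left 0)"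
      using shifted_tendsto(2)[OF jost_deriv_continuous[OF k], of "of_real (- \<sigma>)" a] by simp
    then show "(F1 \<longlongrightarrow> of_real (- \<sigma> * jost_deriv \<kappa> a)) (at_left 0)"
      by (rule Lim_transform_eventually) (rule eventually_mono[OF near(2)], simp add: F1_def glue_def)
  qed
  have cr: "cont_rep UNIV F0 0 = of_real (jost \<kappa> a)"
    using cont_rep_eq[OF open_UNIV F0c, of F0 0] by (simp add: F0_def glue_def)
  have "of_real (jost_deriv \<kappa> a) - of_real (- \<sigma> * jost_deriv \<kappa> a) = (of_real ((1 + \<sigma>) * jost_deriv \<kappa> a) :: complex)"
    by (simp add: algebra_simps)
  then have D: "F0 \<in> delta_domain Z"
    using H1 H1h tr tl cr j by (simp add: delta_domain_def H2_on_def h1_def)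
  have "AE x in lborel. x \<noteq> (0::real)" by (rule AE_lborel_singleton)
  then have "AE x in lborel. schroedinger_op a F0 x = of_real (s\<^sup>2 - \<kappa>\<^sup>2) * F0 x"
    using ae2
  proof eventually_elim
    case (elim x)
    then have "weak_deriv (- {0}) (weak_deriv (- {0}) F0) x = F2 x" by (simp add: h1_def)
    then show ?case unfolding schroedinger_op_def
      by (auto simp: F0_def F2_def glue_def algebra_simps abs_if)
  qed
  with D show ?thesis by (simp add: eigenspace_def F0_def)
qed

lemma glue_jost_nontrivial:
  assumes "\<kappa> \<ge> s" shows "\<not> (AE x in lborel. glue a (jost \<kappa>) \<sigma> x = 0)"
proof
  assume "AE x in lborel. glue a (jost \<kappa>) \<sigma> x = 0"
  then have ae: "AE x\<in>{0<..} in lborel. jost \<kappa> (a + x) = 0"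
    by eventually_elim (auto simp: glue_def)
  have "\<forall>\<^sub>F y in at_top. jost \<kappa> y > 0 \<and> y > a" by (intro eventually_conj jost_eventually_pos eventually_gt_at_top)
  then obtain y where y: "jost \<kappa> y > 0" "y > a" by (auto dest: eventually_happens)
  have "jost \<kappa> (a + (y - a)) = 0"
    by (rule continuous_AE_eq_imp_eq[OF _ _ _ ae]) (use y in \<open>auto intro!: continuous_on_compose2[OF jost_continuous[of UNIV]] continuous_intros\<close>)
  then show False using y by simp
qed

section \<open>Counting the negative eigenvalues\<close>

definition Dirichlet_rates :: "real \<Rightarrow> real set" where "Dirichlet_rates a = {\<kappa>. \<kappa> > s \<and> jost \<kappa> a = 0}"

definition Robin_rates :: "real \<Rightarrow> real set" where
  "Robin_rates a = {\<kappa>. \<kappa> > s \<and> jost_deriv \<kappa> a + Robin_const a * jost \<kappa> a = 0}"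

lemma AE_half_lines:
  assumes "AE x\<in>{0<..} in lborel. P x" "AE x\<in>{..<0} in lborel. P x" shows "AE x::real in lborel. P x"
proof -
  have "AE x in lborel. x \<noteq> (0::real)" by (rule AE_lborel_singleton)
  with assms show ?thesis
  proof eventually_elim
    case (elim x) then show ?case by (cases "x > 0") auto
  qed
qed

text \<open>
  The Jost function and its derivative do not vanish together at \<open>a\<close>. If the value vanishes, the jump
  condition forces opposite coefficients on the two sides; otherwise continuity forces equal ones.
\<close>
lemma eigenspace_line:
  assumes k: "\<kappa> \<in> Dirichlet_rates a \<union> Robin_rates a"
  shows "\<exists>g0 \<in> eigenspace (delta_domain (2 * Robin_const a)) (schroedinger_op a) (s\<^sup>2 - \<kappa>\<^sup>2). \<not> (AE x in lborel. g0 x = 0) \<and>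
     (\<forall>g \<in> eigenspace (delta_domain (2 * Robin_const a)) (schroedinger_op a) (s\<^sup>2 - \<kappa>\<^sup>2). \<exists>c. AE x in lborel. g x = c * g0 x)"
proof -
  have ks: "\<kappa> \<ge> s" using k by (auto simp: Dirichlet_rates_def Robin_rates_def)
  define \<sigma> :: real where "\<sigma> = (if jost \<kappa> a = 0 then - 1 else 1)"
  have j: "(1 + \<sigma>) * jost_deriv \<kappa> a = - (2 * Robin_const a) * jost \<kappa> a"
    using k by (auto simp: \<sigma>_def Dirichlet_rates_def Robin_rates_def algebra_simps)
  have g0: "glue a (jost \<kappa>) \<sigma> \<in> eigenspace (delta_domain (2 * Robin_const a)) (schroedinger_op a) (s\<^sup>2 - \<kappa>\<^sup>2)"
    by (rule glue_eigenfunction[OF ks _ j]) (simp add: \<sigma>_def)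
  moreover have "\<exists>c. AE x in lborel. g x = c * glue a (jost \<kappa>) \<sigma> x"
    if g: "g \<in> eigenspace (delta_domain (2 * Robin_const a)) (schroedinger_op a) (s\<^sup>2 - \<kappa>\<^sup>2)" for g
  proof -
    obtain cr cl where c: "AE x\<in>{0<..} in lborel. g x = cr * of_real (jost \<kappa> (a + x))"
      "AE x\<in>{..<0} in lborel. g x = cl * of_real (jost \<kappa> (a - x))"
      "cr * of_real (jost \<kappa> a) = cl * of_real (jost \<kappa> a)"
      "(cr + cl) * of_real (jost_deriv \<kappa> a) = - of_real (2 * Robin_const a) * cr * of_real (jost \<kappa> a)"
      using eigenfunction_structure[OF ks g] by blast
    have cl: "cl = of_real \<sigma> * cr"
    proof (cases "jost \<kappa> a = 0")
      case True
      then have "jost_deriv \<kappa> a \<noteq> 0" using jost_nontrivial[OF ks, of a] by simp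
      then have "cr + cl = 0" using c(4) True by simp
      then have "cl = - cr" by (metis add_eq_0_iff)
      then show ?thesis using True by (simp add: \<sigma>_def)
    next
      case False then show ?thesis using c(3) by (simp add: \<sigma>_def)
    qed
    have "AE x in lborel. g x = cr * glue a (jost \<kappa>) \<sigma> x"
    proof (rule AE_half_lines)
      show "AE x\<in>{0<..} in lborel. g x = cr * glue a (jost \<kappa>) \<sigma> x" using c(1) by eventually_elim (auto simp: glue_def)
      show "AE x\<in>{..<0} in lborel. g x = cr * glue a (jost \<kappa>) \<sigma> x" using c(2) by eventually_elim (auto simp: glue_def cl)
    qed
    then show ?thesis by blast
  qed
  ultimately show ?thesis using glue_jost_nontrivial[OF ks] by blast
qed

lemma negative_eigenvalue_rate:
  assumes "\<mu> < 0" "is_eigenvalue (delta_domain (2 * Robin_const a)) (schroedinger_op a) \<mu>"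
  shows "\<exists>\<kappa> \<in> Dirichlet_rates a \<union> Robin_rates a. \<mu> = s\<^sup>2 - \<kappa>\<^sup>2"
proof -
  define \<kappa> where "\<kappa> = sqrt (s\<^sup>2 - \<mu>)"
  have pos: "s\<^sup>2 - \<mu> \<ge> 0" using assms(1) zero_le_power2[of s] by linarith
  have \<mu>: "\<mu> = s\<^sup>2 - \<kappa>\<^sup>2" using pos by (simp add: \<kappa>_def)
  have ks: "\<kappa> > s" unfolding \<kappa>_def using assms(1) by (intro real_less_rsqrt) simp
  obtain g where g: "g \<in> eigenspace (delta_domain (2 * Robin_const a)) (schroedinger_op a) (s\<^sup>2 - \<kappa>\<^sup>2)" "\<not> (AE x in lborel. g x = 0)"
    using assms(2) unfolding is_eigenvalue_def \<mu> by blast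
  obtain cr cl where c: "AE x\<in>{0<..} in lborel. g x = cr * of_real (jost \<kappa> (a + x))"
    "AE x\<in>{..<0} in lborel. g x = cl * of_real (jost \<kappa> (a - x))"
    "cr * of_real (jost \<kappa> a) = cl * of_real (jost \<kappa> a)"
    "(cr + cl) * of_real (jost_deriv \<kappa> a) = - of_real (2 * Robin_const a) * cr * of_real (jost \<kappa> a)"
    using eigenfunction_structure[OF less_imp_le[OF ks] g(1)] by blast
  have "\<kappa> \<in> Dirichlet_rates a \<union> Robin_rates a"
  proof (cases "jost \<kappa> a = 0")
    case True then show ?thesis using ks by (simp add: Dirichlet_rates_def)
  next
    case False
    then have e: "cl = cr" using c(3) by simp
    have "cr \<noteq> 0"
    proof
      assume "cr = 0"
      have "AE x\<in>{0<..} in lborel. g x = 0" using c(1) by eventually_elim (simp add: \<open>cr = 0\<close>)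
      moreover have "AE x\<in>{..<0} in lborel. g x = 0" using c(2) by eventually_elim (simp add: e \<open>cr = 0\<close>)
      ultimately have "AE x in lborel. g x = 0" by (rule AE_half_lines)
      with g show False by blast
    qed
    have "2 * cr * of_real (jost_deriv \<kappa> a + Robin_const a * jost \<kappa> a)
        = (cr + cr) * of_real (jost_deriv \<kappa> a) - (- of_real (2 * Robin_const a) * cr * of_real (jost \<kappa> a))"
      by (simp add: algebra_simps)
    also have "\<dots> = 0" unfolding c(4)[unfolded e] by (rule diff_self)
    finally have "2 * cr * of_real (jost_deriv \<kappa> a + Robin_const a * jost \<kappa> a) = 0" .
    with \<open>cr \<noteq> 0\<close> have "jost_deriv \<kappa> a + Robin_const a * jost \<kappa> a = 0"
      unfolding mult_eq_0_iff of_real_eq_0_iff by simp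
    then show ?thesis using ks by (simp add: Robin_rates_def)
  qed
  then show ?thesis using \<mu> by blast
qed

text \<open>
  The energies \<open>s\<^sup>2 - \<kappa>\<^sup>2\<close> are injective in the rate, and every eigenspace is a line.
\<close>
lemma num_neg_eigenvalues_eq_card:
  assumes fin: "finite (Dirichlet_rates a \<union> Robin_rates a)"
  shows "num_neg_eigenvalues (delta_domain (2 * Robin_const a)) (schroedinger_op a) = enat (card (Dirichlet_rates a \<union> Robin_rates a))"
proof -
  let ?D = "delta_domain (2 * Robin_const a)" and ?A = "schroedinger_op a" and ?K = "Dirichlet_rates a \<union> Robin_rates a"
  have Ks: "\<kappa> > s" if "\<kappa> \<in> ?K" for \<kappa> using that by (auto simp: Dirichlet_rates_def Robin_rates_def)
  have ev: "{\<mu>. \<mu> < 0 \<and> is_eigenvalue ?D ?A \<mu>} = (\<lambda>\<kappa>. s\<^sup>2 - \<kappa>\<^sup>2) ` ?K"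
  proof (intro equalityI subsetI)
    fix \<mu> assume "\<mu> \<in> {\<mu>. \<mu> < 0 \<and> is_eigenvalue ?D ?A \<mu>}"
    then show "\<mu> \<in> (\<lambda>\<kappa>. s\<^sup>2 - \<kappa>\<^sup>2) ` ?K" using negative_eigenvalue_rate by blast
  next
    fix \<mu> assume "\<mu> \<in> (\<lambda>\<kappa>. s\<^sup>2 - \<kappa>\<^sup>2) ` ?K"
    then obtain \<kappa> where k: "\<kappa> \<in> ?K" "\<mu> = s\<^sup>2 - \<kappa>\<^sup>2" by blast
    have "s\<^sup>2 < \<kappa>\<^sup>2" using Ks[OF k(1)] s_pos by (intro power_strict_mono) auto
    then show "\<mu> \<in> {\<mu>. \<mu> < 0 \<and> is_eigenvalue ?D ?A \<mu>}"
      using eigenspace_line[OF k(1)] k(2) by (auto simp: is_eigenvalue_def)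
  qed
  have dim: "ae_dim (eigenspace ?D ?A (s\<^sup>2 - \<kappa>\<^sup>2)) = 1" if k: "\<kappa> \<in> ?K" for \<kappa>
    using eigenspace_line[OF k] by (auto intro: ae_dim_line)
  have inj: "inj_on (\<lambda>\<kappa>. s\<^sup>2 - \<kappa>\<^sup>2) ?K"
  proof (rule inj_onI)
    fix x y assume "x \<in> ?K" "y \<in> ?K" "s\<^sup>2 - x\<^sup>2 = s\<^sup>2 - y\<^sup>2"
    then show "x = y" using Ks[of x] Ks[of y] s_pos by (auto simp: power2_eq_iff)
  qed
  have "num_neg_eigenvalues ?D ?A = (\<Sum>\<mu>\<in>(\<lambda>\<kappa>. s\<^sup>2 - \<kappa>\<^sup>2) ` ?K. ae_dim (eigenspace ?D ?A \<mu>))"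
    unfolding num_neg_eigenvalues_def ev using fin by (intro infsum_finite) auto
  also have "\<dots> = (\<Sum>\<kappa>\<in>?K. ae_dim (eigenspace ?D ?A (s\<^sup>2 - \<kappa>\<^sup>2)))"
    by (simp add: sum.reindex[OF inj])
  also have "\<dots> = (\<Sum>\<kappa>\<in>?K. 1)" by (rule sum.cong) (use dim in auto)
  also have "\<dots> = enat (card ?K)" by (simp add: of_nat_eq_enat)
  finally show ?thesis .
qed

text \<open>
  A common Dirichlet and Robin rate would be a rate with vanishing value and derivative at \<open>a\<close>.
\<close>
lemma num_neg_eigenvalues_schroedinger_op:
  shows "a > 0 \<Longrightarrow> num_neg_eigenvalues (delta_domain (2 * Robin_const a)) (schroedinger_op a) = 1"
    and "a < 0 \<Longrightarrow> num_neg_eigenvalues (delta_domain (2 * Robin_const a)) (schroedinger_op a) = 2"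
proof -
  show "num_neg_eigenvalues (delta_domain (2 * Robin_const a)) (schroedinger_op a) = 1" if a: "a > 0"
  proof -
    obtain \<kappa> where "Robin_rates a = {\<kappa>}" 
    proof -
      obtain \<kappa> where "\<And>k. k \<in> Robin_rates a \<longleftrightarrow> k = \<kappa>"
        using Robin_unique[of a] a by (auto simp: Robin_rates_def Ex1_def)
      then show ?thesis using that by blast
    qed
    moreover have "Dirichlet_rates a = {}" using Dirichlet_none[OF a] by (auto simp: Dirichlet_rates_def)
    ultimately show ?thesis using num_neg_eigenvalues_eq_card[of a] by (simp add: one_enat_def)
  qed
  show "num_neg_eigenvalues (delta_domain (2 * Robin_const a)) (schroedinger_op a) = 2" if a: "a < 0"
  proof -
    obtain \<kappa>1 where k1: "Robin_rates a = {\<kappa>1}" 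
    proof -
      obtain \<kappa> where "\<And>k. k \<in> Robin_rates a \<longleftrightarrow> k = \<kappa>"
        using Robin_unique[of a] a by (auto simp: Robin_rates_def Ex1_def)
      then show ?thesis using that by blast
    qed
    obtain \<kappa>2 where k2: "Dirichlet_rates a = {\<kappa>2}" 
    proof -
      obtain \<kappa> where "\<And>k. k \<in> Dirichlet_rates a \<longleftrightarrow> k = \<kappa>"
        using Dirichlet_unique[OF a] by (auto simp: Dirichlet_rates_def Ex1_def)
      then show ?thesis using that by blast
    qed
    have "\<kappa>1 \<noteq> \<kappa>2"
    proof
      assume "\<kappa>1 = \<kappa>2"
      then have "\<kappa>1 \<in> Robin_rates a" "\<kappa>1 \<in> Dirichlet_rates a" using k1 k2 by simp_all
      then have "\<kappa>1 \<ge> s" "jost \<kappa>1 a = 0" "jost_deriv \<kappa>1 a + Robin_const a * jost \<kappa>1 a = 0"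
        unfolding Robin_rates_def Dirichlet_rates_def by simp_all
      then show False using jost_nontrivial[of \<kappa>1 a] by simp
    qed
    then show ?thesis using num_neg_eigenvalues_eq_card[of a] by (simp add: k1 k2 numeral_eq_enat)
  qed
qed

end

text \<open>
  The ratio is odd and continuous and tends to one; \<open>E = exp (2 * s * Y)\<close> is large enough for it to
  exceed \<open>\<bar>v\<bar>\<close> at \<open>Y\<close>.
\<close>
lemma (in soliton) slope_ratio_surj:
  assumes "\<bar>v\<bar> < 1" shows "\<exists>y. B * sinh (2 * s * y) / inv_square_amplitude y = v"
proof -
  define t where "t = (\<lambda>y. B * sinh (2 * s * y) - v * inv_square_amplitude y)"
  define r where "r = B * (1 - \<bar>v\<bar>)"
  have r: "r > 0" using assms B_pos by (simp add: r_def)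
  define E where "E = 2 * (A + B) / r + 1"
  have E: "E \<ge> 1" using r A_pos B_pos by (simp add: E_def)
  define Y where "Y = ln E / (2 * s)"
  have Y0: "Y \<ge> 0" unfolding Y_def using E s_pos by (intro divide_nonneg_pos) auto
  have eY: "exp (2 * s * Y) = E" using s_pos E by (simp add: Y_def)
  have eYm: "exp (- (2 * s * Y)) \<le> 1" using Y0 s_pos by simp
  have S: "sinh (2 * s * Y) = cosh (2 * s * Y) - exp (- (2 * s * Y))" by (simp add: sinh_def cosh_def field_simps)
  have C: "E / 2 \<le> cosh (2 * s * Y)" unfolding eY[symmetric] by (simp add: cosh_def)
  have "B * sinh (2 * s * Y) - \<bar>v\<bar> * inv_square_amplitude Y = r * cosh (2 * s * Y) - B * exp (- (2 * s * Y)) - \<bar>v\<bar> * A"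
    unfolding S inv_square_amplitude_def r_def by (simp add: algebra_simps)
  moreover have "r * (E / 2) \<le> r * cosh (2 * s * Y)" using r C by (intro mult_left_mono) auto
  moreover have "r * (E / 2) = A + B + r / 2" using r by (simp add: E_def field_simps)
  moreover have "B * exp (- (2 * s * Y)) \<le> B" "\<bar>v\<bar> * A \<le> A"
    using eYm B_pos A_pos assms by (auto simp: mult_left_le mult_left_le_one_le)
  ultimately have key: "B * sinh (2 * s * Y) > \<bar>v\<bar> * inv_square_amplitude Y" using r by linarith
  have up: "v * inv_square_amplitude Y \<le> \<bar>v\<bar> * inv_square_amplitude Y" "- (v * inv_square_amplitude Y) \<le> \<bar>v\<bar> * inv_square_amplitude Y"
    unfolding minus_mult_left using q_pos[of Y] by (intro mult_right_mono; simp)+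
  have even: "inv_square_amplitude (- Y) = inv_square_amplitude Y" by (simp add: inv_square_amplitude_def)
  have "t (- Y) \<le> 0" "0 \<le> t Y" using key up by (simp_all add: t_def even)
  moreover have "continuous_on {- Y..Y} t" unfolding t_def by (intro continuous_intros q_cont)
  ultimately obtain y where "t y = 0" using IVT'[of t "- Y" 0 Y] Y0 by auto
  then have "B * sinh (2 * s * y) / inv_square_amplitude y = v" using q_pos[of y] by (simp add: t_def field_simps)
  then show ?thesis by blast
qed

text \<open>
  The amplitude parameters of the soliton are \<open>A = - \<alpha> / \<omega>\<close> and \<open>B = sqrt (\<alpha>\<^sup>2 - \<beta> * \<omega>) / - \<omega>\<close>, and
  the bound on \<open>- \<omega>\<close> for negative \<open>l2\<close> says that the radicand is positive. The shift \<open>a\<close> satisfies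
  \<open>2 * Robin_const a = Z\<close>, so it has the sign of \<open>Z\<close>.
\<close>
theorem theorem9:
  fixes l1 l2 \<omega> Z :: real
  assumes "l1 > 0" and "\<omega> < 0"
    and "(l2 > 0 \<and> Z\<^sup>2 / 4 < - \<omega>) \<or>
         (l2 < 0 \<and> Z\<^sup>2 / 4 < - \<omega> \<and> - \<omega> < - (3 * l1\<^sup>2) / (16 * l2))"
  shows "(Z < 0 \<longrightarrow> num_neg_eigenvalues (delta_domain Z) (L1_op l1 l2 \<omega> Z) = 2) \<and>
         (Z > 0 \<longrightarrow> num_neg_eigenvalues (delta_domain Z) (L1_op l1 l2 \<omega> Z) = 1)"
proof -
  define \<alpha> \<beta> s where "\<alpha> = l1 / 4" and "\<beta> = l2 / 3" and "s = sqrt (- \<omega>)"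
  define D where "D = sqrt (\<alpha>\<^sup>2 - \<beta> * \<omega>)"
  define A B where "A = \<alpha> / s\<^sup>2" and "B = D / s\<^sup>2"
  have s: "s > 0" and s2: "s\<^sup>2 = - \<omega>" using assms(2) by (auto simp: s_def)
  have disc: "\<alpha>\<^sup>2 - \<beta> * \<omega> > 0"
    using assms(3)
  proof
    assume "l2 > 0 \<and> Z\<^sup>2 / 4 < - \<omega>"
    then have "\<beta> * \<omega> < 0" using assms(2) by (simp add: \<beta>_def mult_pos_neg)
    then show ?thesis using zero_le_power2[of \<alpha>] by linarith
  next
    assume "l2 < 0 \<and> Z\<^sup>2 / 4 < - \<omega> \<and> - \<omega> < - (3 * l1\<^sup>2) / (16 * l2)"
    then have l2: "16 * l2 < 0" and "3 * l1\<^sup>2 / (16 * l2) < \<omega>" by auto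
    then have "\<omega> * (16 * l2) < 3 * l1\<^sup>2" using iffD1[OF neg_divide_less_eq[OF l2]] by blast
    then have "16 * (l2 * \<omega>) < 3 * l1\<^sup>2" by (simp only: ac_simps)
    then show ?thesis by (simp add: \<alpha>_def \<beta>_def power_divide)
  qed
  have D: "D > 0" and D2: "D\<^sup>2 = \<alpha>\<^sup>2 + \<beta> * s\<^sup>2" using disc by (auto simp: D_def s2)
  interpret soliton s A B
    by unfold_locales (use s D assms(1) in \<open>auto simp: A_def B_def \<alpha>_def\<close>)
  have \<alpha>: "\<alpha> = s\<^sup>2 * A" and Ds: "D = s\<^sup>2 * B" using s by (simp_all add: A_def B_def)
  have \<beta>: "\<beta> = s\<^sup>2 * (B\<^sup>2 - A\<^sup>2)"
  proof -
    have "s\<^sup>2 * \<beta> = s\<^sup>2 * (s\<^sup>2 * (B\<^sup>2 - A\<^sup>2))" using D2 unfolding Ds \<alpha> by (simp add: algebra_simps power2_eq_square)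
    then show ?thesis using s unfolding mult_cancel_left by simp
  qed
  have R: "Rfun l1 l2 \<omega> y = B * sinh (2 * s * y) / inv_square_amplitude y" for y
  proof -
    have "Rfun l1 l2 \<omega> y = D * sinh (2 * s * y) / (\<alpha> + D * cosh (2 * s * y))"
      by (simp add: Rfun_def Let_def \<alpha>_def \<beta>_def D_def s_def)
    also have "\<dots> = (s\<^sup>2 * (B * sinh (2 * s * y))) / (s\<^sup>2 * inv_square_amplitude y)"
      unfolding Ds \<alpha> inv_square_amplitude_def by (simp add: algebra_simps)
    also have "\<dots> = B * sinh (2 * s * y) / inv_square_amplitude y" using s by simp
    finally show ?thesis .
  qed
  define a where "a = inv (Rfun l1 l2 \<omega>) (Z / (2 * s))"
  have Zs: "\<bar>Z / (2 * s)\<bar> < 1"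
  proof -
    have "Z\<^sup>2 < (2 * s)\<^sup>2" using assms(3) by (auto simp: power_mult_distrib s2)
    then have "\<bar>Z\<bar> < 2 * s" using s abs_le_square_iff[of "2 * s" Z] by (simp add: not_le[symmetric])
    then show ?thesis using s by (simp add: abs_mult)
  qed
  have Ra: "Rfun l1 l2 \<omega> a = Z / (2 * s)"
  proof -
    have "Z / (2 * s) \<in> range (Rfun l1 l2 \<omega>)" using slope_ratio_surj[OF Zs] R by (metis rangeI)
    then show ?thesis unfolding a_def by (rule f_inv_into_f)
  qed
  have ZR: "Z = 2 * Robin_const a"
  proof -
    have "Robin_const a = s * Rfun l1 l2 \<omega> a" by (simp add: R Robin_const_def)
    also have "\<dots> = Z / 2" unfolding Ra using s by simp
    finally show ?thesis by simp
  qed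
  have sign: "a > 0 \<longleftrightarrow> Z > 0" "a < 0 \<longleftrightarrow> Z < 0"
    unfolding ZR Robin_const_def using s B_pos q_pos[of a]
    by (auto simp: zero_less_divide_iff divide_less_0_iff zero_less_mult_iff mult_less_0_iff)
  have prof: "(profile l1 l2 \<omega> Z x)\<^sup>2 = 1 / inv_square_amplitude (\<bar>x\<bar> + a)" for x
  proof -
    have "profile l1 l2 \<omega> Z x = (- \<alpha> / \<omega> + D / (- \<omega>) * cosh (2 * s * (\<bar>x\<bar> + a))) powr (- 1 / 2)"
      by (simp add: profile_def Let_def \<alpha>_def \<beta>_def D_def s_def a_def)
    also have "- \<alpha> / \<omega> + D / (- \<omega>) * cosh (2 * s * (\<bar>x\<bar> + a)) = inv_square_amplitude (\<bar>x\<bar> + a)"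
    proof -
      have "- \<alpha> / \<omega> = A" "D / (- \<omega>) = B" by (simp_all add: A_def B_def s2)
      then show ?thesis by (simp only: inv_square_amplitude_def)
    qed
    finally have "(profile l1 l2 \<omega> Z x)\<^sup>2 = inv_square_amplitude (\<bar>x\<bar> + a) powr (- 1)"
      by (simp add: power2_eq_square powr_add[symmetric])
    then show ?thesis using q_pos[of "\<bar>x\<bar> + a"] by (simp add: powr_minus_divide)
  qed
  have pot: "\<omega> + 3 * l1 * (profile l1 l2 \<omega> Z x)\<^sup>2 + 5 * l2 * (profile l1 l2 \<omega> Z x) ^ 4 = well (\<bar>x\<bar> + a) - s\<^sup>2" for x
  proof -
    have p4: "(profile l1 l2 \<omega> Z x) ^ 4 = 1 / (inv_square_amplitude (\<bar>x\<bar> + a))\<^sup>2"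
      using arg_cong[OF prof[of x], of "\<lambda>t. t\<^sup>2"] by (simp add: power_divide flip: power_mult)
    have "l1 = 4 * s\<^sup>2 * A" "l2 = 3 * s\<^sup>2 * (B\<^sup>2 - A\<^sup>2)" using \<alpha> \<beta> by (simp_all add: \<alpha>_def \<beta>_def)
    then show ?thesis unfolding prof p4 well_def s2 by simp
  qed
  have "L1_op l1 l2 \<omega> Z = schroedinger_op a"
    unfolding L1_op_def schroedinger_op_def pot ..
  then show ?thesis
    using num_neg_eigenvalues_schroedinger_op[of a] sign ZR by metis
qed

end
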